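(* Let $(M,\boldsymbol{c},\sigma)$ be a Poincaré-Einstein manifold of dimension $n\ge3$, let $\gamma$ be a generalised geodesic of $(M,\boldsymbol{c},\sigma)$, and let $\Sigma^{ABC}$ be its associated 3-tractor. Suppose that $k_{bc}\in\Gamma(\mathcal{E}_{[bc]}[3])$ is a conformal Killing-Yano 2-form of $(M,\boldsymbol{c})$, i.e. $$\nabla_ak_{bc}=\nabla_{[a}k_{bc]}-\frac{2}{n-1}\mathbf{g}_{a[b}\nabla^pk_{c]p},$$ and let $\mathbb{K}_{ABC}=L(k)\in\Gamma(\Lambda^3\mathcal{T}^* )$, where $L$ is the BGG splitting operator. Then the function $$\Sigma^{ABC}\mathbb{K}_{ABC},$$ equivalently (up to a nonzero constant factor) $$\mathbf{u}^a\mathbf{a}^bk_{ab}\mp\frac{1}{n-1}\mathbf{u}^a\nabla^pk_{pa},$$ is a first integral of $\gamma$, i.e. it is constant along $\gamma$. Here $\mathbf{u}^a$ and $\mathbf{a}^a$ are the weighted velocity and acceleration of $\gamma$, with $\mathbf{u}^a\mathbf{u}_a=\pm1$ according to whether $\gamma$ is spacelike or timelike.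
   Context: Poincaré-Einstein: $M$ is a smooth connected $n$-manifold with boundary $\partial M$ and interior $\mathring M$, with an Einstein metric $\mathring g=r^{-2}g$ on $\mathring M$, where $g$ is a metric (of any signature) on all of $M$, nondegenerate up to $\partial M$, and $r$ is a defining function for $\partial M$: $\mathcal{Z}(r)=\partial M$ and $dr\ne0$ at all points of $\partial M$. Then $\boldsymbol{c}=[g]$ and $\sigma=r\sigma_g$ where $g=\sigma_g^{-2}\mathbf{g}$, so $\mathring g=\sigma^{-2}\mathbf{g}$ on $\mathring M$. Conventions. Abstract indices are used: $\mathcal{E}^a=TM$, $\mathcal{E}_a=T^*M$. Density bundles: $\mathcal{E}[w]=\big((\Lambda^nTM)^{2}\big)^{w/2n}$ for $w\in\mathbb{R}$, $\mathcal{E}_+[1]$ is the bundle of positive 1-densities, and $\mathcal{V}[w]=\mathcal{V}\otimes\mathcal{E}[w]$. $\mathcal{E}_{[bc]}[3]=\Lambda^2T^*M[3]$. The conformal metric $\mathbf{g}_{ab}\in\Gamma(\mathcal{E}_{(ab)}[2])$ is characterised by: each $g\in\boldsymbol{c}$ is $\sigma_g^{-2}\mathbf{g}$ for a unique $\sigma_g\in\Gamma(\mathcal{E}_+[1])$. Indices are raised and lowered with $\mathbf{g}$; the Levi-Civita connection $\nabla$ of $g\in\boldsymbol{c}$ acts on densities and preserves $\mathbf{g}$ and $\sigma_g$. $P_{ab}=\frac{1}{n-2}(\mathrm{Ric}_{ab}-J\mathbf{g}_{ab})$ is the Schouten tensor of $g$, $J=\mathbf{g}^{ab}P_{ab}$,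 $\Delta=\mathbf{g}^{ab}\nabla_a\nabla_b$. Tractors. The standard tractor bundle $\mathcal{T}$ is the rank $n+2$ bundle which, for each $g\in\boldsymbol{c}$, is identified with $\mathcal{E}[1]\oplus\mathcal{E}_a[1]\oplus\mathcal{E}[-1]$; for $\hat g=e^{2\omega}g$, $\Upsilon=d\omega$, the triples are related by $(\hat\sigma,\hat\mu_a,\hat\rho)=(\sigma,\ \mu_a+\Upsilon_a\sigma,\ \rho-\Upsilon^b\mu_b-\tfrac12\Upsilon^b\Upsilon_b\sigma)$. In a scale $g$ write $V^A=\sigma Y^A+\mu^aZ^A{}_a+\rho X^A$ for the triple $(\sigma,\mu_a,\rho)$; $X^A\in\Gamma(\mathcal{E}^A[1])$ is conformally invariant. The tractor connection is $\nabla_a(\sigma,\mu_b,\rho)=(\nabla_a\sigma-\mu_a,\ \nabla_a\mu_b+\mathbf{g}_{ab}\rho+P_{ab}\sigma,\ \nabla_a\rho-P_{ab}\mu^b)$. The tractor metric is $h(V,V')=\sigma\rho'+\mathbf{g}^{ab}\mu_a\mu'_b+\rho\sigma'$ and is used to raise and lower tractor indices (so $X^AY_A=1$, $Z^A{}_aZ_{Ab}=\mathbf{g}_{ab}$, other pairings of $X,Y,Z$ vanish). Scale tractor of $\sigma\in\Gamma(\mathcal{E}[1])$: $I=\big(\sigma,\ \nabla_a\sigma,\ -\tfrac1n(\Delta\sigma+J\sigma)\big)\in\Gamma(\mathcal{T})$ (conformally invariant). BGG splitting operator. For a conformal Killing-Yano 2-form $k_{bc}$ of weight 3, in a scale $g$,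 $$L(k)_{ABC}=3k_{bc}Y_{[A}Z_B{}^bZ_{C]}{}^c+m_{abc}Z_{[A}{}^aZ_B{}^bZ_{C]}{}^c+6n_cX_{[A}Y_BZ_{C]}{}^c+3r_{bc}X_{[A}Z_B{}^bZ_{C]}{}^c,$$ with $m_{abc}=\nabla_{[a}k_{bc]}$, $n_c=\frac{1}{n-1}\nabla^pk_{pc}$, $r_{bc}=\frac1n\big(-\nabla^am_{abc}+2\nabla_{[b}n_{c]}-Jk_{bc}+4P_{[b}{}^dk_{|d|c]}\big)$; this is conformally invariant. Curves. A curve is a smooth regular map from an interval to $M$. For a nowhere-null curve with velocity $u^a$ put $\sigma_u=\sqrt{\pm\mathbf{g}_{ab}u^au^b}$ ($+$ if spacelike, $-$ if timelike), weighted velocity $\mathbf{u}^a=\sigma_u^{-1}u^a$ (so $\mathbf{u}^a\mathbf{u}_a=\pm1$), and, in a scale $g\in\boldsymbol{c}$, weighted acceleration $\mathbf{a}^b=\mathbf{u}^a\nabla_a\mathbf{u}^b$. With $U^A=\sigma_u\mathbf{u}^a\nabla_a(\sigma_u^{-1}X^A)$ and $A^B=\sigma_u\mathbf{u}^a\nabla_aU^B$, the 3-tractor of $\gamma$ is $$\Sigma^{ABC}=6\sigma_u^{-1}X^{[A}U^BA^{C]}=\pm6\,\mathbf{u}^cX^{[A}Y^BZ^{C]}{}_c+6\,\mathbf{u}^b\mathbf{a}^cX^{[A}Z^B{}_bZ^{C]}{}_c ,$$ which is conformally invariant and parametrisation independent. Generalised geodesic of $(M,\boldsymbol{c},\sigma)$: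 a (nowhere-null) unparametrised curve with $I\wedge\Sigma=0$ at all of its points, where $I\wedge\Sigma:=I^{[A}\Sigma^{BCD]}$. *)

theory Defs
  imports "HOL-Analysis.Analysis"
begin

section \<open>Smooth maps on subsets of Euclidean space\<close>

primrec ck_on :: "nat \<Rightarrow> 'a::euclidean_space set \<Rightarrow> ('a \<Rightarrow> 'b::real_normed_vector) \<Rightarrow> bool" where
  "ck_on 0 W F \<longleftrightarrow> continuous_on W F"
| "ck_on (Suc k) W F \<longleftrightarrow> (\<forall>x\<in>W. F differentiable (at x)) \<and>
     (\<forall>e\<in>Basis. ck_on k W (\<lambda>x. frechet_derivative F (at x) e))"

text \<open>On a set that need not be open (a relatively open part of a half-space, an interval containing
  an end point) smooth means: locally the restriction of a smooth map on an open set.\<close>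

definition smooth_on :: "'a::euclidean_space set \<Rightarrow> ('a \<Rightarrow> 'b::real_normed_vector) \<Rightarrow> bool" where
  "smooth_on S f \<longleftrightarrow> (\<forall>x\<in>S. \<exists>W F. open W \<and> x \<in> W \<and> (\<forall>k. ck_on k W F) \<and> (\<forall>y\<in>S \<inter> W. F y = f y))"


section \<open>Manifolds with boundary\<close>

text \<open>The model half-space is \<open>{x. 0 \<le> x $ bindex}\<close>; which coordinate is used is immaterial.\<close>

definition bindex :: "'n::finite" where
  "bindex = (SOME i. True)"

definition halfspace :: "(real ^ 'n::finite) set" where
  "halfspace = {x. 0 \<le> x $ bindex}"

text \<open>A chart is a pair of an open set of points and a coordinate map. The manifold is the whole
  type \<open>'p\<close>, which is Hausdorff and second countable by its sort.\<close>

type_synonym ('p, 'n) chart = "'p set \<times> ('p \<Rightarrow> real ^ 'n)"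

abbreviation chart_dom :: "('p, 'n::finite) chart \<Rightarrow> 'p set" where
  "chart_dom ch \<equiv> fst ch"

abbreviation coord :: "('p, 'n::finite) chart \<Rightarrow> 'p \<Rightarrow> real ^ 'n" where
  "coord ch \<equiv> snd ch"

definition chart_ran :: "('p, 'n::finite) chart \<Rightarrow> (real ^ 'n) set" where
  "chart_ran ch = coord ch ` chart_dom ch"

definition point :: "('p, 'n::finite) chart \<Rightarrow> real ^ 'n \<Rightarrow> 'p" where
  "point ch = inv_into (chart_dom ch) (coord ch)"

definition transition :: "('p, 'n::finite) chart \<Rightarrow> ('p, 'n) chart \<Rightarrow> real ^ 'n \<Rightarrow> real ^ 'n" where
  "transition ch ch' x = coord ch' (point ch x)"

definition smooth_manifold ::
    "('p::{t2_space, second_countable_topology}, 'n::finite) chart set \<Rightarrow> bool" where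
  "smooth_manifold A \<longleftrightarrow>
     (\<Union>ch\<in>A. chart_dom ch) = UNIV \<and>
     (\<forall>ch\<in>A. open (chart_dom ch) \<and> openin (top_of_set halfspace) (chart_ran ch) \<and>
        homeomorphism (chart_dom ch) (chart_ran ch) (coord ch) (point ch)) \<and>
     (\<forall>ch\<in>A. \<forall>ch'\<in>A. smooth_on (coord ch ` (chart_dom ch \<inter> chart_dom ch')) (transition ch ch'))"

definition boundary :: "('p, 'n::finite) chart set \<Rightarrow> 'p set" where
  "boundary A = {p. \<exists>ch\<in>A. p \<in> chart_dom ch \<and> coord ch p $ bindex = 0}"

definition smooth_function :: "('p, 'n::finite) chart set \<Rightarrow> ('p \<Rightarrow> real) \<Rightarrow> bool" where
  "smooth_function A f \<longleftrightarrow> (\<forall>ch\<in>A. smooth_on (chart_ran ch) (\<lambda>x. f (point ch x)))"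

text \<open>Partial derivatives in coordinates; one-sided at boundary points.\<close>

definition pd :: "'n::finite \<Rightarrow> (real ^ 'n \<Rightarrow> real) \<Rightarrow> real ^ 'n \<Rightarrow> real" where
  "pd i f x = frechet_derivative f (at x within halfspace) (axis i 1)"

text \<open>\<open>jacobian ch ch' x $ k $ i\<close> is the derivative of the \<open>k\<close>-th coordinate of \<open>ch'\<close> in the direction
  of the \<open>i\<close>-th coordinate of \<open>ch\<close>.\<close>

definition jacobian :: "('p, 'n::finite) chart \<Rightarrow> ('p, 'n) chart \<Rightarrow> real ^ 'n \<Rightarrow> real ^ 'n ^ 'n" where
  "jacobian ch ch' x = matrix (frechet_derivative (transition ch ch') (at x within halfspace))"


section \<open>Weighted tensor fields\<close>

text \<open>A tensor field is given by its components in each chart, as functions of the coordinates; only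
  the values on \<open>chart_ran ch\<close> matter. The coordinates of a chart trivialise \<open>(\<Lambda>\<^sup>n TM)\<^sup>2\<close>, and hence the
  bundle of densities of weight \<open>w\<close>, its \<open>w / 2n\<close>-th power; a change of coordinates with Jacobian
  \<open>B\<close> multiplies the component of a \<open>w\<close>-density by \<open>\<bar>det B\<bar> powr (w / n)\<close>. Below, the law is
  written as a formula for the old components in terms of the new ones.\<close>

type_synonym ('p, 'n) tensor2 = "('p, 'n) chart \<Rightarrow> real ^ 'n \<Rightarrow> real ^ 'n ^ 'n"
type_synonym ('p, 'n) density = "('p, 'n) chart \<Rightarrow> real ^ 'n \<Rightarrow> real"

definition tensor2_field :: "('p, 'n::finite) chart set \<Rightarrow> real \<Rightarrow> ('p, 'n) tensor2 \<Rightarrow> bool" where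
  "tensor2_field A w t \<longleftrightarrow>
     (\<forall>ch\<in>A. smooth_on (chart_ran ch) (t ch)) \<and>
     (\<forall>ch\<in>A. \<forall>ch'\<in>A. \<forall>x\<in>coord ch ` (chart_dom ch \<inter> chart_dom ch').
        let B = jacobian ch ch' x in
        t ch x = (\<bar>det B\<bar> powr (- w / real CARD('n))) *\<^sub>R
                   (transpose B ** t ch' (transition ch ch' x) ** B))"

definition metric :: "('p, 'n::finite) chart set \<Rightarrow> ('p, 'n) tensor2 \<Rightarrow> bool" where
  "metric A g \<longleftrightarrow> tensor2_field A 0 g \<and>
     (\<forall>ch\<in>A. \<forall>x\<in>chart_ran ch. transpose (g ch x) = g ch x \<and> det (g ch x) \<noteq> 0)"

definition conformal_class ::
    "('p, 'n::finite) chart set \<Rightarrow> ('p, 'n) tensor2 \<Rightarrow> ('p, 'n) tensor2 set" where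
  "conformal_class A g = {g'. metric A g' \<and> (\<exists>\<omega>. smooth_function A \<omega> \<and>
     (\<forall>ch\<in>A. \<forall>x\<in>chart_ran ch. g' ch x = exp (2 * \<omega> (point ch x)) *\<^sub>R g ch x))}"


section \<open>Tensor calculus in one chart\<close>

text \<open>In this section \<open>G\<close> is the component matrix of a metric in one chart, and tensors are
  functions of their indices and of the coordinates. With \<open>scale_density G\<close> for the density
  \<open>\<sigma>\<^sub>g\<close>, \<open>cmetric G = \<sigma>\<^sub>g\<^sup>2 G\<close> is the conformal metric (weight 2); it has determinant of absolute
  value 1 in every chart, so it is the same for all metrics of a conformal class.\<close>

definition scale_density :: "(real ^ 'n \<Rightarrow> real ^ 'n ^ 'n) \<Rightarrow> real ^ 'n::finite \<Rightarrow> real" where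
  "scale_density G x = \<bar>det (G x)\<bar> powr (- 1 / (2 * real CARD('n)))"

definition cmetric :: "(real ^ 'n \<Rightarrow> real ^ 'n ^ 'n) \<Rightarrow> real ^ 'n::finite \<Rightarrow> real ^ 'n ^ 'n" where
  "cmetric G x = (scale_density G x)\<^sup>2 *\<^sub>R G x"

definition cinverse :: "(real ^ 'n \<Rightarrow> real ^ 'n ^ 'n) \<Rightarrow> real ^ 'n::finite \<Rightarrow> real ^ 'n ^ 'n" where
  "cinverse G x = matrix_inv (cmetric G x)"

text \<open>\<open>christoffel G k i j\<close> has upper index \<open>k\<close>.\<close>

definition christoffel ::
    "(real ^ 'n \<Rightarrow> real ^ 'n ^ 'n) \<Rightarrow> 'n \<Rightarrow> 'n \<Rightarrow> 'n \<Rightarrow> real ^ 'n::finite \<Rightarrow> real" where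
  "christoffel G k i j x = (\<Sum>l\<in>UNIV. matrix_inv (G x) $ k $ l *
     (pd i (\<lambda>y. G y $ j $ l) x + pd j (\<lambda>y. G y $ i $ l) x - pd l (\<lambda>y. G y $ i $ j) x)) / 2"

definition Ric :: "(real ^ 'n \<Rightarrow> real ^ 'n ^ 'n) \<Rightarrow> 'n \<Rightarrow> 'n \<Rightarrow> real ^ 'n::finite \<Rightarrow> real" where
  "Ric G i j x =
     (\<Sum>k\<in>UNIV. pd k (christoffel G k i j) x - pd i (christoffel G k k j) x) +
     (\<Sum>k\<in>UNIV. \<Sum>l\<in>UNIV. christoffel G k k l x * christoffel G l i j x
                        - christoffel G k i l x * christoffel G l k j x)"

text \<open>Solving \<open>(n - 2) P\<^sub>a\<^sub>b = Ric\<^sub>a\<^sub>b - J g\<^sub>a\<^sub>b\<close>, \<open>J = g\<^sup>a\<^sup>b P\<^sub>a\<^sub>b\<close> (with the conformal metric) for \<open>J\<close> gives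
  \<open>J = g\<^sup>a\<^sup>b Ric\<^sub>a\<^sub>b / (2 (n - 1))\<close>.\<close>

definition schouten_trace :: "(real ^ 'n \<Rightarrow> real ^ 'n ^ 'n) \<Rightarrow> real ^ 'n::finite \<Rightarrow> real" where
  "schouten_trace G x =
     (\<Sum>a\<in>UNIV. \<Sum>b\<in>UNIV. cinverse G x $ a $ b * Ric G a b x) / (2 * (real CARD('n) - 1))"

definition schouten :: "(real ^ 'n \<Rightarrow> real ^ 'n ^ 'n) \<Rightarrow> 'n \<Rightarrow> 'n \<Rightarrow> real ^ 'n::finite \<Rightarrow> real" where
  "schouten G a b x =
     (Ric G a b x - schouten_trace G x * cmetric G x $ a $ b) / (real CARD('n) - 2)"

text \<open>\<open>schouten_mixed G b d\<close> is \<open>P\<^sub>b\<^sup>d\<close>.\<close>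

definition schouten_mixed ::
    "(real ^ 'n \<Rightarrow> real ^ 'n ^ 'n) \<Rightarrow> 'n \<Rightarrow> 'n \<Rightarrow> real ^ 'n::finite \<Rightarrow> real" where
  "schouten_mixed G b d x = (\<Sum>e\<in>UNIV. cinverse G x $ d $ e * schouten G b e x)"

text \<open>The Levi-Civita connection on densities of weight \<open>w\<close> is \<open>\<partial>\<^sub>a + (w / n) \<Gamma>\<^sup>d\<^sub>d\<^sub>a\<close>. Below, \<open>cd_r G w\<close>
  is the Levi-Civita derivative of covariant tensors of rank \<open>r\<close> and weight \<open>w\<close>; its first index is
  the direction of differentiation.\<close>

definition density_form :: "(real ^ 'n \<Rightarrow> real ^ 'n ^ 'n) \<Rightarrow> real \<Rightarrow> 'n \<Rightarrow> real ^ 'n::finite \<Rightarrow> real" where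
  "density_form G w a x = w / real CARD('n) * (\<Sum>d\<in>UNIV. christoffel G d d a x)"

definition cd0 ::
    "(real ^ 'n \<Rightarrow> real ^ 'n ^ 'n) \<Rightarrow> real \<Rightarrow> (real ^ 'n \<Rightarrow> real) \<Rightarrow> 'n \<Rightarrow> real ^ 'n::finite \<Rightarrow> real" where
  "cd0 G w s a x = pd a s x + density_form G w a x * s x"

definition cd1 ::
    "(real ^ 'n \<Rightarrow> real ^ 'n ^ 'n) \<Rightarrow> real \<Rightarrow> ('n \<Rightarrow> real ^ 'n \<Rightarrow> real) \<Rightarrow>
     'n \<Rightarrow> 'n \<Rightarrow> real ^ 'n::finite \<Rightarrow> real" where
  "cd1 G w t a b x = pd a (t b) x + density_form G w a x * t b x
     - (\<Sum>e\<in>UNIV. christoffel G e a b x * t e x)"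

definition cd2 ::
    "(real ^ 'n \<Rightarrow> real ^ 'n ^ 'n) \<Rightarrow> real \<Rightarrow> ('n \<Rightarrow> 'n \<Rightarrow> real ^ 'n \<Rightarrow> real) \<Rightarrow>
     'n \<Rightarrow> 'n \<Rightarrow> 'n \<Rightarrow> real ^ 'n::finite \<Rightarrow> real" where
  "cd2 G w t a b c x = pd a (t b c) x + density_form G w a x * t b c x
     - (\<Sum>e\<in>UNIV. christoffel G e a b x * t e c x)
     - (\<Sum>e\<in>UNIV. christoffel G e a c x * t b e x)"

definition cd3 ::
    "(real ^ 'n \<Rightarrow> real ^ 'n ^ 'n) \<Rightarrow> real \<Rightarrow> ('n \<Rightarrow> 'n \<Rightarrow> 'n \<Rightarrow> real ^ 'n \<Rightarrow> real) \<Rightarrow>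
     'n \<Rightarrow> 'n \<Rightarrow> 'n \<Rightarrow> 'n \<Rightarrow> real ^ 'n::finite \<Rightarrow> real" where
  "cd3 G w t a b c d x = pd a (t b c d) x + density_form G w a x * t b c d x
     - (\<Sum>e\<in>UNIV. christoffel G e a b x * t e c d x)
     - (\<Sum>e\<in>UNIV. christoffel G e a c x * t b e d x)
     - (\<Sum>e\<in>UNIV. christoffel G e a d x * t b c e x)"

definition alt2 :: "('i \<Rightarrow> 'i \<Rightarrow> real) \<Rightarrow> 'i \<Rightarrow> 'i \<Rightarrow> real" where
  "alt2 T a b = (T a b - T b a) / 2"

definition alt3 :: "('i \<Rightarrow> 'i \<Rightarrow> 'i \<Rightarrow> real) \<Rightarrow> 'i \<Rightarrow> 'i \<Rightarrow> 'i \<Rightarrow> real" where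
  "alt3 T a b c = (T a b c + T b c a + T c a b - T b a c - T a c b - T c b a) / 6"

text \<open>The 24 signed permutations, grouped by the first argument.\<close>

definition alt4 :: "('i \<Rightarrow> 'i \<Rightarrow> 'i \<Rightarrow> 'i \<Rightarrow> real) \<Rightarrow> 'i \<Rightarrow> 'i \<Rightarrow> 'i \<Rightarrow> 'i \<Rightarrow> real" where
  "alt4 T a b c d = (alt3 (T a) b c d - alt3 (T b) a c d + alt3 (T c) a b d - alt3 (T d) a b c) / 4"


section \<open>Poincare-Einstein manifolds\<close>

definition rescale :: "('p \<Rightarrow> real) \<Rightarrow> ('p, 'n::finite) tensor2 \<Rightarrow> ('p, 'n) tensor2" where
  "rescale f g ch x = f (point ch x) *\<^sub>R g ch x"

definition einstein_on :: "('p, 'n::finite) chart set \<Rightarrow> 'p set \<Rightarrow> ('p, 'n) tensor2 \<Rightarrow> bool" where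
  "einstein_on A S h \<longleftrightarrow> (\<exists>\<Lambda>. \<forall>ch\<in>A. \<forall>x\<in>chart_ran ch. point ch x \<in> S \<longrightarrow>
     (\<forall>a b. Ric (h ch) a b x = \<Lambda> * h ch x $ a $ b))"

definition defining_function :: "('p, 'n::finite) chart set \<Rightarrow> ('p \<Rightarrow> real) \<Rightarrow> bool" where
  "defining_function A r \<longleftrightarrow> smooth_function A r \<and> {p. r p = 0} = boundary A \<and>
     (\<forall>ch\<in>A. \<forall>x\<in>chart_ran ch. point ch x \<in> boundary A \<longrightarrow> (\<exists>i. pd i (\<lambda>y. r (point ch y)) x \<noteq> 0))"

definition poincare_einstein ::
    "('p::{t2_space, second_countable_topology}, 'n::finite) chart set \<Rightarrow>
     ('p, 'n) tensor2 set \<Rightarrow> ('p, 'n) density \<Rightarrow> bool" where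
  "poincare_einstein A c \<sigma> \<longleftrightarrow>
     smooth_manifold A \<and> connected (UNIV :: 'p set) \<and>
     (\<exists>g r. metric A g \<and> defining_function A r \<and>
        einstein_on A (- boundary A) (rescale (\<lambda>p. 1 / (r p)\<^sup>2) g) \<and>
        c = conformal_class A g \<and>
        (\<forall>ch\<in>A. \<forall>x\<in>chart_ran ch. \<sigma> ch x = r (point ch x) * scale_density (g ch) x))"


section \<open>Conformal Killing-Yano 2-forms\<close>

text \<open>\<open>div2 G k a\<close> is \<open>\<nabla>\<^sup>p k\<^sub>p\<^sub>a\<close> for \<open>k\<close> of weight 3.\<close>

definition div2 ::
    "(real ^ 'n \<Rightarrow> real ^ 'n ^ 'n) \<Rightarrow> ('n \<Rightarrow> 'n \<Rightarrow> real ^ 'n \<Rightarrow> real) \<Rightarrow> 'n \<Rightarrow> real ^ 'n::finite \<Rightarrow> real" where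
  "div2 G k a x = (\<Sum>p\<in>UNIV. \<Sum>q\<in>UNIV. cinverse G x $ p $ q * cd2 G 3 k q p a x)"

definition comps :: "(real ^ 'n \<Rightarrow> real ^ 'n ^ 'n) \<Rightarrow> 'n \<Rightarrow> 'n \<Rightarrow> real ^ 'n::finite \<Rightarrow> real" where
  "comps k a b x = k x $ a $ b"

definition conformal_killing_yano ::
    "('p, 'n::finite) chart set \<Rightarrow> ('p, 'n) tensor2 set \<Rightarrow> ('p, 'n) tensor2 \<Rightarrow> bool" where
  "conformal_killing_yano A c k \<longleftrightarrow>
     tensor2_field A 3 k \<and>
     (\<forall>ch\<in>A. \<forall>x\<in>chart_ran ch. transpose (k ch x) = - k ch x) \<and>
     (\<forall>g\<in>c. \<forall>ch\<in>A. \<forall>x\<in>chart_ran ch. \<forall>a b d.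
        let G = g ch; K = comps (k ch) in
        cd2 G 3 K a b d x =
          alt3 (\<lambda>a b d. cd2 G 3 K a b d x) a b d
          - 2 / (real CARD('n) - 1) *
              alt2 (\<lambda>b d. cmetric G x $ a $ b * div2 G (\<lambda>p q. K q p) d x) b d)"


section \<open>Tractors\<close>

text \<open>In a scale \<open>g\<close> and a chart, a tractor \<open>\<sigma> Y + \<mu>\<^sup>a Z\<^sub>a + \<rho> X\<close> is the vector with entries
  \<open>\<sigma>\<close>, \<open>\<mu>\<^sup>a\<close>, \<open>\<rho>\<close> at the indices \<open>TY\<close>, \<open>TZ a\<close>, \<open>TX\<close>; so the middle slot carries an upper index, raised by
  the conformal metric. Tractors and tractor fields are given by such components in every scale of
  the conformal class; the splittings for different scales are related by the usual change of
  splitting, under which the constructions below are invariant.\<close>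

datatype 'n tindex = TY | TZ 'n | TX

instance tindex :: (finite) finite
proof
  have "(UNIV :: 'a tindex set) = insert TY (insert TX (range TZ))"
    using tindex.exhaust by auto
  then show "finite (UNIV :: 'a tindex set)"
    by (metis finite finite_imageI finite_insert)
qed

type_synonym 'n tractor = "real ^ 'n tindex"

definition trY :: "'n::finite tractor" where "trY = axis TY 1"
definition trZ :: "'n::finite \<Rightarrow> 'n tractor" where "trZ a = axis (TZ a) 1"
definition trX :: "'n::finite tractor" where "trX = axis TX 1"

definition mk_tractor :: "real \<Rightarrow> real ^ 'n \<Rightarrow> real \<Rightarrow> 'n::finite tractor" where
  "mk_tractor s m r = s *\<^sub>R trY + (\<Sum>a\<in>UNIV. m $ a *\<^sub>R trZ a) + r *\<^sub>R trX"

definition tractor_metric ::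
    "(real ^ 'n \<Rightarrow> real ^ 'n ^ 'n) \<Rightarrow> real ^ 'n \<Rightarrow> real ^ 'n::finite tindex ^ 'n tindex" where
  "tractor_metric G x = (\<chi> A B. case (A, B) of
       (TY, TX) \<Rightarrow> 1
     | (TX, TY) \<Rightarrow> 1
     | (TZ a, TZ b) \<Rightarrow> cmetric G x $ a $ b
     | _ \<Rightarrow> 0)"

text \<open>\<open>X\<^sub>A\<close>, \<open>Y\<^sub>A\<close> and \<open>Z\<^sub>A\<^sup>a\<close>.\<close>

definition lowX :: "(real ^ 'n \<Rightarrow> real ^ 'n ^ 'n) \<Rightarrow> real ^ 'n \<Rightarrow> 'n::finite tractor" where
  "lowX G x = tractor_metric G x *v trX"

definition lowY :: "(real ^ 'n \<Rightarrow> real ^ 'n ^ 'n) \<Rightarrow> real ^ 'n \<Rightarrow> 'n::finite tractor" where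
  "lowY G x = tractor_metric G x *v trY"

definition lowZ :: "(real ^ 'n \<Rightarrow> real ^ 'n ^ 'n) \<Rightarrow> 'n \<Rightarrow> real ^ 'n \<Rightarrow> 'n::finite tractor" where
  "lowZ G a x = tractor_metric G x *v (\<Sum>b\<in>UNIV. cinverse G x $ a $ b *\<^sub>R trZ b)"

definition wedge3 ::
    "real ^ 'i \<Rightarrow> real ^ 'i \<Rightarrow> real ^ 'i \<Rightarrow> 'i \<Rightarrow> 'i \<Rightarrow> 'i::finite \<Rightarrow> real" where
  "wedge3 u v w = alt3 (\<lambda>A B C. u $ A * v $ B * w $ C)"

definition scale_tractor ::
    "(real ^ 'n \<Rightarrow> real ^ 'n ^ 'n) \<Rightarrow> (real ^ 'n \<Rightarrow> real) \<Rightarrow> real ^ 'n \<Rightarrow> 'n::finite tractor" where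
  "scale_tractor G s x =
     (let m = cd0 G 1 s;
          laplacian = (\<Sum>a\<in>UNIV. \<Sum>b\<in>UNIV. cinverse G x $ a $ b * cd1 G 1 m a b x)
      in mk_tractor (s x) (cinverse G x *v (\<chi> a. m a x))
           (- (laplacian + schouten_trace G x * s x) / real CARD('n)))"

text \<open>The BGG splitting operator on 2-forms of weight 3.\<close>

definition bgg_m ::
    "(real ^ 'n \<Rightarrow> real ^ 'n ^ 'n) \<Rightarrow> ('n \<Rightarrow> 'n \<Rightarrow> real ^ 'n \<Rightarrow> real) \<Rightarrow>
     'n \<Rightarrow> 'n \<Rightarrow> 'n \<Rightarrow> real ^ 'n::finite \<Rightarrow> real" where
  "bgg_m G k a b c x = alt3 (\<lambda>a b c. cd2 G 3 k a b c x) a b c"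

definition bgg_n ::
    "(real ^ 'n \<Rightarrow> real ^ 'n ^ 'n) \<Rightarrow> ('n \<Rightarrow> 'n \<Rightarrow> real ^ 'n \<Rightarrow> real) \<Rightarrow>
     'n \<Rightarrow> real ^ 'n::finite \<Rightarrow> real" where
  "bgg_n G k c x = div2 G k c x / (real CARD('n) - 1)"

definition bgg_r ::
    "(real ^ 'n \<Rightarrow> real ^ 'n ^ 'n) \<Rightarrow> ('n \<Rightarrow> 'n \<Rightarrow> real ^ 'n \<Rightarrow> real) \<Rightarrow>
     'n \<Rightarrow> 'n \<Rightarrow> real ^ 'n::finite \<Rightarrow> real" where
  "bgg_r G k b c x =
     (- (\<Sum>a\<in>UNIV. \<Sum>d\<in>UNIV. cinverse G x $ a $ d * cd3 G 3 (bgg_m G k) d a b c x)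
      + 2 * alt2 (\<lambda>b c. cd1 G 1 (bgg_n G k) b c x) b c
      - schouten_trace G x * k b c x
      + 4 * alt2 (\<lambda>b c. \<Sum>d\<in>UNIV. schouten_mixed G b d x * k d c x) b c) / real CARD('n)"

definition bgg_splitting ::
    "(real ^ 'n \<Rightarrow> real ^ 'n ^ 'n) \<Rightarrow> ('n \<Rightarrow> 'n \<Rightarrow> real ^ 'n \<Rightarrow> real) \<Rightarrow> real ^ 'n \<Rightarrow>
     'n tindex \<Rightarrow> 'n tindex \<Rightarrow> 'n::finite tindex \<Rightarrow> real" where
  "bgg_splitting G k x A B C =
     3 * (\<Sum>b\<in>UNIV. \<Sum>c\<in>UNIV. k b c x * wedge3 (lowY G x) (lowZ G b x) (lowZ G c x) A B C)
     + (\<Sum>a\<in>UNIV. \<Sum>b\<in>UNIV. \<Sum>c\<in>UNIV.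
          bgg_m G k a b c x * wedge3 (lowZ G a x) (lowZ G b x) (lowZ G c x) A B C)
     + 6 * (\<Sum>c\<in>UNIV. bgg_n G k c x * wedge3 (lowX G x) (lowY G x) (lowZ G c x) A B C)
     + 3 * (\<Sum>b\<in>UNIV. \<Sum>c\<in>UNIV.
          bgg_r G k b c x * wedge3 (lowX G x) (lowZ G b x) (lowZ G c x) A B C)"


section \<open>Curves\<close>

definition regular_curve ::
    "('p::topological_space, 'n::finite) chart set \<Rightarrow> real set \<Rightarrow> (real \<Rightarrow> 'p) \<Rightarrow> bool" where
  "regular_curve A T \<gamma> \<longleftrightarrow>
     is_interval T \<and> interior T \<noteq> {} \<and> continuous_on T \<gamma> \<and>
     (\<forall>ch\<in>A. smooth_on {t\<in>T. \<gamma> t \<in> chart_dom ch} (\<lambda>t. coord ch (\<gamma> t)) \<and>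
        (\<forall>t\<in>T. \<gamma> t \<in> chart_dom ch \<longrightarrow> vector_derivative (\<lambda>t. coord ch (\<gamma> t)) (at t within T) \<noteq> 0))"

text \<open>From here on \<open>y\<close> is the coordinate expression of a curve defined on (a relatively open part of)
  the interval \<open>T\<close>. All derivatives are taken within \<open>T\<close>, hence one-sided at its end points.\<close>

definition velocity :: "real set \<Rightarrow> (real \<Rightarrow> real ^ 'n) \<Rightarrow> real \<Rightarrow> real ^ 'n::finite" where
  "velocity T y t = vector_derivative y (at t within T)"

definition causal_sign ::
    "(real ^ 'n \<Rightarrow> real ^ 'n ^ 'n) \<Rightarrow> real set \<Rightarrow> (real \<Rightarrow> real ^ 'n) \<Rightarrow> real \<Rightarrow> real" where
  "causal_sign G T y t = sgn (velocity T y t \<bullet> (cmetric G (y t) *v velocity T y t))"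

definition speed ::
    "(real ^ 'n \<Rightarrow> real ^ 'n ^ 'n) \<Rightarrow> real set \<Rightarrow> (real \<Rightarrow> real ^ 'n) \<Rightarrow> real \<Rightarrow> real" where
  "speed G T y t =
     sqrt (causal_sign G T y t * (velocity T y t \<bullet> (cmetric G (y t) *v velocity T y t)))"

text \<open>Covariant derivatives \<open>u\<^sup>a \<nabla>\<^sub>a\<close>, along the curve with velocity \<open>u\<close>, of densities, vector fields and
  tractors of weight \<open>w\<close>. The slots of a weight \<open>w\<close> tractor (with the middle index raised) have
  weights \<open>w + 1\<close>, \<open>w - 1\<close>, \<open>w - 1\<close>.\<close>

definition ddt_density ::
    "(real ^ 'n \<Rightarrow> real ^ 'n ^ 'n) \<Rightarrow> real set \<Rightarrow> (real \<Rightarrow> real ^ 'n) \<Rightarrow> real \<Rightarrow>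
     (real \<Rightarrow> real) \<Rightarrow> real \<Rightarrow> real" where
  "ddt_density G T y w s t = vector_derivative s (at t within T)
     + (\<Sum>a\<in>UNIV. velocity T y t $ a * density_form G w a (y t)) * s t"

definition ddt_vector ::
    "(real ^ 'n \<Rightarrow> real ^ 'n ^ 'n) \<Rightarrow> real set \<Rightarrow> (real \<Rightarrow> real ^ 'n) \<Rightarrow> real \<Rightarrow>
     (real \<Rightarrow> real ^ 'n) \<Rightarrow> real \<Rightarrow> real ^ 'n" where
  "ddt_vector G T y w v t = vector_derivative v (at t within T)
     + (\<Sum>a\<in>UNIV. velocity T y t $ a * density_form G w a (y t)) *\<^sub>R v t
     + (\<chi> b. \<Sum>a\<in>UNIV. \<Sum>d\<in>UNIV. christoffel G b a d (y t) * velocity T y t $ a * v t $ d)"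

definition ddt_tractor ::
    "(real ^ 'n \<Rightarrow> real ^ 'n ^ 'n) \<Rightarrow> real set \<Rightarrow> (real \<Rightarrow> real ^ 'n) \<Rightarrow> real \<Rightarrow>
     (real \<Rightarrow> 'n::finite tractor) \<Rightarrow> real \<Rightarrow> 'n tractor" where
  "ddt_tractor G T y w V t =
     (let u = velocity T y t;
          s = (\<lambda>t. V t $ TY);
          m = (\<lambda>t. \<chi> a. V t $ TZ a);
          r = (\<lambda>t. V t $ TX)
      in mk_tractor
           (ddt_density G T y (w + 1) s t - u \<bullet> (cmetric G (y t) *v m t))
           (ddt_vector G T y (w - 1) m t + r t *\<^sub>R u
              + s t *\<^sub>R (\<chi> b. \<Sum>a\<in>UNIV. u $ a * schouten_mixed G a b (y t)))
           (ddt_density G T y (w - 1) r t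
              - (\<Sum>a\<in>UNIV. \<Sum>b\<in>UNIV. schouten G a b (y t) * u $ a * m t $ b)))"

text \<open>The weighted velocity has weight -1.\<close>

definition wvelocity ::
    "(real ^ 'n \<Rightarrow> real ^ 'n ^ 'n) \<Rightarrow> real set \<Rightarrow> (real \<Rightarrow> real ^ 'n) \<Rightarrow> real \<Rightarrow> real ^ 'n::finite" where
  "wvelocity G T y t = (1 / speed G T y t) *\<^sub>R velocity T y t"

definition wacceleration ::
    "(real ^ 'n \<Rightarrow> real ^ 'n ^ 'n) \<Rightarrow> real set \<Rightarrow> (real \<Rightarrow> real ^ 'n) \<Rightarrow> real \<Rightarrow> real ^ 'n::finite" where
  "wacceleration G T y t = (1 / speed G T y t) *\<^sub>R ddt_vector G T y (- 1) (wvelocity G T y) t"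

text \<open>\<open>U\<close> and \<open>A\<close> have weight 0, and \<open>\<sigma>\<^sub>u \<^bold>u\<^sup>a \<nabla>\<^sub>a = u\<^sup>a \<nabla>\<^sub>a\<close>.\<close>

definition velocity_tractor ::
    "(real ^ 'n \<Rightarrow> real ^ 'n ^ 'n) \<Rightarrow> real set \<Rightarrow> (real \<Rightarrow> real ^ 'n) \<Rightarrow> real \<Rightarrow> 'n::finite tractor" where
  "velocity_tractor G T y = ddt_tractor G T y 0 (\<lambda>t. (1 / speed G T y t) *\<^sub>R trX)"

definition acceleration_tractor ::
    "(real ^ 'n \<Rightarrow> real ^ 'n ^ 'n) \<Rightarrow> real set \<Rightarrow> (real \<Rightarrow> real ^ 'n) \<Rightarrow> real \<Rightarrow> 'n::finite tractor" where
  "acceleration_tractor G T y = ddt_tractor G T y 0 (velocity_tractor G T y)"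

definition three_tractor ::
    "(real ^ 'n \<Rightarrow> real ^ 'n ^ 'n) \<Rightarrow> real set \<Rightarrow> (real \<Rightarrow> real ^ 'n) \<Rightarrow> real \<Rightarrow>
     'n tindex \<Rightarrow> 'n tindex \<Rightarrow> 'n::finite tindex \<Rightarrow> real" where
  "three_tractor G T y t A B C =
     6 / speed G T y t * wedge3 trX (velocity_tractor G T y t) (acceleration_tractor G T y t) A B C"

definition in_chart :: "('p, 'n::finite) chart \<Rightarrow> (real \<Rightarrow> 'p) \<Rightarrow> real \<Rightarrow> real ^ 'n" where
  "in_chart ch \<gamma> t = coord ch (\<gamma> t)"

definition generalised_geodesic ::
    "('p::topological_space, 'n::finite) chart set \<Rightarrow> ('p, 'n) tensor2 set \<Rightarrow> ('p, 'n) density \<Rightarrow>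
     real set \<Rightarrow> (real \<Rightarrow> 'p) \<Rightarrow> bool" where
  "generalised_geodesic A c \<sigma> T \<gamma> \<longleftrightarrow>
     regular_curve A T \<gamma> \<and>
     (\<forall>g\<in>c. \<forall>ch\<in>A. \<forall>t\<in>T. \<gamma> t \<in> chart_dom ch \<longrightarrow>
        causal_sign (g ch) T (in_chart ch \<gamma>) t \<noteq> 0 \<and>
        (\<forall>E B C D. alt4 (\<lambda>E B C D.
             scale_tractor (g ch) (\<sigma> ch) (in_chart ch \<gamma> t) $ E
             * three_tractor (g ch) T (in_chart ch \<gamma>) t B C D) E B C D = 0))"

text \<open>A quantity along a curve, computed in a scale and a chart, is a first integral if it has
  one and the same value for all scales, charts and parameters.\<close>

definition first_integral ::
    "('p, 'n::finite) chart set \<Rightarrow> ('p, 'n) tensor2 set \<Rightarrow> real set \<Rightarrow> (real \<Rightarrow> 'p) \<Rightarrow>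
     (('p, 'n) tensor2 \<Rightarrow> ('p, 'n) chart \<Rightarrow> real \<Rightarrow> real) \<Rightarrow> bool" where
  "first_integral A c T \<gamma> f \<longleftrightarrow>
     (\<exists>C. \<forall>g\<in>c. \<forall>ch\<in>A. \<forall>t\<in>T. \<gamma> t \<in> chart_dom ch \<longrightarrow> f g ch t = C)"

definition tractor_quantity ::
    "real set \<Rightarrow> (real \<Rightarrow> 'p) \<Rightarrow> ('p, 'n) tensor2 \<Rightarrow>
     ('p, 'n) tensor2 \<Rightarrow> ('p, 'n::finite) chart \<Rightarrow> real \<Rightarrow> real" where
  "tractor_quantity T \<gamma> k g ch t =
     (\<Sum>A\<in>UNIV. \<Sum>B\<in>UNIV. \<Sum>C\<in>UNIV.
        three_tractor (g ch) T (in_chart ch \<gamma>) t A B C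
        * bgg_splitting (g ch) (comps (k ch)) (in_chart ch \<gamma> t) A B C)"

definition tensor_quantity ::
    "real set \<Rightarrow> (real \<Rightarrow> 'p) \<Rightarrow> ('p, 'n) tensor2 \<Rightarrow>
     ('p, 'n) tensor2 \<Rightarrow> ('p, 'n::finite) chart \<Rightarrow> real \<Rightarrow> real" where
  "tensor_quantity T \<gamma> k g ch t =
     (let G = g ch; y = in_chart ch \<gamma>; u = wvelocity G T y t; a = wacceleration G T y t
      in u \<bullet> (k ch (y t) *v a)
         - causal_sign G T y t / (real CARD('n) - 1)
           * (\<Sum>b\<in>UNIV. u $ b * div2 G (comps (k ch)) b (y t)))"

end

theory Submission
  imports Defs
begin

text \<open>In the scale of \<open>\<sigma>\<close>, the condition \<open>I \<and> \<Sigma> = 0\<close> says that the curve is a geodesic of the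
  Einstein metric up to parametrisation, and the tensor quantity becomes the pairing of the unit
  velocity with \<open>\<nabla>\<^sup>pk\<^sub>p\<^sub>a\<close> up to a constant. Contracting the Ricci identity for a conformal
  Killing-Yano form on an Einstein manifold of dimension at least 3 shows that \<open>\<nabla>\<^sup>pk\<^sub>p\<^sub>a\<close> is a
  Killing covector, so the pairing is constant along geodesics. At a boundary point the condition
  forces the velocity to be conormal to the boundary; hence only end points of the curve can lie
  there, and they are reached by continuity.\<close>

section \<open>Partial derivatives\<close>

text \<open>No single scale serves everywhere. The Einstein metric is r^-2 times a metric of the
  class and exists only over interior points, where chart ranges are open and second derivatives are
  two-sided. The quantity in a scale of the class makes sense at all times, but contains the
  acceleration, so differentiating it directly would bring in third derivatives of the curve.
  Conservation is therefore proved in the Einstein scale alone, where only the velocity enters;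
  every scale of the class agrees with it pointwise up to the constant -1/(n-1), so charts too need
  comparing only there.

  The dimension bound comes from a trace: the symmetrised trace of the commutator is n-2 times the
  Killing operator plus a multiple of the metric, and a second trace removes that multiple. The
  Einstein condition turns the Ricci term into a multiple of the skew form itself, and pair symmetry
  makes the other curvature term skew, so neither survives.

  Weights are removed by powers of the parallel density of the metric, so only tensors of weight
  zero are commuted.\<close>

lemma has_derivative_line:
  assumes "F differentiable (at (p + s *\<^sub>R u))"
  shows "((\<lambda>s. F (p + s *\<^sub>R u)) has_vector_derivative
    frechet_derivative F (at (p + s *\<^sub>R u)) u) (at s)"
proof -
  have "(F has_derivative frechet_derivative F (at (p + s *\<^sub>R u))) (at (p + s *\<^sub>R u))"
    using assms frechet_derivative_works by blast
  moreover have "((\<lambda>s. p + s *\<^sub>R u) has_derivative (\<lambda>r. r *\<^sub>R u)) (at s)"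
    by (auto intro!: derivative_eq_intros)
  ultimately have "((F \<circ> (\<lambda>s. p + s *\<^sub>R u)) has_derivative
      frechet_derivative F (at (p + s *\<^sub>R u)) \<circ> (\<lambda>r. r *\<^sub>R u)) (at s)"
    using diff_chain_at by blast
  moreover have "frechet_derivative F (at (p + s *\<^sub>R u)) (r *\<^sub>R u) =
      r *\<^sub>R frechet_derivative F (at (p + s *\<^sub>R u)) u" for r
    using linear_frechet_derivative[OF assms] linear_cmul by blast
  ultimately show ?thesis
    by (simp add: has_vector_derivative_def o_def)
qed

text \<open>The mean value theorem is used twice: in the direction \<open>u\<close> for the
  difference of \<open>F\<close> along two parallel segments, then in the direction \<open>v\<close>
  for \<open>Du\<close>. The second difference itself is unchanged when \<open>u\<close> and
  \<open>v\<close> are exchanged, so the other order of derivatives expresses the same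
  number.\<close>

lemma second_difference:
  fixes F :: "'a::real_normed_vector \<Rightarrow> real" and u v :: 'a
  defines "Du \<equiv> \<lambda>y. frechet_derivative F (at y) u"
  assumes h: "h > 0"
    and box: "\<And>r s. 0 \<le> r \<Longrightarrow> r \<le> h \<Longrightarrow> 0 \<le> s \<Longrightarrow> s \<le> h \<Longrightarrow>
      F differentiable (at (x + r *\<^sub>R u + s *\<^sub>R v)) \<and> Du differentiable (at (x + r *\<^sub>R u + s *\<^sub>R v))"
  shows "\<exists>r s. 0 \<le> r \<and> r \<le> h \<and> 0 \<le> s \<and> s \<le> h \<and>
    F (x + h *\<^sub>R u + h *\<^sub>R v) - F (x + h *\<^sub>R u) - F (x + h *\<^sub>R v) + F x =
      h * (h * frechet_derivative Du (at (x + r *\<^sub>R u + s *\<^sub>R v)) v)"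
proof -
  define f where "f r = F ((x + h *\<^sub>R v) + r *\<^sub>R u) - F (x + r *\<^sub>R u)" for r
  have "\<exists>r>0. r < h \<and> f h - f 0 = (h - 0) * (Du ((x + h *\<^sub>R v) + r *\<^sub>R u) - Du (x + r *\<^sub>R u))"
  proof (rule MVT2[OF h])
    fix r assume r: "0 \<le> r" "r \<le> h"
    have "F differentiable (at ((x + h *\<^sub>R v) + r *\<^sub>R u))" "F differentiable (at (x + r *\<^sub>R u))"
      using box[OF r, of h] box[OF r, of 0] h by (simp_all add: algebra_simps)
    then have "(f has_vector_derivative Du ((x + h *\<^sub>R v) + r *\<^sub>R u) - Du (x + r *\<^sub>R u)) (at r)"
      unfolding f_def Du_def by (intro has_vector_derivative_diff has_derivative_line)
    then show "(f has_real_derivative Du ((x + h *\<^sub>R v) + r *\<^sub>R u) - Du (x + r *\<^sub>R u)) (at r)"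
      by (simp add: has_real_derivative_iff_has_vector_derivative)
  qed
  then obtain r where r: "0 < r" "r < h" and
    fr: "f h - f 0 = h * (Du ((x + h *\<^sub>R v) + r *\<^sub>R u) - Du (x + r *\<^sub>R u))" by auto
  have "\<exists>s>0. s < h \<and> Du ((x + r *\<^sub>R u) + h *\<^sub>R v) - Du ((x + r *\<^sub>R u) + 0 *\<^sub>R v) =
      (h - 0) * frechet_derivative Du (at ((x + r *\<^sub>R u) + s *\<^sub>R v)) v"
  proof (rule MVT2[OF h])
    fix s assume s: "0 \<le> s" "s \<le> h"
    have "Du differentiable (at ((x + r *\<^sub>R u) + s *\<^sub>R v))"
      using box[of r s] r s by simp
    then show "((\<lambda>s. Du ((x + r *\<^sub>R u) + s *\<^sub>R v)) has_real_derivative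
        frechet_derivative Du (at ((x + r *\<^sub>R u) + s *\<^sub>R v)) v) (at s)"
      unfolding has_real_derivative_iff_has_vector_derivative by (rule has_derivative_line)
  qed
  then obtain s where s: "0 < s" "s < h" and
    fs: "Du ((x + r *\<^sub>R u) + h *\<^sub>R v) - Du ((x + r *\<^sub>R u) + 0 *\<^sub>R v) =
      h * frechet_derivative Du (at ((x + r *\<^sub>R u) + s *\<^sub>R v)) v" by auto
  have "F (x + h *\<^sub>R u + h *\<^sub>R v) - F (x + h *\<^sub>R u) - F (x + h *\<^sub>R v) + F x = f h - f 0"
    by (simp add: f_def algebra_simps)
  also have "\<dots> = h * (h * frechet_derivative Du (at (x + r *\<^sub>R u + s *\<^sub>R v)) v)"
    using fr fs by (simp add: algebra_simps)
  finally show ?thesis using r s by (intro exI[of _ r] exI[of _ s]) auto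
qed

text \<open>Schwarz's theorem. The two mixed derivatives, taken at two possibly different points of
  a small parallelogram, both equal the second difference divided by the square of \<open>h\<close>;
  continuity at \<open>x\<close> compares each with its value at \<open>x\<close>.\<close>

lemma symmetric_second_derivative:
  fixes F :: "'a::real_normed_vector \<Rightarrow> real"
  defines "D \<equiv> \<lambda>u y. frechet_derivative F (at y) u"
  assumes W: "open W" "x \<in> W"
    and F: "\<And>y. y \<in> W \<Longrightarrow> F differentiable (at y)"
    and Du: "\<And>y. y \<in> W \<Longrightarrow> D u differentiable (at y)"
    and Dv: "\<And>y. y \<in> W \<Longrightarrow> D v differentiable (at y)"
    and cuv: "continuous_on W (\<lambda>y. frechet_derivative (D u) (at y) v)"
    and cvu: "continuous_on W (\<lambda>y. frechet_derivative (D v) (at y) u)"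
  shows "frechet_derivative (D u) (at x) v = frechet_derivative (D v) (at x) u" (is "?f x = ?g x")
proof -
  have "\<bar>?f x - ?g x\<bar> \<le> e" if e: "e > 0" for e
  proof -
    obtain d0 where d0: "d0 > 0" "ball x d0 \<subseteq> W" using W open_contains_ball by blast
    have "isCont ?f x" "isCont ?g x"
      using cuv cvu W by (auto simp: continuous_on_eq_continuous_at)
    then obtain d1 d2 where d1: "d1 > 0" "\<And>y. dist y x < d1 \<Longrightarrow> dist (?f y) (?f x) < e / 2"
      and d2: "d2 > 0" "\<And>y. dist y x < d2 \<Longrightarrow> dist (?g y) (?g x) < e / 2"
      using e half_gt_zero[OF e] unfolding continuous_at_eps_delta by (metis (no_types))
    define d where "d = min d0 (min d1 d2)"
    have d: "d > 0" using d0 d1 d2 by (simp add: d_def)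
    \<comment> \<open>With this \<open>h\<close> the whole parallelogram with sides
      \<open>h *\<^sub>R u\<close> and \<open>h *\<^sub>R v\<close> stays within distance
      \<open>d\<close> of \<open>x\<close>; the summand 1 covers the case u = v = 0.\<close>
    define h where "h = d / (norm u + norm v + 1)"
    have nz: "norm u + norm v + 1 > 0" by (smt (verit) norm_ge_zero)
    have h: "h > 0" using d nz by (simp add: h_def)
    have near: "dist (x + r *\<^sub>R a + s *\<^sub>R b) x < d"
      if "0 \<le> r" "r \<le> h" "0 \<le> s" "s \<le> h" "norm a + norm b = norm u + norm v" for r s a b
    proof -
      have "dist (x + r *\<^sub>R a + s *\<^sub>R b) x = norm (r *\<^sub>R a + s *\<^sub>R b)"
        by (simp add: dist_norm algebra_simps)
      also have "\<dots> \<le> r * norm a + s * norm b"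
        using norm_triangle_ineq[of "r *\<^sub>R a" "s *\<^sub>R b"] that by simp
      also have "\<dots> \<le> h * norm a + h * norm b"
        using that by (intro add_mono mult_right_mono) auto
      also have "\<dots> = h * (norm u + norm v)" using that(5) by (metis distrib_left)
      also have "\<dots> < h * (norm u + norm v + 1)" using h by simp
      also have "\<dots> = d" using nz by (simp add: h_def)
      finally show ?thesis .
    qed
    have inW: "x + r *\<^sub>R a + s *\<^sub>R b \<in> W"
      if "0 \<le> r" "r \<le> h" "0 \<le> s" "s \<le> h" "norm a + norm b = norm u + norm v" for r s a b
      using near[OF that] d0(2) by (auto simp: d_def dist_commute subset_iff)
    obtain r s where rs: "0 \<le> r" "r \<le> h" "0 \<le> s" "s \<le> h"
      "F (x + h *\<^sub>R u + h *\<^sub>R v) - F (x + h *\<^sub>R u) - F (x + h *\<^sub>R v) + F x =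
        h * (h * ?f (x + r *\<^sub>R u + s *\<^sub>R v))"
      using second_difference[OF h, of F x u v] inW[of _ _ u v] F Du unfolding D_def by force
    obtain r' s' where rs': "0 \<le> r'" "r' \<le> h" "0 \<le> s'" "s' \<le> h"
      "F (x + h *\<^sub>R v + h *\<^sub>R u) - F (x + h *\<^sub>R v) - F (x + h *\<^sub>R u) + F x =
        h * (h * ?g (x + r' *\<^sub>R v + s' *\<^sub>R u))"
      using second_difference[OF h, of F x v u] inW[of _ _ v u] F Dv unfolding D_def by force
    have "h * (h * ?f (x + r *\<^sub>R u + s *\<^sub>R v)) = h * (h * ?g (x + r' *\<^sub>R v + s' *\<^sub>R u))"
      using rs(5) rs'(5) by (simp add: algebra_simps)
    then have eq: "?f (x + r *\<^sub>R u + s *\<^sub>R v) = ?g (x + r' *\<^sub>R v + s' *\<^sub>R u)" using h by simp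
    have "dist (?f (x + r *\<^sub>R u + s *\<^sub>R v)) (?f x) < e / 2"
      by (rule d1(2)) (use near[OF rs(1-4), of u v] in \<open>simp add: d_def\<close>)
    moreover have "dist (?g (x + r' *\<^sub>R v + s' *\<^sub>R u)) (?g x) < e / 2"
      by (rule d2(2)) (use near[OF rs'(1-4), of v u] in \<open>simp add: d_def\<close>)
    ultimately have "dist (?f x) (?g x) < e"
      using eq dist_triangle_half_r by metis
    then show ?thesis by (simp add: dist_real_def)
  qed
  then have "\<bar>?f x - ?g x\<bar> \<le> 0" by (rule field_le_epsilon) auto
  then show ?thesis by simp
qed

text \<open>A positive step along a basis vector never decreases the coordinate that bounds the
  half-space. So each coordinate direction can be tested from inside, and one-sided partial
  derivatives are well defined at boundary points too.\<close>

lemma halfspace_derivative_unique: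
  fixes f :: "real ^ 'n::finite \<Rightarrow> 'b::real_normed_vector"
  assumes "x \<in> halfspace"
    and "(f has_derivative f') (at x within halfspace)" "(f has_derivative f'') (at x within halfspace)"
  shows "f' = f''"
proof (rule frechet_derivative_unique_within[OF assms(2,3)])
  fix i :: "real ^ 'n" and e :: real
  assume i: "i \<in> Basis" and e: "e > 0"
  then obtain j where j: "i = axis j 1" by (auto simp: Basis_vec_def)
  show "\<exists>d. 0 < \<bar>d\<bar> \<and> \<bar>d\<bar> < e \<and> x + d *\<^sub>R i \<in> halfspace"
    using assms(1) e j by (intro exI[of _ "e/2"]) (auto simp: halfspace_def axis_def)
qed

section \<open>Rules for one-sided partial derivatives\<close>

lemma pd_eqI:
  assumes "(f has_derivative f') (at x within halfspace)" "x \<in> halfspace"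
  shows "pd i f x = f' (axis i 1)"
  unfolding pd_def
  using halfspace_derivative_unique[OF assms(2,1)] assms(1) frechet_derivative_works differentiable_def
  by metis

lemma differentiable_has_pd:
  assumes "f differentiable (at x within halfspace)"
  shows "(f has_derivative (\<lambda>h. \<Sum>i\<in>UNIV. h $ i * pd i f x)) (at x within halfspace)"
proof -
  let ?D = "frechet_derivative f (at x within halfspace)"
  have D: "(f has_derivative ?D) (at x within halfspace)"
    using assms frechet_derivative_works by blast
  have "?D h = (\<Sum>i\<in>UNIV. h $ i * pd i f x)" for h
  proof -
    interpret linear ?D using assms linear_frechet_derivative by blast
    have "?D h = ?D (\<Sum>i\<in>UNIV. h $ i *\<^sub>R axis i 1)"
      by (simp add: basis_expansion flip: scalar_mult_eq_scaleR)
    then show ?thesis by (simp add: sum scaleR pd_def)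
  qed
  then have "?D = (\<lambda>h. \<Sum>i\<in>UNIV. h $ i * pd i f x)" by (rule ext)
  then show ?thesis using D by metis
qed

text \<open>Locality relative to the half-space: it lets smooth extensions and equations valid on a
  relatively open set be substituted under \<open>pd\<close>, at boundary points as well.\<close>

lemma pd_cong:
  assumes "openin (top_of_set halfspace) U" "x \<in> U" "\<And>y. y \<in> U \<Longrightarrow> f y = g y"
  shows "pd i f x = pd i g x"
    and "f differentiable (at x within halfspace) \<longleftrightarrow> g differentiable (at x within halfspace)"
proof -
  obtain V where V: "open V" "U = halfspace \<inter> V" using assms(1) openin_open by blast
  then obtain e where e: "e > 0" "ball x e \<subseteq> V" using assms(2) open_contains_ball by blast
  have eq: "f y = g y" if "y \<in> halfspace" "dist y x < e" for y
    using that V e assms(3) by (auto simp: dist_commute subset_iff)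
  have x: "x \<in> halfspace" using V assms(2) by auto
  have *: "(f has_derivative d) (at x within halfspace) \<longleftrightarrow> (g has_derivative d) (at x within halfspace)" for d
    using has_derivative_transform_within[OF _ e(1) x, of f d g]
      has_derivative_transform_within[OF _ e(1) x, of g d f] eq by auto
  show "pd i f x = pd i g x" by (simp add: pd_def frechet_derivative_def *)
  show "f differentiable (at x within halfspace) \<longleftrightarrow> g differentiable (at x within halfspace)"
    by (simp add: differentiable_def *)
qed

context
  fixes x :: "real ^ 'n::finite"
  assumes x: "x \<in> halfspace"
begin

lemma pd_const: "pd i (\<lambda>y. c) x = 0"
  using pd_eqI[OF has_derivative_const x] by simp

lemma pd_add:
  assumes "f differentiable (at x within halfspace)" "g differentiable (at x within halfspace)"
  shows "pd i (\<lambda>y. f y + g y) x = pd i f x + pd i g x"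
  using pd_eqI[OF has_derivative_add[OF assms[unfolded frechet_derivative_works]] x, of i]
  by (simp only: pd_def)

lemma pd_diff:
  assumes "f differentiable (at x within halfspace)" "g differentiable (at x within halfspace)"
  shows "pd i (\<lambda>y. f y - g y) x = pd i f x - pd i g x"
  using pd_eqI[OF has_derivative_diff[OF assms[unfolded frechet_derivative_works]] x, of i]
  by (simp only: pd_def)

lemma pd_minus:
  assumes "f differentiable (at x within halfspace)"
  shows "pd i (\<lambda>y. - f y) x = - pd i f x"
  using pd_eqI[OF has_derivative_minus[OF assms[unfolded frechet_derivative_works]] x, of i]
  by (simp only: pd_def)

lemma pd_mult:
  assumes "f differentiable (at x within halfspace)" "g differentiable (at x within halfspace)"
  shows "pd i (\<lambda>y. f y * g y) x = f x * pd i g x + pd i f x * g x"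
  using pd_eqI[OF has_derivative_mult[OF assms[unfolded frechet_derivative_works]] x, of i]
  by (simp only: pd_def)

lemma pd_sum:
  assumes "\<And>a. a \<in> I \<Longrightarrow> f a differentiable (at x within halfspace)"
  shows "pd i (\<lambda>y. \<Sum>a\<in>I. f a y) x = (\<Sum>a\<in>I. pd i (f a) x)"
  using pd_eqI[OF has_derivative_sum[OF assms[unfolded frechet_derivative_works]] x, of I "\<lambda>a. a" i]
  by (simp only: pd_def)

lemma pd_compose:
  assumes "f differentiable (at x within halfspace)" "(h has_real_derivative h') (at (f x))"
  shows "pd i (\<lambda>y. h (f y)) x = h' * pd i f x"
    and "(\<lambda>y. h (f y)) differentiable (at x within halfspace)"
proof -
  have *: "((\<lambda>y. h (f y)) has_derivative
      (\<lambda>z. h' * frechet_derivative f (at x within halfspace) z)) (at x within halfspace)"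
    using has_derivative_compose[OF assms(1)[unfolded frechet_derivative_works],
        of h "(*) h'"] assms(2) by (simp add: has_field_derivative_def)
  show "pd i (\<lambda>y. h (f y)) x = h' * pd i f x"
    using pd_eqI[OF * x] by (simp add: pd_def)
  show "(\<lambda>y. h (f y)) differentiable (at x within halfspace)"
    using * differentiable_def by blast
qed

end

text \<open>Metrics of every signature are allowed, so the determinant may have either sign. Near
  \<open>z\<close> the absolute value of \<open>w\<close> is the linear function
  \<open>sgn z * w\<close>.\<close>

lemma DERIV_abs_powr:
  fixes z c :: real
  assumes z: "z \<noteq> 0"
  shows "((\<lambda>z. \<bar>z\<bar> powr c) has_real_derivative c * sgn z * \<bar>z\<bar> powr (c - 1)) (at z)"
proof (rule has_field_derivative_transform_within_open)
  have pos: "sgn z * z > 0" using z by (simp add: sgn_if)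
  have "((\<lambda>w. w powr c) has_real_derivative c * (sgn z * z) powr (c - 1)) (at (sgn z * z))"
    using pos by (rule has_real_derivative_powr)
  from DERIV_chain2[OF this DERIV_cmult[OF DERIV_ident]]
  have "((\<lambda>w. (sgn z * w) powr c) has_real_derivative c * (sgn z * z) powr (c - 1) * (sgn z * 1)) (at z)" .
  moreover have "sgn z * z = \<bar>z\<bar>" by (simp add: abs_sgn mult.commute)
  ultimately show "((\<lambda>w. (sgn z * w) powr c) has_real_derivative c * sgn z * \<bar>z\<bar> powr (c - 1)) (at z)"
    by (simp only: mult.assoc mult_1_right mult.commute[of _ "sgn z"])
  show "open {w. w * z > 0}"
    by (intro open_Collect_less continuous_intros)
  show "z \<in> {w. w * z > 0}" using z by (auto simp: zero_less_mult_iff neq_iff)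
  show "(sgn z * w) powr c = \<bar>w\<bar> powr c" if "w \<in> {w. w * z > 0}" for w
    using that by (auto simp: sgn_if zero_less_mult_iff)
qed

text \<open>Exactly the regularity that the Ricci identity consumes: two derivatives, the second
  ones symmetric. It is inherited by products, quotients and real powers through the pointwise rules
  of calculus.\<close>

definition twice_diff :: "(real ^ 'n::finite) set \<Rightarrow> (real ^ 'n \<Rightarrow> real) \<Rightarrow> bool" where
  "twice_diff W f \<longleftrightarrow> (\<forall>x\<in>W. f differentiable (at x within halfspace) \<and>
     (\<forall>i. pd i f differentiable (at x within halfspace)) \<and>
     (\<forall>i j. pd i (pd j f) x = pd j (pd i f) x))"

lemma twice_diffD:
  assumes "twice_diff W f" "x \<in> W"
  shows "f differentiable (at x within halfspace)" "pd i f differentiable (at x within halfspace)"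
    "pd i (pd j f) x = pd j (pd i f) x"
  using assms by (auto simp: twice_diff_def)

lemma twice_diff_subset: "twice_diff W f \<Longrightarrow> V \<subseteq> W \<Longrightarrow> twice_diff V f"
  by (auto simp: twice_diff_def)

section \<open>Closure of \<open>twice_diff\<close> under algebra and composition\<close>

context
  fixes W :: "(real ^ 'n::finite) set"
  assumes W: "open W" "W \<subseteq> halfspace"
begin

lemma openin_W: "openin (top_of_set halfspace) W"
  using W by (metis inf.absorb_iff2 openin_open)

lemma inW: "x \<in> W \<Longrightarrow> x \<in> halfspace"
  using W by auto

lemmas pdcong = pd_cong[OF openin_W]

lemma twice_diff_cong:
  assumes "twice_diff W f" "\<And>y. y \<in> W \<Longrightarrow> f y = g y"
  shows "twice_diff W g"
proof -
  have 1: "pd i f y = pd i g y" if "y \<in> W" for i y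
    using pdcong(1)[OF that, of f g] assms(2) by auto
  have 2: "pd j (pd i f) y = pd j (pd i g) y" if "y \<in> W" for i j y
    using pdcong(1)[OF that, of "pd i f" "pd i g"] 1 by auto
  show ?thesis
    unfolding twice_diff_def
  proof (intro ballI conjI allI)
    fix x i j assume x: "x \<in> W"
    show "g differentiable (at x within halfspace)"
      using twice_diffD(1)[OF assms(1) x] pdcong(2)[OF x, of f g] assms(2) by blast
    show "pd i g differentiable (at x within halfspace)"
      using twice_diffD(2)[OF assms(1) x] pdcong(2)[OF x, of "pd i f" "pd i g"] 1 by blast
    show "pd i (pd j g) x = pd j (pd i g) x"
      using twice_diffD(3)[OF assms(1) x] 2[OF x] by metis
  qed
qed

lemma twice_diff_const: "twice_diff W (\<lambda>x. c)"
proof -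
  have 1: "pd i (\<lambda>x. c) y = 0" if "y \<in> W" for i y
    using pd_const[OF inW[OF that]] by auto
  have 2: "pd j (pd i (\<lambda>x. c)) y = 0" if "y \<in> W" for i j y
    using pdcong(1)[OF that, of "pd i (\<lambda>x. c)" "\<lambda>_. 0"] 1 pd_const[OF inW[OF that]] by auto
  have "pd i (\<lambda>x. c) differentiable (at y within halfspace)" if "y \<in> W" for i y
    using pdcong(2)[OF that, of "pd i (\<lambda>x. c)" "\<lambda>_. 0"] 1 by auto
  then show ?thesis by (simp add: twice_diff_def 2)
qed

lemma twice_diff_add:
  assumes f: "twice_diff W f" and g: "twice_diff W g"
  shows "twice_diff W (\<lambda>x. f x + g x)"
  unfolding twice_diff_def
proof (intro ballI conjI allI)
  fix x i j assume x: "x \<in> W"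
  note d = twice_diffD[OF f] twice_diffD[OF g]
  have 1: "pd i (\<lambda>x. f x + g x) y = pd i f y + pd i g y" if "y \<in> W" for i y
    using pd_add[OF inW[OF that]] d that by auto
  have 2: "pd j (pd i (\<lambda>x. f x + g x)) x = pd j (pd i f) x + pd j (pd i g) x" for i j
    using pdcong(1)[OF x, of "pd i (\<lambda>x. f x + g x)" "\<lambda>x. pd i f x + pd i g x" j] 1
    by (simp add: pd_add[OF inW[OF x]] d x)
  show "(\<lambda>x. f x + g x) differentiable (at x within halfspace)"
    using d x by (intro differentiable_add)
  show "pd i (\<lambda>x. f x + g x) differentiable (at x within halfspace)"
    using pdcong(2)[OF x, of "pd i (\<lambda>x. f x + g x)" "\<lambda>x. pd i f x + pd i g x"] 1 d x
    by (simp add: differentiable_add)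
  show "pd i (pd j (\<lambda>x. f x + g x)) x = pd j (pd i (\<lambda>x. f x + g x)) x"
    using 2 d(3,6) x by metis
qed

lemma twice_diff_mult:
  assumes f: "twice_diff W f" and g: "twice_diff W g"
  shows "twice_diff W (\<lambda>x. f x * g x)"
  unfolding twice_diff_def
proof (intro ballI conjI allI)
  fix x i j assume x: "x \<in> W"
  note d = twice_diffD[OF f] twice_diffD[OF g]
  have 1: "pd i (\<lambda>x. f x * g x) y = f y * pd i g y + pd i f y * g y" if "y \<in> W" for i y
    using pd_mult[OF inW[OF that]] d that by auto
  have D: "(\<lambda>x. f x * pd i g x) differentiable (at x within halfspace)"
    "(\<lambda>x. pd i f x * g x) differentiable (at x within halfspace)" for i
    using d x by (simp_all add: differentiable_mult)
  have 2: "pd j (pd i (\<lambda>x. f x * g x)) x =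
      f x * pd j (pd i g) x + pd j f x * pd i g x + (pd i f x * pd j g x + pd j (pd i f) x * g x)" for i j
    using pdcong(1)[OF x, of "pd i (\<lambda>x. f x * g x)" "\<lambda>x. f x * pd i g x + pd i f x * g x" j] 1
    by (simp add: pd_add[OF inW[OF x] D] pd_mult[OF inW[OF x]] d x)
  show "(\<lambda>x. f x * g x) differentiable (at x within halfspace)"
    using d x by (simp add: differentiable_mult)
  show "pd i (\<lambda>x. f x * g x) differentiable (at x within halfspace)"
    using pdcong(2)[OF x, of "pd i (\<lambda>x. f x * g x)" "\<lambda>x. f x * pd i g x + pd i f x * g x"] 1 D
    by (simp add: differentiable_add)
  show "pd i (pd j (\<lambda>x. f x * g x)) x = pd j (pd i (\<lambda>x. f x * g x)) x"
    using 2[of i j] 2[of j i] d(3,6)[OF x, of i j] by simp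
qed

lemma twice_diff_sum: "(\<And>a. a \<in> I \<Longrightarrow> twice_diff W (f a)) \<Longrightarrow> twice_diff W (\<lambda>x. \<Sum>a\<in>I. f a x)"
  by (induction I rule: infinite_finite_induct) (auto intro: twice_diff_const twice_diff_add)

lemma twice_diff_prod: "(\<And>a. a \<in> I \<Longrightarrow> twice_diff W (f a)) \<Longrightarrow> twice_diff W (\<lambda>x. \<Prod>a\<in>I. f a x)"
  by (induction I rule: infinite_finite_induct) (auto intro: twice_diff_const twice_diff_mult)

lemma twice_diff_compose:
  assumes f: "twice_diff W f"
    and h: "\<And>y. y \<in> W \<Longrightarrow> (h has_real_derivative h' (f y)) (at (f y))"
    and h': "\<And>y. y \<in> W \<Longrightarrow> (h' has_real_derivative h'' (f y)) (at (f y))"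
  shows "twice_diff W (\<lambda>x. h (f x))"
  unfolding twice_diff_def
proof (intro ballI conjI allI)
  fix x i j assume x: "x \<in> W"
  note d = twice_diffD[OF f]
  have 1: "pd i (\<lambda>x. h (f x)) y = h' (f y) * pd i f y" if "y \<in> W" for i y
    using pd_compose(1)[OF inW[OF that] d(1)[OF that] h[OF that]] .
  have D: "(\<lambda>x. h' (f x)) differentiable (at x within halfspace)"
    using pd_compose(2)[OF inW[OF x] d(1)[OF x] h'[OF x]] .
  have 2: "pd j (pd i (\<lambda>x. h (f x))) x =
      h' (f x) * pd j (pd i f) x + (h'' (f x) * pd j f x) * pd i f x" for i j
    using pdcong(1)[OF x, of "pd i (\<lambda>x. h (f x))" "\<lambda>x. h' (f x) * pd i f x" j] 1
    by (simp add: pd_mult[OF inW[OF x] D] d x pd_compose(1)[OF inW[OF x] d(1)[OF x] h'[OF x]])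
  show "(\<lambda>x. h (f x)) differentiable (at x within halfspace)"
    using pd_compose(2)[OF inW[OF x] d(1)[OF x] h[OF x]] .
  show "pd i (\<lambda>x. h (f x)) differentiable (at x within halfspace)"
    using pdcong(2)[OF x, of "pd i (\<lambda>x. h (f x))" "\<lambda>x. h' (f x) * pd i f x"] 1 D d x
    by (simp add: differentiable_mult)
  show "pd i (pd j (\<lambda>x. h (f x))) x = pd j (pd i (\<lambda>x. h (f x))) x"
    using 2[of i j] 2[of j i] d(3)[OF x, of i j] by (simp add: algebra_simps)
qed

lemma twice_diff_inverse:
  assumes "twice_diff W f" "\<And>y. y \<in> W \<Longrightarrow> f y \<noteq> 0"
  shows "twice_diff W (\<lambda>x. inverse (f x))"
  by (rule twice_diff_compose[OF assms(1), where h' = "\<lambda>z. - (inverse z * inverse z)" and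
        h'' = "\<lambda>z. 2 * inverse z * inverse z * inverse z"])
    (auto intro!: derivative_eq_intros simp: assms field_simps power2_eq_square)

lemma twice_diff_abs_powr:
  assumes "twice_diff W f" "\<And>y. y \<in> W \<Longrightarrow> f y \<noteq> 0"
  shows "twice_diff W (\<lambda>x. \<bar>f x\<bar> powr c)"
proof -
  have **: "((\<lambda>z. c * sgn z * \<bar>z\<bar> powr (c - 1)) has_real_derivative
      c * (c - 1) * \<bar>z\<bar> powr (c - 1 - 1)) (at z)" if "z \<noteq> 0" for z
  proof (rule has_field_derivative_transform_within_open)
    \<comment> \<open>The sign is constant near \<open>z\<close>, so only the power is
      differentiated; the two sign factors multiply to 1.\<close>
    have "((\<lambda>w. c * sgn z * \<bar>w\<bar> powr (c - 1)) has_real_derivative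
      c * sgn z * ((c - 1) * sgn z * \<bar>z\<bar> powr (c - 1 - 1))) (at z)"
      using DERIV_cmult[OF DERIV_abs_powr[OF that]] .
    moreover have "sgn z * sgn z = 1" using that by (simp add: sgn_if)
    ultimately show "((\<lambda>w. c * sgn z * \<bar>w\<bar> powr (c - 1)) has_real_derivative
      c * (c - 1) * \<bar>z\<bar> powr (c - 1 - 1)) (at z)"
      by (simp add: mult.assoc mult.left_commute)
    show "open {w. w * z > 0}"
      by (intro open_Collect_less continuous_intros)
    show "z \<in> {w. w * z > 0}" using that by (auto simp: zero_less_mult_iff neq_iff)
    show "c * sgn z * \<bar>w\<bar> powr (c - 1) = c * sgn w * \<bar>w\<bar> powr (c - 1)" if "w \<in> {w. w * z > 0}" for w
      using that by (auto simp: sgn_if zero_less_mult_iff)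
  qed
  show ?thesis
    by (rule twice_diff_compose[OF assms(1) DERIV_abs_powr **]) (use assms in auto)
qed

end

section \<open>From smooth maps to one-sided partial derivatives\<close>

lemma ck_on_cong:
  "open W \<Longrightarrow> (\<And>y. y \<in> W \<Longrightarrow> F y = G y) \<Longrightarrow> ck_on k W F \<longleftrightarrow> ck_on k W G"
proof (induction k arbitrary: F G)
  case 0
  then show ?case by (auto cong: continuous_on_cong)
next
  case (Suc k)
  have *: "(F has_derivative d) (at x) \<longleftrightarrow> (G has_derivative d) (at x)" if "x \<in> W" for x d
    using has_derivative_transform_within_open[OF _ Suc.prems(1) that, of F d _ G]
      has_derivative_transform_within_open[OF _ Suc.prems(1) that, of G d _ F] Suc.prems(2) by metis
  then have "ck_on k W (\<lambda>x. frechet_derivative F (at x) e) \<longleftrightarrow>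
      ck_on k W (\<lambda>x. frechet_derivative G (at x) e)" for e
    by (intro Suc.IH Suc.prems(1)) (simp add: frechet_derivative_def)
  then show ?case by (auto simp: differentiable_def *)
qed

lemma ck_on_bounded_linear:
  assumes L: "bounded_linear L" and "open W"
  shows "ck_on k W F \<Longrightarrow> ck_on k W (\<lambda>x. L (F x))"
proof (induction k arbitrary: F)
  case 0
  then show ?case using L by (simp add: bounded_linear.continuous_on)
next
  case (Suc k)
  have d: "((\<lambda>x. L (F x)) has_derivative (\<lambda>h. L (frechet_derivative F (at x) h))) (at x)" if "x \<in> W" for x
    using Suc.prems that by (intro bounded_linear.has_derivative[OF L]) (auto simp flip: frechet_derivative_works)
  have "ck_on k W (\<lambda>x. frechet_derivative (\<lambda>x. L (F x)) (at x) e)" if "e \<in> Basis" for e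
  proof -
    have "ck_on k W (\<lambda>x. L (frechet_derivative F (at x) e))"
      using Suc that by auto
    moreover have "L (frechet_derivative F (at x) e) = frechet_derivative (\<lambda>x. L (F x)) (at x) e"
      if "x \<in> W" for x
      using fun_cong[OF frechet_derivative_at[OF d[OF that]], of e] .
    ultimately show ?thesis
      by (rule ck_on_cong[OF \<open>open W\<close>, THEN iffD1, rotated]) 
  qed
  then show ?case using d by (auto simp: differentiable_def)
qed

lemma smooth_on_bounded_linear:
  "bounded_linear L \<Longrightarrow> smooth_on S f \<Longrightarrow> smooth_on S (\<lambda>x. L (f x))"
  unfolding smooth_on_def by (metis ck_on_bounded_linear)

lemma smooth_on_nth: "smooth_on S f \<Longrightarrow> smooth_on S (\<lambda>x. f x $ i)"
  by (rule smooth_on_bounded_linear[OF bounded_linear_vec_nth])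

lemma smooth_on_local_extension:
  assumes "smooth_on S f" "openin (top_of_set halfspace) S" "x \<in> S"
  obtains W F where "open W" "x \<in> W" "\<And>k. ck_on k W F" "openin (top_of_set halfspace) (S \<inter> W)"
    "\<And>y. y \<in> S \<inter> W \<Longrightarrow> F y = f y"
proof -
  have "\<exists>W F. open W \<and> x \<in> W \<and> (\<forall>k. ck_on k W F) \<and> (\<forall>y\<in>S \<inter> W. F y = f y)"
    using assms(1,3) by (simp add: smooth_on_def)
  then obtain W F where "open W \<and> x \<in> W \<and> (\<forall>k. ck_on k W F) \<and> (\<forall>y\<in>S \<inter> W. F y = f y)"
    by (elim exE)
  moreover from this have "openin (top_of_set halfspace) (S \<inter> W)"
    using assms(2) by (simp add: openin_Int_open)
  ultimately show ?thesis by (intro that[of W F]) auto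
qed

lemma pd_eq_frechet:
  assumes "F differentiable (at x)" "x \<in> halfspace"
  shows "pd i F x = frechet_derivative F (at x) (axis i 1)"
  using pd_eqI[OF has_derivative_at_withinI[OF assms(1)[unfolded frechet_derivative_works]] assms(2)] .

text \<open>Near each point \<open>f\<close> is the restriction of a smooth \<open>F\<close> on an
  open set, and the one-sided partial derivatives of \<open>f\<close> are the ordinary ones of
  \<open>F\<close>. This gives continuity up to the boundary. Second derivatives are taken only on
  open subsets, where Schwarz's theorem for \<open>F\<close> applies.\<close>

lemma smooth_on_pd:
  fixes f :: "real ^ 'n::finite \<Rightarrow> real"
  assumes "smooth_on S f" "openin (top_of_set halfspace) S"
  shows smooth_on_differentiable: "x \<in> S \<Longrightarrow> f differentiable (at x within halfspace)"
    and smooth_on_continuous_pd: "continuous_on S (pd i f)"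
    and smooth_on_twice_diff: "open V \<Longrightarrow> V \<subseteq> S \<Longrightarrow> twice_diff V f"
proof -
  have S: "S \<subseteq> halfspace" using openin_subset[OF assms(2)] by simp
  show "f differentiable (at x within halfspace)" if x: "x \<in> S" for x
  proof -
    obtain W F where F: "open W" "x \<in> W" "\<And>k. ck_on k W F" "openin (top_of_set halfspace) (S \<inter> W)"
      "\<And>y. y \<in> S \<inter> W \<Longrightarrow> F y = f y"
      by (rule smooth_on_local_extension[OF assms x]) blast
    have "F differentiable (at x)" using F(3)[of "Suc 0"] F(2) by simp
    then show ?thesis using pd_cong(2)[OF F(4), of x F f] F(2,5) x
      by (auto intro: differentiable_at_withinI)
  qed
  show "continuous_on S (pd i f)"
    unfolding continuous_on_eq_continuous_within
  proof
    fix x assume x: "x \<in> S"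
    obtain W F where F: "open W" "x \<in> W" "\<And>k. ck_on k W F" "openin (top_of_set halfspace) (S \<inter> W)"
      "\<And>y. y \<in> S \<inter> W \<Longrightarrow> F y = f y"
      by (rule smooth_on_local_extension[OF assms x]) blast
    have d: "\<And>y. y \<in> W \<Longrightarrow> F differentiable (at y)"
      and c: "continuous_on W (\<lambda>y. frechet_derivative F (at y) (axis i 1))"
      using F(3)[of "Suc 0"] by (auto simp: Basis_vec_def)
    have "continuous (at x within S) (\<lambda>y. frechet_derivative F (at y) (axis i 1))"
      using c F(1,2) continuous_at_imp_continuous_at_within continuous_on_eq_continuous_at by blast
    moreover have "frechet_derivative F (at y) (axis i 1) = pd i f y" if "y \<in> S \<inter> W" for y
      using pd_eq_frechet[OF d, of y i] pd_cong(1)[OF F(4) that, of F f i] F(5) that S by auto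
    moreover obtain e where e: "e > 0" "ball x e \<subseteq> W" using F(1,2) open_contains_ball by blast
    ultimately show "continuous (at x within S) (pd i f)"
      using continuous_transform_within[OF _ e(1) x, of _ "pd i f"]
      by (smt (verit) IntI dist_commute e(2) mem_ball subset_iff)
  qed
  show "twice_diff V f" if V: "open V" "V \<subseteq> S"
    unfolding twice_diff_def
  proof
    fix x assume "x \<in> V"
    then have x: "x \<in> S" using V by auto
    obtain W F where F: "open W" "x \<in> W" "\<And>k. ck_on k W F" "openin (top_of_set halfspace) (S \<inter> W)"
      "\<And>y. y \<in> S \<inter> W \<Longrightarrow> F y = f y"
      by (rule smooth_on_local_extension[OF assms x]) blast
    define U where "U = V \<inter> W"
    have U: "open U" "U \<subseteq> halfspace" "x \<in> U" "U \<subseteq> W" using V S F x \<open>x \<in> V\<close> by (auto simp: U_def)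
    have ax: "axis i 1 \<in> (Basis :: (real ^ 'n) set)" for i by (simp add: axis_in_Basis_iff)
    let ?D = "\<lambda>i y. frechet_derivative F (at y) (axis i 1)"
    have d: "\<And>y. y \<in> W \<Longrightarrow> F differentiable (at y)"
      and dd: "\<And>y i. y \<in> W \<Longrightarrow> ?D i differentiable (at y)"
      and c: "\<And>i j. continuous_on W (\<lambda>y. frechet_derivative (?D i) (at y) (axis j 1))"
      using F(3)[of "Suc (Suc 0)"] ax by auto
    have 1: "pd i F y = ?D i y" if "y \<in> U" for i y
      using pd_eq_frechet[OF d] that U by blast
    have 2: "pd j (pd i F) y = frechet_derivative (?D i) (at y) (axis j 1)" if y: "y \<in> U" for i j y
    proof -
      have "pd j (pd i F) y = pd j (?D i) y" by (rule pdcong(1)[OF U(1,2) y]) (rule 1)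
      also have "\<dots> = frechet_derivative (?D i) (at y) (axis j 1)"
        by (rule pd_eq_frechet[OF dd]) (use y U in auto)
      finally show ?thesis .
    qed
    have "twice_diff U F"
      unfolding twice_diff_def
    proof (intro ballI conjI allI)
      fix y i j assume y: "y \<in> U"
      show "F differentiable at y within halfspace" using d y U differentiable_at_withinI by blast
      show "pd i F differentiable at y within halfspace"
        using pdcong(2)[OF U(1,2) y, of "pd i F" "?D i"] 1 dd y U differentiable_at_withinI by blast
      show "pd i (pd j F) y = pd j (pd i F) y"
        unfolding 2[OF y] by (rule symmetric_second_derivative[OF F(1) _ d dd dd c c]) (use y U in auto)
    qed
    then have "twice_diff U f"
      by (rule twice_diff_cong[OF U(1,2)]) (use F(5) V U_def in blast)
    then show "f differentiable at x within halfspace \<and>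
      (\<forall>i. pd i f differentiable at x within halfspace) \<and> (\<forall>i j. pd i (pd j f) x = pd j (pd i f) x)"
      using U(3) by (auto simp: twice_diff_def)
  qed
qed

section \<open>Determinants and inverse matrices\<close>

lemma matrix_inv_right:
  fixes M :: "real ^ 'n::finite ^ 'n"
  assumes "det M \<noteq> 0"
  shows "M ** matrix_inv M = mat 1" "matrix_inv M ** M = mat 1"
proof -
  have "invertible M" using assms invertible_det_nz by blast
  then have "\<exists>A'. M ** A' = mat 1 \<and> A' ** M = mat 1" by (simp add: invertible_def)
  from someI_ex[OF this] show "M ** matrix_inv M = mat 1" "matrix_inv M ** M = mat 1"
    by (simp_all add: matrix_inv_def)
qed

lemma matrix_inv_sum:
  fixes M :: "real ^ 'n::finite ^ 'n"
  assumes "det M \<noteq> 0"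
  shows "(\<Sum>k\<in>UNIV. M $ i $ k * matrix_inv M $ k $ j) = (if i = j then 1 else 0)"
    "(\<Sum>k\<in>UNIV. matrix_inv M $ i $ k * M $ k $ j) = (if i = j then 1 else 0)"
proof -
  have "(M ** matrix_inv M) $ i $ j = mat 1 $ i $ j" "(matrix_inv M ** M) $ i $ j = mat 1 $ i $ j"
    using matrix_inv_right[OF assms] by simp_all
  then show "(\<Sum>k\<in>UNIV. M $ i $ k * matrix_inv M $ k $ j) = (if i = j then 1 else 0)"
    "(\<Sum>k\<in>UNIV. matrix_inv M $ i $ k * M $ k $ j) = (if i = j then 1 else 0)"
    by (simp_all add: matrix_matrix_mult_def mat_def)
qed

lemma matrix_inv_unique:
  fixes M :: "real ^ 'n::finite ^ 'n"
  assumes "M ** N = mat 1"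
  shows "matrix_inv M = N"
proof -
  have "det M * det N = 1" using assms by (metis det_I det_mul)
  then have "det M \<noteq> 0" by auto
  then show ?thesis
    using assms matrix_inv_right[of M] by (metis matrix_mul_assoc matrix_mul_lid matrix_mul_rid)
qed

lemma matrix_inv_sym:
  fixes M :: "real ^ 'n::finite ^ 'n"
  assumes "det M \<noteq> 0" "transpose M = M"
  shows "matrix_inv M $ i $ j = matrix_inv M $ j $ i"
proof -
  have "M ** transpose (matrix_inv M) = mat 1"
    using matrix_inv_right(2)[OF assms(1)] assms(2) by (metis matrix_transpose_mul transpose_mat)
  then have "matrix_inv M = transpose (matrix_inv M)" by (rule matrix_inv_unique)
  then show ?thesis by (metis (no_types, lifting) transpose_def vec_lambda_beta)
qed

text \<open>Cramer's rule. It writes an entry of the inverse as a polynomial in the entries divided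
  by the determinant, from which continuity and \<open>twice_diff\<close> of the inverse metric are
  read off.\<close>

lemma matrix_inv_cofactor:
  fixes M :: "real ^ 'n::finite ^ 'n"
  assumes "det M \<noteq> 0"
  shows "matrix_inv M $ k $ c =
    det (\<chi> i j. if j = k then (if i = c then 1 else 0) else M $ i $ j) * inverse (det M)"
proof -
  have "M *v (matrix_inv M *v axis c 1) = axis c 1"
    using matrix_inv_right(1)[OF assms] by (simp add: matrix_vector_mul_assoc)
  then have "matrix_inv M *v axis c 1 =
      (\<chi> k. det (\<chi> i j. if j = k then axis c 1 $ i else M $ i $ j) / det M)"
    using cramer[OF assms] by blast
  then have "(matrix_inv M *v axis c 1) $ k =
      det (\<chi> i j. if j = k then axis c 1 $ i else M $ i $ j) / det M" by simp
  moreover have "(\<chi> i j. if j = k then axis c 1 $ i else M $ i $ j) =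
      (\<chi> i j. if j = k then (if i = c then 1 else 0) else M $ i $ j)"
    by (simp add: vec_eq_iff axis_def)
  ultimately show ?thesis by (simp add: matrix_vector_mult_basis column_def divide_inverse)
qed

lemma continuous_on_det:
  assumes "\<And>i j. continuous_on S (\<lambda>x. M x $ i $ j)"
  shows "continuous_on S (\<lambda>x. det (M x :: real ^ 'n::finite ^ 'n))"
  unfolding det_def by (intro continuous_intros assms)

lemma continuous_on_matrix_inv:
  assumes M: "\<And>i j. continuous_on S (\<lambda>x. M x $ i $ j)" and "\<And>x. x \<in> S \<Longrightarrow> det (M x) \<noteq> 0"
  shows "continuous_on S (\<lambda>x. matrix_inv (M x :: real ^ 'n::finite ^ 'n) $ a $ b)"
proof -
  have "continuous_on S (\<lambda>x. if j = a then (if i = b then 1 else 0) else M x $ i $ j)" for i j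
    by (cases "j = a"; cases "i = b") (simp_all add: M)
  then have "continuous_on S (\<lambda>x. det (\<chi> i j. if j = a then (if i = b then 1 else 0) else M x $ i $ j)
      * inverse (det (M x)))"
    by (intro continuous_on_mult continuous_on_inverse continuous_on_det ballI)
      (simp_all add: M assms(2) del: if_split)
  then show ?thesis
    by (rule continuous_on_eq) (simp add: matrix_inv_cofactor assms(2))
qed

lemma twice_diff_det:
  assumes "open W" "W \<subseteq> halfspace" "\<And>i j. twice_diff W (\<lambda>x. M x $ i $ j)"
  shows "twice_diff W (\<lambda>x. det (M x :: real ^ 'n::finite ^ 'n))"
  unfolding det_def
  by (intro twice_diff_sum[OF assms(1,2)] twice_diff_mult[OF assms(1,2)]
      twice_diff_prod[OF assms(1,2)] twice_diff_const[OF assms(1,2)] assms(3))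

lemma twice_diff_matrix_inv:
  assumes W: "open W" "W \<subseteq> halfspace" and M: "\<And>i j. twice_diff W (\<lambda>x. M x $ i $ j)"
    and nz: "\<And>x. x \<in> W \<Longrightarrow> det (M x) \<noteq> 0"
  shows "twice_diff W (\<lambda>x. matrix_inv (M x :: real ^ 'n::finite ^ 'n) $ a $ b)"
proof -
  have "twice_diff W (\<lambda>x. if j = a then (if i = b then 1 else 0) else M x $ i $ j)" for i j
    by (cases "j = a"; cases "i = b") (simp_all add: M twice_diff_const[OF W])
  then have "twice_diff W (\<lambda>x. det (\<chi> i j. if j = a then (if i = b then 1 else 0) else M x $ i $ j)
      * inverse (det (M x)))"
    by (intro twice_diff_mult[OF W] twice_diff_inverse[OF W] twice_diff_det[OF W])
      (simp_all add: M nz del: if_split)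
  then show ?thesis
    by (rule twice_diff_cong[OF W]) (simp add: matrix_inv_cofactor nz)
qed

lemma differentiable_prod:
  fixes f :: "'i \<Rightarrow> 'a::real_normed_vector \<Rightarrow> real"
  assumes "\<And>i. i \<in> I \<Longrightarrow> f i differentiable (at x within S)"
  shows "(\<lambda>x. \<Prod>i\<in>I. f i x) differentiable (at x within S)"
  using has_derivative_prod[of I f "\<lambda>i. frechet_derivative (f i) (at x within S)" x S] assms
  unfolding differentiable_def by (metis assms frechet_derivative_works)

lemma differentiable_det:
  assumes "\<And>i j. (\<lambda>x. M x $ i $ j) differentiable (at x within S)"
  shows "(\<lambda>x. det (M x :: real ^ 'n::finite ^ 'n)) differentiable (at x within S)"
  unfolding det_def
  by (intro differentiable_sum differentiable_mult differentiable_prod assms differentiable_const)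
    (auto intro!: finite_permutations differentiable_mult differentiable_const differentiable_prod assms)

lemma pd_prod:
  fixes x :: "real ^ 'n::finite"
  assumes "finite I" "\<And>i. i \<in> I \<Longrightarrow> f i differentiable (at x within halfspace)" "x \<in> halfspace"
  shows "pd a (\<lambda>y. \<Prod>i\<in>I. f i y) x = (\<Sum>i\<in>I. pd a (f i) x * (\<Prod>j\<in>I-{i}. f j x))"
  using pd_eqI[OF has_derivative_prod[of I f "\<lambda>i. frechet_derivative (f i) (at x within halfspace)" x halfspace]
      assms(3), of a] assms(2)[unfolded frechet_derivative_works] by (simp add: pd_def)

text \<open>Replacing one row of \<open>M\<close> by its derivative gives, by Cramer's rule, \<open>det M\<close> times an entry of
  \<open>M\<inverse> M'\<close> on the diagonal.\<close>

lemma pd_det: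
  fixes M :: "real ^ 'n::finite \<Rightarrow> real ^ 'm::finite ^ 'm"
  assumes M: "\<And>i j. (\<lambda>x. M x $ i $ j) differentiable (at x within halfspace)"
    and x: "x \<in> halfspace" and nz: "det (M x) \<noteq> 0"
  shows "pd a (\<lambda>y. det (M y)) x =
    det (M x) * (\<Sum>i\<in>UNIV. \<Sum>j\<in>UNIV. matrix_inv (M x) $ j $ i * pd a (\<lambda>y. M y $ i $ j) x)"
proof -
  let ?d = "\<lambda>i j. pd a (\<lambda>y. M y $ i $ j) x"
  let ?P = "{p. p permutes (UNIV :: 'm set)}"
  have D: "(\<lambda>y. \<Prod>i\<in>UNIV. M y $ i $ p i) differentiable (at x within halfspace)" for p
    by (intro differentiable_prod M)
  have "pd a (\<lambda>y. det (M y)) x =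
      (\<Sum>p\<in>?P. of_int (sign p) * (\<Sum>i\<in>UNIV. ?d i (p i) * (\<Prod>j\<in>UNIV-{i}. M x $ j $ p j)))"
    unfolding det_def
    by (simp add: pd_sum[OF x] pd_mult[OF x] pd_const[OF x] pd_prod[OF _ _ x] D M differentiable_mult)
  \<comment> \<open>The product rule in Leibniz's formula differentiates one row at a time.\<close>
  also have "\<dots> = (\<Sum>i\<in>UNIV. det (\<chi> k. if k = i then (\<chi> j. ?d i j) else row k (M x)))"
  proof -
    have "(\<Prod>k\<in>UNIV. (if k = i then (\<chi> j. ?d i j) else row k (M x)) $ p k) =
        ?d i (p i) * (\<Prod>j\<in>UNIV-{i}. M x $ j $ p j)" for i p
      by (subst prod.remove[of _ i]) (auto simp: row_def intro!: prod.cong)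
    then show ?thesis
      unfolding det_def by (subst sum.swap) (simp add: sum_distrib_left)
  qed
  also have "\<dots> = (\<Sum>i\<in>UNIV. (\<Sum>j\<in>UNIV. matrix_inv (M x) $ j $ i * ?d i j) * det (M x))"
  proof (rule sum.cong[OF refl])
    fix i
    \<comment> \<open>The coefficients of the differentiated row in the basis of the rows of
      \<open>M x\<close>; replacing row \<open>i\<close> by this combination multiplies the
      determinant by \<open>c $ i\<close>.\<close>
    define c where "c = (\<chi> l. \<Sum>j\<in>UNIV. ?d i j * matrix_inv (M x) $ j $ l)"
    have "(\<Sum>l\<in>UNIV. c $ l *s row l (M x)) = (\<chi> j. ?d i j)"
    proof (rule vec_eq_iff[THEN iffD2], rule allI)
      fix j
      have "(\<Sum>l\<in>UNIV. c $ l *s row l (M x)) $ j =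
          (\<Sum>l\<in>UNIV. \<Sum>m\<in>UNIV. ?d i m * (matrix_inv (M x) $ m $ l * M x $ l $ j))"
        by (simp add: c_def row_def sum_distrib_right mult.assoc)
      also have "\<dots> = (\<Sum>m\<in>UNIV. ?d i m * (\<Sum>l\<in>UNIV. matrix_inv (M x) $ m $ l * M x $ l $ j))"
        by (subst sum.swap) (simp add: sum_distrib_left)
      also have "\<dots> = ?d i j" by (simp add: matrix_inv_sum[OF nz] if_distrib cong: if_cong)
      finally show "(\<Sum>l\<in>UNIV. c $ l *s row l (M x)) $ j = (\<chi> j. ?d i j) $ j" by simp
    qed
    then show "det (\<chi> k. if k = i then (\<chi> j. ?d i j) else row k (M x)) =
        (\<Sum>j\<in>UNIV. matrix_inv (M x) $ j $ i * ?d i j) * det (M x)"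
      using cramer_lemma_transpose[of i c "M x"] by (simp only:) (simp add: c_def mult.commute)
  qed
  also have "\<dots> = det (M x) * (\<Sum>i\<in>UNIV. \<Sum>j\<in>UNIV. matrix_inv (M x) $ j $ i * ?d i j)"
    by (simp add: sum_distrib_left mult.commute)
  finally show ?thesis .
qed

section \<open>Algebra of the curvature tensor\<close>

lemma sum_delta_left:
  fixes f :: "'n::finite \<Rightarrow> real"
  shows "(\<Sum>b\<in>UNIV. (if a = b then 1 else 0) * f b) = f a"
    and "(\<Sum>b\<in>UNIV. (if b = a then 1 else 0) * f b) = f a"
  by (simp_all add: if_distrib[of "\<lambda>z. z * _"] cong: if_cong)

lemma contraction:
  fixes H g :: "'n::finite \<Rightarrow> 'n \<Rightarrow> real"
  assumes "\<And>a c. (\<Sum>b\<in>UNIV. H a b * g b c) = (if a = c then 1 else 0)"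
  shows "(\<Sum>b\<in>UNIV. H a b * (\<Sum>c\<in>UNIV. g b c * v c)) = v a"
proof -
  have "(\<Sum>b\<in>UNIV. H a b * (\<Sum>c\<in>UNIV. g b c * v c)) =
      (\<Sum>b\<in>UNIV. \<Sum>c\<in>UNIV. H a b * g b c * v c)"
    by (simp add: sum_distrib_left mult.assoc)
  also have "\<dots> = (\<Sum>c\<in>UNIV. \<Sum>b\<in>UNIV. H a b * g b c * v c)" by (rule sum.swap)
  also have "\<dots> = (\<Sum>c\<in>UNIV. (\<Sum>b\<in>UNIV. H a b * g b c) * v c)"
    by (simp add: sum_distrib_right)
  finally show ?thesis by (simp only: assms sum_delta_left)
qed

lemma sum_sym_antisym:
  fixes H S :: "'n::finite \<Rightarrow> 'n \<Rightarrow> real"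
  assumes "\<And>a b. H a b = H b a" "\<And>a b. S b a = - S a b"
  shows "(\<Sum>a\<in>UNIV. \<Sum>b\<in>UNIV. H a b * S a b) = 0"
proof -
  have "(\<Sum>a\<in>UNIV. \<Sum>b\<in>UNIV. H a b * S a b) = (\<Sum>b\<in>UNIV. \<Sum>a\<in>UNIV. H a b * S a b)"
    by (rule sum.swap)
  also have "\<dots> = - (\<Sum>a\<in>UNIV. \<Sum>b\<in>UNIV. H a b * S a b)"
    by (subst assms(1), subst assms(2)) (simp add: sum_negf)
  finally show ?thesis by simp
qed

text \<open>The classical argument: pair symmetry is a linear consequence of the two skew symmetries
  and the Bianchi identity, taken at suitable permutations of the four indices.\<close>

lemma curvature_pair_symmetry:
  fixes R :: "'n \<Rightarrow> 'n \<Rightarrow> 'n \<Rightarrow> 'n \<Rightarrow> real"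
  assumes a12: "\<And>d a c b. R a d c b = - R d a c b"
    and a34: "\<And>d a c b. R d a b c = - R d a c b"
    and bianchi: "\<And>d a c b. R d a c b + R a b c d + R b d c a = 0"
  shows "R d a c b = R c b d a"
  using bianchi[of d a c b] bianchi[of c b d a] bianchi[of d c a b] bianchi[of a c d b]
    bianchi[of c b a d] bianchi[of d a b c]
    a12[of d a c b] a12[of a b c d] a12[of b d c a] a12[of c b d a] a12[of b a d c] a12[of a c d b]
    a12[of d c a b] a12[of c b a d] a12[of b d a c] a12[of a c b d] a12[of c d b a] a12[of d a b c]
    a34[of d a c b] a34[of a b c d] a34[of b d c a] a34[of c b d a] a34[of b a d c] a34[of a c d b]
    a34[of d c a b] a34[of c b a d] a34[of b d a c] a34[of a c b d] a34[of c d b a] a34[of d a b c]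
  by linarith

text \<open>The trace of the commutator of covariant derivatives of a conformal Killing-Yano form, with the
  Ricci and Weyl parts killed by the symmetrisation.\<close>

lemma killing_from_commutator:
  fixes H g N \<kappa> :: "'n::finite \<Rightarrow> 'n \<Rightarrow> real" and S F :: "'n \<Rightarrow> 'n \<Rightarrow> 'n \<Rightarrow> 'n \<Rightarrow> real"
  assumes card: "CARD('n) \<ge> 3"
    and H: "\<And>a b. H a b = H b a" and g: "\<And>a b. g a b = g b a"
    and Hg: "\<And>a c. (\<Sum>b\<in>UNIV. H a b * g b c) = (if a = c then 1 else 0)"
    and \<kappa>: "\<And>a b. \<kappa> b a = - \<kappa> a b"
    and S1: "\<And>d a b c. S d b a c = - S d a b c" and S2: "\<And>d a b c. S d a c b = - S d a b c"
    and F12: "\<And>d a e b. F a d e b = - F d a e b"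
    and F34: "\<And>d a b c. (\<Sum>e\<in>UNIV. g b e * F d a e c) = - (\<Sum>e\<in>UNIV. g c e * F d a e b)"
    and bianchi: "\<And>d a e b. F d a e b + F a b e d + F b d e a = 0"
    and einstein: "\<And>i j. (\<Sum>k\<in>UNIV. F k i k j) = \<Lambda> * g i j"
    and comm: "\<And>d a b c. S d a b c + g a b * N d c - g a c * N d b
        - (S a d b c + g d b * N a c - g d c * N a b) =
        - (\<Sum>e\<in>UNIV. F d a e b * \<kappa> e c) - (\<Sum>e\<in>UNIV. F d a e c * \<kappa> b e)"
  shows "N d c + N c d = 0"
proof -
  \<comment> \<open>The upper curvature index is lowered into third place. In this form the tensor
    has the classical symmetries, and pair symmetry becomes available.\<close>
  define R where "R d a c b = (\<Sum>e\<in>UNIV. g c e * F d a e b)" for d a c b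
  have R12: "R a d c b = - R d a c b" for d a c b
    unfolding R_def by (subst F12) (simp add: sum_negf)
  have R34: "R d a b c = - R d a c b" for d a b c
    unfolding R_def by (rule F34)
  have Rb: "R d a c b + R a b c d + R b d c a = 0" for d a c b
    unfolding R_def sum.distrib[symmetric] distrib_left[symmetric] bianchi by simp
  note pair = curvature_pair_symmetry[of R, OF R12 R34 Rb]
  have FR: "F d a e b = (\<Sum>f\<in>UNIV. H e f * R d a f b)" for d a e b
    unfolding R_def by (rule contraction[OF Hg, symmetric])
  \<comment> \<open>Raising the last index keeps the skewness in the last pair. It turns a trace
    over the second and fourth index into one over the second and third, which is a Ricci
    contraction.\<close>
  define Fu where "Fu d a e f = (\<Sum>b\<in>UNIV. F d a e b * H b f)" for d a e f
  have Fu: "Fu d a f e = - Fu d a e f" for d a e f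
  proof -
    have 1: "Fu d a e f = (\<Sum>b\<in>UNIV. \<Sum>c\<in>UNIV. H e c * R d a c b * H b f)" for e f
      by (simp add: Fu_def FR sum_distrib_right)
    have "Fu d a f e = (\<Sum>c\<in>UNIV. \<Sum>b\<in>UNIV. H f c * R d a c b * H b e)"
      by (subst 1, rule sum.swap)
    also have "\<dots> = (\<Sum>c\<in>UNIV. \<Sum>b\<in>UNIV. - (H e b * R d a b c * H c f))"
      by (intro sum.cong refl) (metis H R34 mult.commute mult_minus_left mult_minus_right mult.assoc)
    also have "\<dots> = - Fu d a e f" by (subst 1) (simp add: sum_negf)
    finally show ?thesis .
  qed
  \<comment> \<open>The trace of the curvature acting on the first index of the form. It reduces to
    the Ricci tensor, and the Einstein condition makes it \<Lambda> times the form, hence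
    skew.\<close>
  define P where "P d c = (\<Sum>a\<in>UNIV. \<Sum>b\<in>UNIV. H a b * (\<Sum>e\<in>UNIV. F d a e b * \<kappa> e c))" for d c
  have gH: "(\<Sum>b\<in>UNIV. g d b * H b e) = (if e = d then 1 else 0)" for d e
    using Hg[of e d] by (simp add: H[of e] g[of d] mult.commute)
  have P: "P d c = \<Lambda> * \<kappa> d c" for d c
  proof -
    have "P d c = (\<Sum>a\<in>UNIV. \<Sum>b\<in>UNIV. \<Sum>e\<in>UNIV. F d a e b * H b a * \<kappa> e c)"
      unfolding P_def by (intro sum.cong refl) (simp add: sum_distrib_left H[of _ "_"] mult.commute mult.left_commute)
    also have "\<dots> = (\<Sum>a\<in>UNIV. \<Sum>e\<in>UNIV. \<Sum>b\<in>UNIV. F d a e b * H b a * \<kappa> e c)"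
      by (rule sum.cong[OF refl], rule sum.swap)
    also have "\<dots> = (\<Sum>a\<in>UNIV. \<Sum>e\<in>UNIV. Fu d a e a * \<kappa> e c)"
      by (simp add: Fu_def sum_distrib_right)
    also have "\<dots> = (\<Sum>e\<in>UNIV. \<Sum>a\<in>UNIV. - (Fu d a a e * \<kappa> e c))"
      by (subst sum.swap) (simp add: Fu[of d _ _ _, symmetric] flip: mult_minus_left)
    also have "\<dots> = (\<Sum>e\<in>UNIV. - (\<Sum>b\<in>UNIV. (\<Sum>a\<in>UNIV. F d a a b) * H b e) * \<kappa> e c)"
    proof (intro sum.cong refl)
      fix e
      have "(\<Sum>a\<in>UNIV. Fu d a a e) = (\<Sum>b\<in>UNIV. (\<Sum>a\<in>UNIV. F d a a b) * H b e)"
        unfolding Fu_def by (subst sum.swap) (simp add: sum_distrib_right)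
      then show "(\<Sum>a\<in>UNIV. - (Fu d a a e * \<kappa> e c)) =
          - (\<Sum>b\<in>UNIV. (\<Sum>a\<in>UNIV. F d a a b) * H b e) * \<kappa> e c"
        by (simp add: sum_negf sum_distrib_right[symmetric])
    qed
    also have "\<dots> = (\<Sum>e\<in>UNIV. \<Lambda> * ((if e = d then 1 else 0) * \<kappa> e c))"
    proof (intro sum.cong refl)
      fix e
      have "(\<Sum>a\<in>UNIV. F d a a b) = - (\<Lambda> * g d b)" for b
        by (subst F12) (simp add: sum_negf einstein)
      then have "- (\<Sum>b\<in>UNIV. (\<Sum>a\<in>UNIV. F d a a b) * H b e) = \<Lambda> * (\<Sum>b\<in>UNIV. g d b * H b e)"
        by (simp add: sum_negf sum_distrib_left mult.assoc)
      then show "- (\<Sum>b\<in>UNIV. (\<Sum>a\<in>UNIV. F d a a b) * H b e) * \<kappa> e c =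
          \<Lambda> * ((if e = d then 1 else 0) * \<kappa> e c)"
        by (simp only: gH mult.assoc)
    qed
    also have "\<dots> = \<Lambda> * \<kappa> d c" by (simp only: sum_distrib_left[symmetric] sum_delta_left)
    finally show ?thesis .
  qed
  define k where "k a f = (\<Sum>b\<in>UNIV. \<Sum>e\<in>UNIV. H a b * \<kappa> b e * H e f)" for a f
  have k: "k f a = - k a f" for a f
  proof -
    have "k f a = (\<Sum>e\<in>UNIV. \<Sum>b\<in>UNIV. H f b * \<kappa> b e * H e a)"
      unfolding k_def by (rule sum.swap)
    also have "\<dots> = (\<Sum>e\<in>UNIV. \<Sum>b\<in>UNIV. - (H a e * \<kappa> e b * H b f))"
      by (intro sum.cong refl) (metis H \<kappa> mult.commute mult_minus_left mult_minus_right mult.assoc)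
    also have "\<dots> = - k a f" by (simp add: k_def sum_negf)
    finally show ?thesis .
  qed
  \<comment> \<open>The trace of the curvature acting on the other index. Here the full curvature,
    Weyl part included, is contracted with the raised form \<open>k\<close>; pair symmetry together
    with the skewness of \<open>k\<close> makes the result skew in \<open>d\<close> and
    \<open>c\<close>.\<close>
  define Q where "Q d c = (\<Sum>a\<in>UNIV. \<Sum>b\<in>UNIV. H a b * (\<Sum>e\<in>UNIV. F d a e c * \<kappa> b e))" for d c
  have Q1: "Q d c = (\<Sum>a\<in>UNIV. \<Sum>f\<in>UNIV. k a f * R d a f c)" for d c
  proof -
    have "(\<Sum>b\<in>UNIV. H a b * (\<Sum>e\<in>UNIV. F d a e c * \<kappa> b e)) = (\<Sum>f\<in>UNIV. k a f * R d a f c)" for a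
    proof -
      have "(\<Sum>b\<in>UNIV. H a b * (\<Sum>e\<in>UNIV. F d a e c * \<kappa> b e)) =
          (\<Sum>b\<in>UNIV. \<Sum>e\<in>UNIV. \<Sum>f\<in>UNIV. H a b * \<kappa> b e * H e f * R d a f c)"
        by (simp add: FR sum_distrib_left sum_distrib_right mult.commute mult.left_commute)
      also have "\<dots> = (\<Sum>b\<in>UNIV. \<Sum>f\<in>UNIV. \<Sum>e\<in>UNIV. H a b * \<kappa> b e * H e f * R d a f c)"
        by (rule sum.cong[OF refl], rule sum.swap)
      also have "\<dots> = (\<Sum>f\<in>UNIV. \<Sum>b\<in>UNIV. \<Sum>e\<in>UNIV. H a b * \<kappa> b e * H e f * R d a f c)"
        by (rule sum.swap)
      also have "\<dots> = (\<Sum>f\<in>UNIV. k a f * R d a f c)"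
        by (simp add: k_def sum_distrib_right)
      finally show ?thesis .
    qed
    then show ?thesis by (simp add: Q_def)
  qed
  have Q: "Q c d = - Q d c" for c d
  proof -
    have "Q c d = (\<Sum>f\<in>UNIV. \<Sum>a\<in>UNIV. k a f * R c a f d)"
      unfolding Q1 by (rule sum.swap)
    also have "\<dots> = (\<Sum>f\<in>UNIV. \<Sum>a\<in>UNIV. - (k f a * R d f a c))"
    proof (intro sum.cong refl)
      fix f a
      have "R c a f d = R d f a c" using pair[of c a f d] R12[of f d c a] R34[of d f c a] by linarith
      then show "k a f * R c a f d = - (k f a * R d f a c)" using k[of f a] by simp
    qed
    also have "\<dots> = - Q d c" by (simp add: Q1 sum_negf)
    finally show ?thesis .
  qed
  define tr where "tr = (\<Sum>a\<in>UNIV. \<Sum>b\<in>UNIV. H a b * N a b)"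
  \<comment> \<open>\<open>S\<close> is totally skew in its last three indices, so this trace is
    skew in \<open>d\<close> and \<open>c\<close>, while the trace of \<open>S d a b c\<close> over
    \<open>a\<close> and \<open>b\<close> vanishes outright.\<close>
  define Z where "Z d c = (\<Sum>a\<in>UNIV. \<Sum>b\<in>UNIV. H a b * S a d b c)" for d c
  have Z: "Z c d = - Z d c" for c d
  proof -
    have "S a c b d = - S a d b c" for a b
      using S1[of a c b d] S2[of a b d c] S1[of a b d c] by simp
    then show ?thesis by (simp add: Z_def sum_negf)
  qed
  let ?n = "real CARD('n)"
  have t1: "(\<Sum>a\<in>UNIV. \<Sum>b\<in>UNIV. H a b * S d a b c) = 0" for d c
    by (rule sum_sym_antisym[OF H S1])
  have t2: "(\<Sum>a\<in>UNIV. \<Sum>b\<in>UNIV. H a b * (g a b * N d c)) = ?n * N d c" for d c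
  proof -
    have "(\<Sum>b\<in>UNIV. H a b * (g a b * N d c)) = N d c" for a
      using Hg[of a a] by (simp add: g[of a] mult.assoc[symmetric] flip: sum_distrib_right)
    then show ?thesis by simp
  qed
  have t3: "(\<Sum>a\<in>UNIV. \<Sum>b\<in>UNIV. H a b * (g a c * N d b)) = N d c" for d c
  proof -
    have "(\<Sum>a\<in>UNIV. \<Sum>b\<in>UNIV. H a b * (g a c * N d b)) =
        (\<Sum>b\<in>UNIV. (\<Sum>a\<in>UNIV. H b a * g a c) * N d b)"
      by (subst sum.swap) (simp add: sum_distrib_right H[of _ "_"] mult.assoc)
    then show ?thesis by (simp only: Hg sum_delta_left)
  qed
  have t4: "(\<Sum>a\<in>UNIV. \<Sum>b\<in>UNIV. H a b * (g d b * N a c)) = N d c" for d c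
  proof -
    have "(\<Sum>a\<in>UNIV. \<Sum>b\<in>UNIV. H a b * (g d b * N a c)) =
        (\<Sum>a\<in>UNIV. (\<Sum>b\<in>UNIV. H a b * g b d) * N a c)"
      by (simp add: sum_distrib_right g[of d] mult.assoc)
    then show ?thesis by (simp only: Hg sum_delta_left)
  qed
  have t5: "(\<Sum>a\<in>UNIV. \<Sum>b\<in>UNIV. H a b * (g d c * N a b)) = g d c * tr" for d c
    by (simp add: tr_def sum_distrib_left mult.left_commute)
  \<comment> \<open>The coefficient n - 2 is n from the full trace of the metric, less 1 for each of
    the two terms where the metric merely renames an index.\<close>
  have main: "(?n - 2) * N d c + g d c * tr - Z d c = - P d c - Q d c" for d c
  proof -
    have "- P d c - Q d c = (\<Sum>a\<in>UNIV. \<Sum>b\<in>UNIV. H a b *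
        (- (\<Sum>e\<in>UNIV. F d a e b * \<kappa> e c) - (\<Sum>e\<in>UNIV. F d a e c * \<kappa> b e)))"
      by (simp add: P_def Q_def right_diff_distrib sum_subtractf sum_negf)
    also have "\<dots> = (\<Sum>a\<in>UNIV. \<Sum>b\<in>UNIV. H a b * (S d a b c + g a b * N d c - g a c * N d b
        - (S a d b c + g d b * N a c - g d c * N a b)))"
      by (simp only: comm)
    also have "\<dots> = (\<Sum>a\<in>UNIV. \<Sum>b\<in>UNIV. H a b * S d a b c)
        + (\<Sum>a\<in>UNIV. \<Sum>b\<in>UNIV. H a b * (g a b * N d c))
        - (\<Sum>a\<in>UNIV. \<Sum>b\<in>UNIV. H a b * (g a c * N d b)) - (Z d c
        + (\<Sum>a\<in>UNIV. \<Sum>b\<in>UNIV. H a b * (g d b * N a c))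
        - (\<Sum>a\<in>UNIV. \<Sum>b\<in>UNIV. H a b * (g d c * N a b)))"
      by (simp only: Z_def distrib_left right_diff_distrib sum.distrib sum_subtractf)
    also have "\<dots> = (?n - 2) * N d c + g d c * tr - Z d c"
      by (simp only: t1 t2 t3 t4 t5) (simp add: algebra_simps)
    finally show ?thesis by simp
  qed
  have sym: "(?n - 2) * (N d c + N c d) + 2 * g d c * tr = 0" for d c
    using main[of d c] main[of c d] P[of d c] P[of c d] Q[of d c] Z[of d c] \<kappa>[of d c] g[of d c]
    by (simp add: algebra_simps)
  \<comment> \<open>A second trace, of the symmetrised identity: 2(n-2) + 2n = 4(n-1) is positive,
    so \<open>tr\<close> vanishes, and n - 2 can then be divided out.\<close>
  have "(?n - 2) * (2 * tr) + 2 * ?n * tr = 0"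
  proof -
    have "(\<Sum>a\<in>UNIV. \<Sum>b\<in>UNIV. H a b * N b a) = tr"
      unfolding tr_def by (subst sum.swap, subst H) simp
    moreover have "(\<Sum>a\<in>UNIV. \<Sum>b\<in>UNIV. H a b * g a b) = ?n"
      using Hg by (simp add: g[of _ "_"])
    moreover have "(\<Sum>a\<in>UNIV. \<Sum>b\<in>UNIV. H a b * ((?n - 2) * (N a b + N b a) + 2 * g a b * tr)) =
       (?n - 2) * ((\<Sum>a\<in>UNIV. \<Sum>b\<in>UNIV. H a b * N a b) + (\<Sum>a\<in>UNIV. \<Sum>b\<in>UNIV. H a b * N b a))
        + 2 * (\<Sum>a\<in>UNIV. \<Sum>b\<in>UNIV. H a b * g a b) * tr"
      by (simp add: distrib_left sum.distrib sum_distrib_left sum_distrib_right mult.assoc mult.left_commute)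
    ultimately show ?thesis by (simp add: sym flip: tr_def)
  qed
  then have "(4 * ?n - 4) * tr = 0" by (simp add: algebra_simps)
  then have "tr = 0" using card by simp
  then show ?thesis using sym[of d c] card by simp
qed

section \<open>Curvature and the Ricci identity\<close>

lemma lower_christoffel:
  assumes "det (G x) \<noteq> 0"
  shows "(\<Sum>e\<in>UNIV. G x $ c $ e * christoffel G e i j x) =
    (pd i (\<lambda>y. G y $ j $ c) x + pd j (\<lambda>y. G y $ i $ c) x - pd c (\<lambda>y. G y $ i $ j) x) / 2"
proof -
  let ?v = "\<lambda>l. (pd i (\<lambda>y. G y $ j $ l) x + pd j (\<lambda>y. G y $ i $ l) x - pd l (\<lambda>y. G y $ i $ j) x) / 2"
  have "christoffel G e i j x = (\<Sum>l\<in>UNIV. matrix_inv (G x) $ e $ l * ?v l)" for e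
    by (simp add: christoffel_def sum_divide_distrib)
  then show ?thesis
    by (simp only: contraction[OF matrix_inv_sum(1)[OF assms]])
qed

text \<open>Uniqueness of the torsion-free metric connection: the Koszul combination of three
  compatibility equations isolates the lowered symbol. Candidates for a rescaled metric and for a
  pulled back metric are identified through this criterion.\<close>

lemma christoffel_unique:
  fixes G :: "real ^ 'n::finite \<Rightarrow> real ^ 'n ^ 'n"
  assumes nz: "det (G x) \<noteq> 0" and G: "\<And>a b. G x $ a $ b = G x $ b $ a"
    and sym: "\<And>e a b. \<Gamma> e a b = \<Gamma> e b a"
    and compat: "\<And>a b c. pd a (\<lambda>y. G y $ b $ c) x =
      (\<Sum>e\<in>UNIV. G x $ c $ e * \<Gamma> e a b) + (\<Sum>e\<in>UNIV. G x $ b $ e * \<Gamma> e a c)"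
  shows "christoffel G k i j x = \<Gamma> k i j"
proof -
  have *: "pd i (\<lambda>y. G y $ j $ l) x + pd j (\<lambda>y. G y $ i $ l) x - pd l (\<lambda>y. G y $ i $ j) x =
      2 * (\<Sum>e\<in>UNIV. G x $ l $ e * \<Gamma> e i j)" for l
    by (simp add: compat sym[of _ j i] sym[of _ l])
  show ?thesis
    unfolding christoffel_def * using contraction[OF matrix_inv_sum(2)[OF nz], of k "\<lambda>e. \<Gamma> e i j"]
    by (simp add: mult.left_commute flip: sum_distrib_left)
qed

text \<open>The Riemann tensor \<open>R_da^e_b\<close>, with the sign for which the commutator of
  the derivatives \<open>d\<close> and \<open>a\<close> on a vector field is plus the curvature; on
  each covariant index it therefore acts with a minus sign.\<close>

definition curv :: "(real ^ 'n \<Rightarrow> real ^ 'n ^ 'n) \<Rightarrow> 'n \<Rightarrow> 'n \<Rightarrow> 'n \<Rightarrow> 'n \<Rightarrow> real ^ 'n::finite \<Rightarrow> real" where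
  "curv G d a e b x = pd d (christoffel G e a b) x - pd a (christoffel G e d b) x
     + (\<Sum>f\<in>UNIV. christoffel G e d f x * christoffel G f a b x - christoffel G e a f x * christoffel G f d b x)"

lemma Ric_curv: "Ric G i j x = (\<Sum>k\<in>UNIV. curv G k i k j x)"
  by (simp add: Ric_def curv_def sum.distrib)

lemma curv_antisym: "curv G a d e b x = - curv G d a e b x"
  by (simp add: curv_def sum_subtractf)

text \<open>An open set contained in the half-space misses the bounding hyperplane, so all
  derivatives here are two-sided. Boundary points are excluded on purpose and recovered by
  continuity at the end.\<close>

locale local_metric =
  fixes W :: "(real ^ 'n::finite) set" and G :: "real ^ 'n \<Rightarrow> real ^ 'n ^ 'n"
  assumes W: "open W" "W \<subseteq> halfspace"
    and G: "\<And>i j. twice_diff W (\<lambda>y. G y $ i $ j)"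
    and sym: "\<And>x i j. x \<in> W \<Longrightarrow> G x $ i $ j = G x $ j $ i"
    and nz: "\<And>x. x \<in> W \<Longrightarrow> det (G x) \<noteq> 0"
begin

lemmas hs = inW[OF W]
lemmas cong = pdcong[OF W]

lemma pd_sym: "x \<in> W \<Longrightarrow> pd a (\<lambda>y. G y $ i $ j) x = pd a (\<lambda>y. G y $ j $ i) x"
  by (rule cong(1)) (auto intro: sym)

lemma inv_sym: "x \<in> W \<Longrightarrow> matrix_inv (G x) $ i $ j = matrix_inv (G x) $ j $ i"
  by (rule matrix_inv_sym[OF nz]) (auto simp: transpose_def vec_eq_iff sym)

lemma christoffel_sym: "x \<in> W \<Longrightarrow> christoffel G k i j x = christoffel G k j i x"
  by (simp add: christoffel_def pd_sym[of x _ i j] add.commute)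

lemma compat:
  assumes x: "x \<in> W"
  shows "pd a (\<lambda>y. G y $ b $ c) x =
    (\<Sum>e\<in>UNIV. christoffel G e a b x * G x $ e $ c) + (\<Sum>e\<in>UNIV. christoffel G e a c x * G x $ b $ e)"
proof -
  have "(\<Sum>e\<in>UNIV. christoffel G e a b x * G x $ e $ c) = (\<Sum>e\<in>UNIV. G x $ c $ e * christoffel G e a b x)"
    "(\<Sum>e\<in>UNIV. christoffel G e a c x * G x $ b $ e) = (\<Sum>e\<in>UNIV. G x $ b $ e * christoffel G e a c x)"
    using sym[OF x] by (auto intro!: sum.cong simp: mult.commute)
  then show ?thesis
    unfolding lower_christoffel[where G=G, OF nz[OF x]]
    using pd_sym[OF x] by (simp add: field_simps)
qed

lemma differentiable_christoffel:
  assumes "x \<in> W"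
  shows "christoffel G k i j differentiable (at x within halfspace)"
proof -
  have "christoffel G k i j = (\<lambda>x. \<Sum>l\<in>UNIV. matrix_inv (G x) $ k $ l * ((1/2) *
     (pd i (\<lambda>y. G y $ j $ l) x + pd j (\<lambda>y. G y $ i $ l) x - pd l (\<lambda>y. G y $ i $ j) x)))"
    by (intro ext) (simp add: christoffel_def sum_divide_distrib)
  then show ?thesis
    using twice_diffD(1)[OF twice_diff_matrix_inv[OF W G nz] assms] twice_diffD(2)[OF G assms]
    by (auto intro!: differentiable_sum differentiable_mult differentiable_add differentiable_diff)
qed

text \<open>The other two derivative terms form a skew expression contracted with the symmetric
  inverse. Combined with \<open>pd_det\<close>, the result says that twice the trace is the
  logarithmic derivative of the determinant.\<close>

lemma trace_christoffel:
  assumes x: "x \<in> W"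
  shows "2 * (\<Sum>d\<in>UNIV. christoffel G d d a x) =
    (\<Sum>i\<in>UNIV. \<Sum>j\<in>UNIV. matrix_inv (G x) $ j $ i * pd a (\<lambda>y. G y $ i $ j) x)"
proof -
  let ?H = "\<lambda>i j. matrix_inv (G x) $ i $ j"
  have "2 * christoffel G d d a x =
     (\<Sum>l\<in>UNIV. ?H d l * (pd d (\<lambda>y. G y $ a $ l) x - pd l (\<lambda>y. G y $ d $ a) x))
     + (\<Sum>l\<in>UNIV. ?H d l * pd a (\<lambda>y. G y $ d $ l) x)" for d
    by (simp add: christoffel_def algebra_simps flip: sum.distrib)
  then have "2 * (\<Sum>d\<in>UNIV. christoffel G d d a x) = 
     (\<Sum>d\<in>UNIV. \<Sum>l\<in>UNIV. ?H d l * (pd d (\<lambda>y. G y $ a $ l) x - pd l (\<lambda>y. G y $ d $ a) x))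
     + (\<Sum>d\<in>UNIV. \<Sum>l\<in>UNIV. ?H d l * pd a (\<lambda>y. G y $ d $ l) x)"
    by (simp add: sum_distrib_left sum.distrib)
  also have "(\<Sum>d\<in>UNIV. \<Sum>l\<in>UNIV. ?H d l * (pd d (\<lambda>y. G y $ a $ l) x - pd l (\<lambda>y. G y $ d $ a) x)) = 0"
    by (rule sum_sym_antisym) (use inv_sym[OF x] pd_sym[OF x] in auto)
  also have "0 + (\<Sum>d\<in>UNIV. \<Sum>l\<in>UNIV. ?H d l * pd a (\<lambda>y. G y $ d $ l) x) =
      (\<Sum>i\<in>UNIV. \<Sum>j\<in>UNIV. ?H j i * pd a (\<lambda>y. G y $ i $ j) x)"
    using inv_sym[OF x] by simp
  finally show ?thesis .
qed

text \<open>Everything symmetric in the two directions of differentiation cancels in the commutator;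
  what remains are derivatives of Christoffel symbols and their products, once for each index of
  \<open>M\<close>.\<close>

lemma ricci_identity:
  assumes x: "x \<in> W" and M: "\<And>b c. twice_diff W (M b c)"
  shows "cd3 G 0 (cd2 G 0 M) d a b c x - cd3 G 0 (cd2 G 0 M) a d b c x =
    - (\<Sum>e\<in>UNIV. curv G d a e b x * M e c x) - (\<Sum>e\<in>UNIV. curv G d a e c x * M b e x)"
proof -
  let ?\<Gamma> = "\<lambda>e a b. christoffel G e a b x"
  let ?D = "\<lambda>d e a b. pd d (christoffel G e a b) x"
  let ?T = "\<lambda>a b c. cd2 G 0 M a b c x"
  have dM: "M b c differentiable (at x within halfspace)" "pd a (M b c) differentiable (at x within halfspace)" for a b c
    using twice_diffD[OF M x] by auto
  note d = dM differentiable_christoffel[OF x] differentiable_sum differentiable_mult differentiable_diff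
  have eq: "cd2 G 0 M a b c = (\<lambda>x. pd a (M b c) x - (\<Sum>e\<in>UNIV. christoffel G e a b x * M e c x)
      - (\<Sum>e\<in>UNIV. christoffel G e a c x * M b e x))" for a b c
    by (intro ext) (simp add: cd2_def density_form_def)
  have pdT: "pd d (cd2 G 0 M a b c) x = pd d (pd a (M b c)) x
      - (\<Sum>e\<in>UNIV. ?\<Gamma> e a b * pd d (M e c) x + ?D d e a b * M e c x)
      - (\<Sum>e\<in>UNIV. ?\<Gamma> e a c * pd d (M b e) x + ?D d e a c * M b e x)" for a b c d
    unfolding eq by (simp add: pd_diff[OF hs[OF x]] pd_sum[OF hs[OF x]] pd_mult[OF hs[OF x]] d)
  \<comment> \<open>Collects the symmetric part: second partials, the torsion-free term on the
    derivative index, and the mixed terms in which both connections act on different indices or one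
    of them meets a first derivative.\<close>
  define S where "S d a = pd d (pd a (M b c)) x - (\<Sum>e\<in>UNIV. ?\<Gamma> e d a * ?T e b c)
     - (\<Sum>e\<in>UNIV. ?\<Gamma> e a b * pd d (M e c) x + ?\<Gamma> e d b * pd a (M e c) x)
     - (\<Sum>e\<in>UNIV. ?\<Gamma> e a c * pd d (M b e) x + ?\<Gamma> e d c * pd a (M b e) x)
     + (\<Sum>e\<in>UNIV. \<Sum>f\<in>UNIV. ?\<Gamma> e d b * ?\<Gamma> f a c * M e f x + ?\<Gamma> e a b * ?\<Gamma> f d c * M e f x)" for d a
  have S: "S d a = S a d" for d a
    by (simp add: S_def christoffel_sym[OF x, of _ d a] twice_diffD(3)[OF M x, of d a] sum.distrib)
  have *: "cd3 G 0 (cd2 G 0 M) d a b c x = S d a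
     - (\<Sum>f\<in>UNIV. (?D d f a b - (\<Sum>e\<in>UNIV. ?\<Gamma> f a e * ?\<Gamma> e d b)) * M f c x)
     - (\<Sum>f\<in>UNIV. (?D d f a c - (\<Sum>e\<in>UNIV. ?\<Gamma> f a e * ?\<Gamma> e d c)) * M b f x)" for d a
  proof -
    have T: "?T a b c = pd a (M b c) x - (\<Sum>e\<in>UNIV. ?\<Gamma> e a b * M e c x) - (\<Sum>e\<in>UNIV. ?\<Gamma> e a c * M b e x)" for b c
      by (simp add: eq)
    have 1: "(\<Sum>e\<in>UNIV. ?\<Gamma> e d b * ?T a e c) = (\<Sum>e\<in>UNIV. ?\<Gamma> e d b * pd a (M e c) x)
       - (\<Sum>f\<in>UNIV. (\<Sum>e\<in>UNIV. ?\<Gamma> f a e * ?\<Gamma> e d b) * M f c x)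
       - (\<Sum>e\<in>UNIV. \<Sum>f\<in>UNIV. ?\<Gamma> e d b * ?\<Gamma> f a c * M e f x)"
    proof -
      have "(\<Sum>e\<in>UNIV. ?\<Gamma> e d b * (\<Sum>f\<in>UNIV. ?\<Gamma> f a e * M f c x)) =
          (\<Sum>e\<in>UNIV. \<Sum>f\<in>UNIV. ?\<Gamma> f a e * ?\<Gamma> e d b * M f c x)"
        by (simp add: sum_distrib_left mult.assoc mult.left_commute)
      also have "\<dots> = (\<Sum>f\<in>UNIV. \<Sum>e\<in>UNIV. ?\<Gamma> f a e * ?\<Gamma> e d b * M f c x)"
        by (rule sum.swap)
      also have "\<dots> = (\<Sum>f\<in>UNIV. (\<Sum>e\<in>UNIV. ?\<Gamma> f a e * ?\<Gamma> e d b) * M f c x)"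
        by (simp add: sum_distrib_right)
      finally show ?thesis
        by (simp add: T right_diff_distrib sum_subtractf sum_distrib_left mult.assoc)
    qed
    have 2: "(\<Sum>e\<in>UNIV. ?\<Gamma> e d c * ?T a b e) = (\<Sum>e\<in>UNIV. ?\<Gamma> e d c * pd a (M b e) x)
       - (\<Sum>e\<in>UNIV. \<Sum>f\<in>UNIV. ?\<Gamma> e a b * ?\<Gamma> f d c * M e f x)
       - (\<Sum>f\<in>UNIV. (\<Sum>e\<in>UNIV. ?\<Gamma> f a e * ?\<Gamma> e d c) * M b f x)"
    proof -
      have "(\<Sum>e\<in>UNIV. ?\<Gamma> e d c * (\<Sum>f\<in>UNIV. ?\<Gamma> f a e * M b f x)) =
          (\<Sum>e\<in>UNIV. \<Sum>f\<in>UNIV. ?\<Gamma> f a e * ?\<Gamma> e d c * M b f x)"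
        by (simp add: sum_distrib_left mult.assoc mult.left_commute)
      also have "\<dots> = (\<Sum>f\<in>UNIV. \<Sum>e\<in>UNIV. ?\<Gamma> f a e * ?\<Gamma> e d c * M b f x)"
        by (rule sum.swap)
      also have "\<dots> = (\<Sum>f\<in>UNIV. (\<Sum>e\<in>UNIV. ?\<Gamma> f a e * ?\<Gamma> e d c) * M b f x)"
        by (simp add: sum_distrib_right)
      finally have 3: "(\<Sum>e\<in>UNIV. ?\<Gamma> e d c * (\<Sum>f\<in>UNIV. ?\<Gamma> f a e * M b f x)) =
        (\<Sum>f\<in>UNIV. (\<Sum>e\<in>UNIV. ?\<Gamma> f a e * ?\<Gamma> e d c) * M b f x)" .
      have "(\<Sum>e\<in>UNIV. ?\<Gamma> e d c * (\<Sum>f\<in>UNIV. ?\<Gamma> f a b * M f e x)) =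
          (\<Sum>e\<in>UNIV. \<Sum>f\<in>UNIV. ?\<Gamma> f a b * ?\<Gamma> e d c * M f e x)"
        by (simp add: sum_distrib_left mult.assoc mult.left_commute)
      also have "\<dots> = (\<Sum>e\<in>UNIV. \<Sum>f\<in>UNIV. ?\<Gamma> e a b * ?\<Gamma> f d c * M e f x)"
        by (rule sum.swap)
      finally show ?thesis using 3
        by (simp add: T right_diff_distrib sum_subtractf)
    qed
    show ?thesis
      unfolding cd3_def pdT 1 2 S_def
      by (simp add: density_form_def sum.distrib sum_subtractf left_diff_distrib)
  qed
  show ?thesis
    unfolding * S[of a d]
    by (simp add: curv_def left_diff_distrib distrib_right sum.distrib sum_subtractf christoffel_sym[OF x, of _ _ "_"])
qed

text \<open>Torsion-freeness pairs off both the derivative terms and the quadratic terms of the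
  cyclic sum.\<close>

lemma curv_bianchi:
  assumes x: "x \<in> W"
  shows "curv G d a e b x + curv G a b e d x + curv G b d e a x = 0"
proof -
  have "pd d (christoffel G e a b) x = pd d (christoffel G e b a) x" for d a b
    by (rule cong(1)[OF x]) (rule christoffel_sym)
  note this[of d a b] this[of a b d] this[of b d a]
  then show ?thesis
    by (simp add: curv_def sum_subtractf christoffel_sym[OF x, of _ a b] christoffel_sym[OF x, of _ b d]
        christoffel_sym[OF x, of _ a d])
qed

lemma nabla_G:
  assumes x: "x \<in> W"
  shows "cd2 G 0 (comps G) a b c x = 0"
  using compat[OF x] by (simp add: cd2_def comps_def density_form_def flip: comps_def)

text \<open>The Ricci identity applied to the metric itself: its covariant derivative vanishes on
  all of \<open>W\<close>, so the curvature terms must cancel each other.\<close>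

lemma curv_lower_antisym:
  assumes x: "x \<in> W"
  shows "(\<Sum>e\<in>UNIV. G x $ b $ e * curv G d a e c x) = - (\<Sum>e\<in>UNIV. G x $ c $ e * curv G d a e b x)"
proof -
  have "pd d (cd2 G 0 (comps G) a b c) x = pd d (\<lambda>_. 0) x" for d a b c
    by (rule cong(1)[OF x]) (rule nabla_G)
  then have "cd3 G 0 (cd2 G 0 (comps G)) d a b c x = 0" for d a b c
    by (simp add: cd3_def nabla_G[OF x] pd_const[OF hs[OF x]])
  moreover have "twice_diff W (comps G b c)" for b c
    using G[of b c] by (simp add: comps_def[abs_def])
  ultimately have "(\<Sum>e\<in>UNIV. curv G d a e b x * G x $ e $ c) + (\<Sum>e\<in>UNIV. curv G d a e c x * G x $ b $ e) = 0"
    using ricci_identity[OF x, of "comps G" d a b c] by (simp add: comps_def)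
  moreover have "(\<Sum>e\<in>UNIV. curv G d a e b x * G x $ e $ c) = (\<Sum>e\<in>UNIV. G x $ c $ e * curv G d a e b x)"
    using sym[OF x, of c] by (simp add: mult.commute)
  ultimately show ?thesis by (simp add: mult.commute)
qed

end

section \<open>Killing covectors from conformal Killing-Yano forms\<close>

lemma scale_density_pos: "det (G x) \<noteq> 0 \<Longrightarrow> scale_density G x > 0"
  by (simp add: scale_density_def)

lemma cmetric_nth: "cmetric G x $ a $ b = (scale_density G x)\<^sup>2 * G x $ a $ b"
  by (simp add: cmetric_def)

lemma cinverse_nth:
  assumes "det (G x) \<noteq> 0"
  shows "cinverse G x $ a $ b = matrix_inv (G x) $ a $ b / (scale_density G x)\<^sup>2"
proof -
  let ?l = "scale_density G x"
  have l: "?l \<noteq> 0" using scale_density_pos[where G=G, OF assms] by simp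
  have "cmetric G x ** (inverse (?l\<^sup>2) *\<^sub>R matrix_inv (G x)) = G x ** matrix_inv (G x)"
    using l by (simp add: vec_eq_iff matrix_matrix_mult_def cmetric_def field_simps)
  also have "\<dots> = mat 1" by (rule matrix_inv_right(1)[OF assms])
  finally have "cmetric G x ** (inverse (?l\<^sup>2) *\<^sub>R matrix_inv (G x)) = mat 1" .
  then show ?thesis
    by (simp add: cinverse_def matrix_inv_unique divide_inverse mult.commute)
qed

lemma cinverse_cmetric:
  assumes "det (G x) \<noteq> 0"
  shows "(\<Sum>b\<in>UNIV. cinverse G x $ a $ b * cmetric G x $ b $ c) = (if a = c then 1 else 0)"
proof -
  have "(scale_density G x)\<^sup>2 > 0" using scale_density_pos[where G=G, OF assms] by simp
  then show ?thesis
    using matrix_inv_sum(2)[OF assms, of a c] by (simp add: cinverse_nth[where G=G, OF assms] cmetric_nth)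
qed

text \<open>Under the trace the skew part drops out, one metric term counts n times and the other
  once. This is the origin of the factor n - 1 in the normalisation of \<open>bgg_n\<close>.\<close>

lemma div2_trace:
  assumes nz: "det (G x) \<noteq> 0" and G: "\<And>a b. G x $ a $ b = G x $ b $ a"
    and t: "\<And>a b d. cd2 G 3 K a b d x = t a b d + cmetric G x $ a $ b * N d - cmetric G x $ a $ d * N b"
    and t12: "\<And>a b d. t b a d = - t a b d"
  shows "div2 G K d x = (real CARD('n) - 1) * N (d :: 'n::finite)"
proof -
  let ?H = "\<lambda>a b. cinverse G x $ a $ b" and ?g = "\<lambda>a b. cmetric G x $ a $ b"
  have H: "?H a b = ?H b a" for a b
    using matrix_inv_sym[OF nz, of a b] G by (simp add: cinverse_nth[where G=G, OF nz] transpose_def vec_eq_iff)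
  have g: "?g a b = ?g b a" for a b using G by (simp add: cmetric_nth)
  have "(\<Sum>p\<in>UNIV. \<Sum>q\<in>UNIV. ?H p q * t q p d) = 0"
    by (rule sum_sym_antisym[OF H t12])
  moreover have "(\<Sum>p\<in>UNIV. \<Sum>q\<in>UNIV. ?H p q * (?g q p * N d)) = real CARD('n) * N d"
    using cinverse_cmetric[where G=G, OF nz] by (simp add: mult.assoc[symmetric] flip: sum_distrib_right)
  moreover have "(\<Sum>p\<in>UNIV. \<Sum>q\<in>UNIV. ?H p q * (?g q d * N p)) = N d"
  proof -
    have "(\<Sum>q\<in>UNIV. ?H p q * (?g q d * N p)) = (if p = d then 1 else 0) * N p" for p
      using cinverse_cmetric[where G=G, OF nz, of p d] by (simp only: mult.assoc[symmetric] flip: sum_distrib_right)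
    then show ?thesis by (simp only: sum_delta_left)
  qed
  ultimately show ?thesis
    by (simp add: div2_def t right_diff_distrib distrib_left sum.distrib sum_subtractf) (simp add: algebra_simps)
qed

context local_metric
begin

text \<open>The conformal Killing-Yano equation in weight zero is differentiated once more and the
  two derivatives are exchanged by the Ricci identity. \<open>killing_from_commutator\<close> then
  applies with the derivatives of \<tau> and \<open>n\<close> as \<open>S\<close> and
  \<open>N\<close>.\<close>

lemma killing:
  assumes card: "CARD('n) \<ge> 3" and x: "x \<in> W" and \<kappa>: "\<And>b c. twice_diff W (\<kappa> b c)"
    and \<kappa>_anti: "\<And>b c. \<kappa> c b x = - \<kappa> b c x"
    and n: "\<And>c. n c differentiable (at x within halfspace)"
    and cky: "\<And>y a b c. y \<in> W \<Longrightarrow> cd2 G 0 \<kappa> a b c y = \<tau> a b c y + G y $ a $ b * n c y - G y $ a $ c * n b y"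
    and \<tau>: "\<And>y a b c. y \<in> W \<Longrightarrow> \<tau> b a c y = - \<tau> a b c y" "\<And>y a b c. y \<in> W \<Longrightarrow> \<tau> a c b y = - \<tau> a b c y"
    and einstein: "\<And>i j. Ric G i j x = \<Lambda> * G x $ i $ j"
  shows "cd1 G 0 n d c x + cd1 G 0 n c d x = 0"
proof -
  note h = hs[OF x]
  have dG: "(\<lambda>y. G y $ i $ j) differentiable (at x within halfspace)" for i j
    using twice_diffD(1)[OF G x] .
  have dT: "cd2 G 0 \<kappa> a b c differentiable (at x within halfspace)" for a b c
  proof -
    have "cd2 G 0 \<kappa> a b c = (\<lambda>x. pd a (\<kappa> b c) x - (\<Sum>e\<in>UNIV. christoffel G e a b x * \<kappa> e c x)
      - (\<Sum>e\<in>UNIV. christoffel G e a c x * \<kappa> b e x))" for a b c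
      by (intro ext) (simp add: cd2_def density_form_def)
    then show ?thesis
      by (auto intro!: differentiable_sum differentiable_mult differentiable_diff
          differentiable_christoffel[OF x] twice_diffD(1,2)[OF \<kappa> x])
  qed
  \<comment> \<open>\<tau> is solved from the equation, so it inherits the regularity of the other
    terms.\<close>
  have d\<tau>: "\<tau> a b c differentiable (at x within halfspace)" for a b c
  proof -
    have "(\<lambda>y. cd2 G 0 \<kappa> a b c y - G y $ a $ b * n c y + G y $ a $ c * n b y) differentiable (at x within halfspace)"
      by (intro differentiable_add differentiable_diff differentiable_mult dT dG n)
    then show ?thesis
      using cong(2)[OF x, of "\<tau> a b c" "\<lambda>y. cd2 G 0 \<kappa> a b c y - G y $ a $ b * n c y + G y $ a $ c * n b y"]
      by (simp add: cky)
  qed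
  let ?S = "\<lambda>d a b c. cd3 G 0 \<tau> d a b c x"
  have pd\<tau>: "pd d (\<tau> b a c) x = - pd d (\<tau> a b c) x" "pd d (\<tau> a c b) x = - pd d (\<tau> a b c) x" for d a b c
  proof -
    have "pd d (\<tau> b a c) x = pd d (\<lambda>y. - \<tau> a b c y) x" by (rule cong(1)[OF x]) (rule \<tau>(1))
    then show "pd d (\<tau> b a c) x = - pd d (\<tau> a b c) x" by (simp add: pd_minus[OF h d\<tau>])
    have "pd d (\<tau> a c b) x = pd d (\<lambda>y. - \<tau> a b c y) x" by (rule cong(1)[OF x]) (rule \<tau>(2))
    then show "pd d (\<tau> a c b) x = - pd d (\<tau> a b c) x" by (simp add: pd_minus[OF h d\<tau>])
  qed
  have S1: "?S d b a c = - ?S d a b c" for d a b c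
    by (simp add: cd3_def pd\<tau>(1)[of _ b a c] \<tau>(1)[OF x, of b a c] \<tau>(1)[OF x, of b _ c]
        \<tau>(1)[OF x, of _ a c] \<tau>(1)[OF x, of b a _] sum_negf)
  have S2: "?S d a c b = - ?S d a b c" for d a b c
    by (simp add: cd3_def pd\<tau>(2)[of _ a c b] \<tau>(2)[OF x, of a c b] \<tau>(2)[OF x, of a _ b]
        \<tau>(2)[OF x, of a c _] \<tau>(2)[OF x, of _ c b] sum_negf)
  \<comment> \<open>Since the metric is parallel, the outer derivative falls only on \<tau> and on
    \<open>n\<close>.\<close>
  have E: "cd3 G 0 (cd2 G 0 \<kappa>) d a b c x =
      ?S d a b c + G x $ a $ b * cd1 G 0 n d c x - G x $ a $ c * cd1 G 0 n d b x" for d a b c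
  proof -
    have "pd d (cd2 G 0 \<kappa> a b c) x = pd d (\<lambda>y. \<tau> a b c y + G y $ a $ b * n c y - G y $ a $ c * n b y) x"
      by (rule cong(1)[OF x]) (rule cky)
    also have "\<dots> = pd d (\<tau> a b c) x + (G x $ a $ b * pd d (n c) x + pd d (\<lambda>y. G y $ a $ b) x * n c x)
        - (G x $ a $ c * pd d (n b) x + pd d (\<lambda>y. G y $ a $ c) x * n b x)"
      by (simp add: pd_diff[OF h] pd_add[OF h] pd_mult[OF h] d\<tau> dG n differentiable_mult differentiable_add)
    finally have 1: "pd d (cd2 G 0 \<kappa> a b c) x = \<dots>" .
    show ?thesis
      unfolding cd3_def 1 cky[OF x] cd1_def compat[OF x]
      by (simp add: density_form_def distrib_left distrib_right left_diff_distrib right_diff_distrib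
          sum.distrib sum_subtractf sum_distrib_left sum_distrib_right mult.assoc mult.left_commute)
  qed
  show ?thesis
  proof (rule killing_from_commutator[where S = ?S and N = "\<lambda>d c. cd1 G 0 n d c x" and
        H = "\<lambda>a b. matrix_inv (G x) $ a $ b" and g = "\<lambda>a b. G x $ a $ b" and
        \<kappa> = "\<lambda>a b. \<kappa> a b x" and F = "\<lambda>d a e b. curv G d a e b x" and \<Lambda> = \<Lambda>])
    show "CARD('n) \<ge> 3" by (rule card)
    show "matrix_inv (G x) $ a $ b = matrix_inv (G x) $ b $ a" for a b by (rule inv_sym[OF x])
    show "G x $ a $ b = G x $ b $ a" for a b by (rule sym[OF x])
    show "(\<Sum>b\<in>UNIV. matrix_inv (G x) $ a $ b * G x $ b $ c) = (if a = c then 1 else 0)" for a c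
      by (rule matrix_inv_sum(2)[OF nz[OF x]])
    show "\<kappa> b a x = - \<kappa> a b x" for a b by (rule \<kappa>_anti)
    show "?S d b a c = - ?S d a b c" for d a b c by (rule S1)
    show "?S d a c b = - ?S d a b c" for d a b c by (rule S2)
    show "curv G a d e b x = - curv G d a e b x" for d a e b by (rule curv_antisym)
    show "(\<Sum>e\<in>UNIV. G x $ b $ e * curv G d a e c x) = - (\<Sum>e\<in>UNIV. G x $ c $ e * curv G d a e b x)" for d a b c
      by (rule curv_lower_antisym[OF x])
    show "curv G d a e b x + curv G a b e d x + curv G b d e a x = 0" for d a e b
      by (rule curv_bianchi[OF x])
    show "(\<Sum>k\<in>UNIV. curv G k i k j x) = \<Lambda> * G x $ i $ j" for i j
      using einstein by (simp add: Ric_curv)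
    show "?S d a b c + G x $ a $ b * cd1 G 0 n d c x - G x $ a $ c * cd1 G 0 n d b x
        - (?S a d b c + G x $ d $ b * cd1 G 0 n a c x - G x $ d $ c * cd1 G 0 n a b x) =
        - (\<Sum>e\<in>UNIV. curv G d a e b x * \<kappa> e c x) - (\<Sum>e\<in>UNIV. curv G d a e c x * \<kappa> b e x)" for d a b c
      unfolding E[symmetric] by (rule ricci_identity[OF x \<kappa>])
  qed
qed

lemma scale_density_twice_diff: "twice_diff W (scale_density G)"
  unfolding scale_density_def[abs_def] by (rule twice_diff_abs_powr[OF W twice_diff_det[OF W G] nz])

text \<open>This is the statement that the density of the metric is parallel. The exponent -1/(2n)
  converts the logarithmic derivative of the determinant into minus the connection form of weight
  1.\<close>

lemma pd_scale_density:
  assumes x: "x \<in> W"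
  shows "pd a (scale_density G) x = - density_form G 1 a x * scale_density G x"
proof -
  let ?c = "- 1 / (2 * real CARD('n))" and ?D = "det (G x)"
  have D: "?D \<noteq> 0" by (rule nz[OF x])
  have "(\<lambda>y. det (G y)) differentiable (at x within halfspace)"
    using twice_diffD(1)[OF twice_diff_det[OF W G] x] .
  from pd_compose(1)[OF hs[OF x] this DERIV_abs_powr[OF D], of a]
  have "pd a (scale_density G) x = ?c * sgn ?D * \<bar>?D\<bar> powr (?c - 1) * (?D * (2 * (\<Sum>d\<in>UNIV. christoffel G d d a x)))"
    by (simp add: scale_density_def[abs_def] pd_det[OF twice_diffD(1)[OF G x] hs[OF x] D] trace_christoffel[OF x])
  also have "\<dots> = ?c * (\<bar>?D\<bar> powr (?c - 1) * \<bar>?D\<bar> powr 1) * (2 * (\<Sum>d\<in>UNIV. christoffel G d d a x))"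
  proof -
    have "sgn ?D * ?D = \<bar>?D\<bar>" by (metis abs_sgn mult.commute)
    then have "sgn ?D * ?D = \<bar>?D\<bar> powr 1" by simp
    then show ?thesis by (simp only: mult_ac flip: \<open>sgn ?D * ?D = \<bar>?D\<bar> powr 1\<close>)
  qed
  also have "\<bar>?D\<bar> powr (?c - 1) * \<bar>?D\<bar> powr 1 = scale_density G x"
    by (subst powr_add[symmetric]) (simp add: scale_density_def)
  finally show ?thesis by (simp add: density_form_def)
qed

text \<open>The density being parallel, division by its cube trades weight 3 for weight 0 without
  disturbing covariant derivatives.\<close>

lemma cd2_weight:
  assumes x: "x \<in> W" and K: "\<And>b c. twice_diff W (K b c)"
  shows "cd2 G 3 K a b c x = (scale_density G x)^3 *
    cd2 G 0 (\<lambda>b c y. K b c y * inverse (scale_density G y ^ 3)) a b c x"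
proof -
  let ?l = "scale_density G"
  have l: "?l x \<noteq> 0" using scale_density_pos[where G=G, OF nz[OF x]] by simp
  have dl: "?l differentiable (at x within halfspace)" using twice_diffD(1)[OF scale_density_twice_diff x] .
  have dK: "K b c differentiable (at x within halfspace)" using twice_diffD(1)[OF K x] .
  have "((\<lambda>z. inverse (z ^ 3)) has_real_derivative - 3 * inverse (?l x ^ 4)) (at (?l x))"
    using l by (auto intro!: derivative_eq_intros simp: field_simps power2_eq_square eval_nat_numeral)
  note c = pd_compose[OF hs[OF x] dl this]
  have "pd a (\<lambda>y. K b c y * inverse (?l y ^ 3)) x =
     K b c x * (3 * inverse (?l x ^ 3) * density_form G 1 a x) + pd a (K b c) x * inverse (?l x ^ 3)"
    unfolding pd_mult[OF hs[OF x] dK c(2)] c(1) pd_scale_density[OF x]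
    using l by (simp add: field_simps eval_nat_numeral)
  then show ?thesis
    using l unfolding cd2_def
    by (simp add: density_form_def algebra_simps sum_distrib_left)
qed

end

section \<open>Conformal change\<close>

lemma det_scaleR: "det (q *\<^sub>R M) = q ^ CARD('n) * det (M :: real ^ 'n::finite ^ 'n)"
proof -
  have "q *\<^sub>R M = (\<chi> i. q *s (M $ i))" by (simp add: vec_eq_iff)
  then show ?thesis using det_rows_mul[of "\<lambda>_. q" "\<lambda>i. M $ i"] by simp
qed

lemma scale_density_rescale:
  fixes G G' :: "real ^ 'n::finite \<Rightarrow> real ^ 'n ^ 'n"
  assumes "G' x = q *\<^sub>R G x" "q > 0"
  shows "scale_density G' x = q powr (- 1 / 2) * scale_density G x"
proof -
  have "\<bar>det (G' x)\<bar> = q powr real CARD('n) * \<bar>det (G x)\<bar>"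
    using assms by (simp add: det_scaleR abs_mult powr_realpow)
  then show ?thesis
    using assms(2) by (simp add: scale_density_def powr_mult powr_powr)
qed

lemma cmetric_rescale:
  assumes "G' x = q *\<^sub>R G x" "q > 0"
  shows "cmetric G' x = cmetric G x"
proof -
  have "(scale_density G' x)\<^sup>2 * q = (q powr (- 1 / 2) * q powr (- 1 / 2) * q) * (scale_density G x)\<^sup>2"
    unfolding scale_density_rescale[where G=G and G'=G' and x=x, OF assms] by (simp add: power2_eq_square)
  also have "q powr (- 1 / 2) * q powr (- 1 / 2) * q = 1"
  proof -
    have "q powr (- 1 / 2) * q powr (- 1 / 2) * q powr 1 = q powr (- 1 / 2 + - 1 / 2 + 1)"
      by (simp only: powr_add)
    then show ?thesis using assms(2) by simp
  qed
  finally show ?thesis by (simp add: cmetric_def assms(1))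
qed

text \<open>\<open>N\<close> is the trace part of \<open>\<nabla>k\<close>; the remaining part is totally skew.\<close>

definition cky_form ::
  "(real ^ 'n \<Rightarrow> real ^ 'n ^ 'n) \<Rightarrow> ('n \<Rightarrow> 'n \<Rightarrow> real ^ 'n \<Rightarrow> real) \<Rightarrow> real ^ 'n::finite \<Rightarrow> ('n \<Rightarrow> real) \<Rightarrow> bool" where
  "cky_form G K x N \<longleftrightarrow> (\<exists>t. (\<forall>a b d. cd2 G 3 K a b d x =
      t a b d + cmetric G x $ a $ b * N d - cmetric G x $ a $ d * N b) \<and>
    (\<forall>a b d. t b a d = - t a b d) \<and> (\<forall>a b d. t a d b = - t a b d))"

lemma cky_form_div2:
  assumes "det (G x) \<noteq> 0" "\<And>a b. G x $ a $ b = G x $ b $ a" "cky_form G K x N"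
  shows "div2 G K d x = (real CARD('n) - 1) * N (d :: 'n::finite)"
proof -
  obtain t where "\<And>a b d. cd2 G 3 K a b d x = t a b d + cmetric G x $ a $ b * N d - cmetric G x $ a $ d * N b"
    "\<And>a b d. t b a d = - t a b d"
    using assms(3) unfolding cky_form_def by blast
  then show ?thesis by (rule div2_trace[where G=G and x=x, OF assms(1,2)])
qed

text \<open>The defining equation uses the divergence over the second index, which is minus
  \<open>div2\<close>. That sign cancels the one in front of the fraction, and the 2 cancels against
  the half in \<open>alt2\<close>.\<close>

lemma cky_form_if_equation:
  fixes K :: "'n::finite \<Rightarrow> 'n \<Rightarrow> real ^ 'n \<Rightarrow> real"
  assumes K: "\<And>a b d. cd2 G 3 (\<lambda>p q. K q p) a b d x = - cd2 G 3 K a b d x"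
    and eq: "\<And>a b d. cd2 G 3 K a b d x =
          alt3 (\<lambda>a b d. cd2 G 3 K a b d x) a b d
          - 2 / (real CARD('n) - 1) *
              alt2 (\<lambda>b d. cmetric G x $ a $ b * div2 G (\<lambda>p q. K q p) d x) b d"
  shows "cky_form G K x (\<lambda>d. div2 G K d x / (real CARD('n) - 1))"
proof -
  have D: "div2 G (\<lambda>p q. K q p) d x = - div2 G K d x" for d
    by (simp add: div2_def K sum_negf)
  show ?thesis
    unfolding cky_form_def
  proof (intro exI[of _ "\<lambda>a b d. alt3 (\<lambda>a b d. cd2 G 3 K a b d x) a b d"] conjI allI)
    fix a b d
    show "cd2 G 3 K a b d x = alt3 (\<lambda>a b d. cd2 G 3 K a b d x) a b d
      + cmetric G x $ a $ b * (div2 G K d x / (real CARD('n) - 1))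
      - cmetric G x $ a $ d * (div2 G K b x / (real CARD('n) - 1))"
      by (subst eq) (simp add: alt2_def D diff_divide_distrib)
    show "alt3 (\<lambda>a b d. cd2 G 3 K a b d x) b a d = - alt3 (\<lambda>a b d. cd2 G 3 K a b d x) a b d" for a b d
      unfolding alt3_def minus_divide_left by (rule arg_cong[where f = "\<lambda>z. z / 6"]) simp
    show "alt3 (\<lambda>a b d. cd2 G 3 K a b d x) a d b = - alt3 (\<lambda>a b d. cd2 G 3 K a b d x) a b d" for a b d
      unfolding alt3_def minus_divide_left by (rule arg_cong[where f = "\<lambda>z. z / 6"]) simp
  qed
qed

text \<open>Writing q = exp(2 \<omega>), the covector \<Upsilon> is the differential of \<omega>.
  The claimed symbols are torsion-free and compatible with the new metric, so
  \<open>christoffel_unique\<close> identifies them.\<close>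

lemma christoffel_conformal:
  assumes "local_metric W G" and "local_metric W G'" and x: "x \<in> W"
    and q: "q differentiable (at x within halfspace)" "q x > 0"
    and G': "\<And>y. y \<in> W \<Longrightarrow> G' y = q y *\<^sub>R G y"
  defines "\<Upsilon> \<equiv> \<lambda>a. pd a q x / (2 * q x)"
  shows "christoffel G' e a b x = christoffel G e a b x + (if e = a then 1 else 0) * \<Upsilon> b
    + (if e = b then 1 else 0) * \<Upsilon> a - cmetric G x $ a $ b * (\<Sum>f\<in>UNIV. cinverse G x $ e $ f * \<Upsilon> f)"
proof -
  interpret G: local_metric W G by fact
  interpret G': local_metric W G' by fact
  let ?g = "cmetric G x" and ?l = "scale_density G x"
  let ?u = "\<lambda>e. \<Sum>f\<in>UNIV. cinverse G x $ e $ f * \<Upsilon> f"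
  have l: "?l > 0" by (rule scale_density_pos) (rule G.nz[OF x])
  have g: "?g $ a $ b = ?g $ b $ a" for a b by (simp add: cmetric_nth G.sym[OF x])
  \<comment> \<open>Raising was done with the conformal metric and lowering with \<open>G\<close>;
    the two differ by the square of the scale density.\<close>
  have low: "(\<Sum>e\<in>UNIV. G x $ c $ e * ?u e) * ?l\<^sup>2 = \<Upsilon> c" for c
  proof -
    have "(\<Sum>e\<in>UNIV. G x $ c $ e * ?u e) * ?l\<^sup>2 = (\<Sum>e\<in>UNIV. G x $ c $ e * (\<Sum>f\<in>UNIV. matrix_inv (G x) $ e $ f * \<Upsilon> f))"
      using l by (simp add: cinverse_nth[where G=G, OF G.nz[OF x]] sum_divide_distrib[symmetric] sum_distrib_left[symmetric])
    then show ?thesis using contraction[OF matrix_inv_sum(1)[OF G.nz[OF x]], of c \<Upsilon>] by simp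
  qed
  show ?thesis
  proof (rule christoffel_unique[where G=G' and x=x, OF G'.nz[OF x]])
    show "G' x $ a $ b = G' x $ b $ a" for a b by (rule G'.sym[OF x])
    show "christoffel G e a b x + (if e = a then 1 else 0) * \<Upsilon> b + (if e = b then 1 else 0) * \<Upsilon> a - ?g $ a $ b * ?u e =
      christoffel G e b a x + (if e = b then 1 else 0) * \<Upsilon> a + (if e = a then 1 else 0) * \<Upsilon> b - ?g $ b $ a * ?u e" for e a b
      by (simp add: G.christoffel_sym[OF x, of e a b] g[of a b])
    fix a b c
    have 1: "(\<Sum>e\<in>UNIV. G' x $ c $ e * (christoffel G e a b x + (if e = a then 1 else 0) * \<Upsilon> b
        + (if e = b then 1 else 0) * \<Upsilon> a - ?g $ a $ b * ?u e)) =
      q x * ((\<Sum>e\<in>UNIV. christoffel G e a b x * G x $ e $ c) + G x $ c $ a * \<Upsilon> b + G x $ c $ b * \<Upsilon> a - G x $ a $ b * \<Upsilon> c)"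
      for a b c
    proof -
      have "(\<Sum>e\<in>UNIV. G x $ c $ e * (christoffel G e a b x + (if e = a then 1 else 0) * \<Upsilon> b
          + (if e = b then 1 else 0) * \<Upsilon> a - ?g $ a $ b * ?u e)) =
        (\<Sum>e\<in>UNIV. G x $ c $ e * christoffel G e a b x) + (\<Sum>e\<in>UNIV. (if e = a then 1 else 0) * (G x $ c $ e * \<Upsilon> b))
         + (\<Sum>e\<in>UNIV. (if e = b then 1 else 0) * (G x $ c $ e * \<Upsilon> a)) - G x $ a $ b * ((\<Sum>e\<in>UNIV. G x $ c $ e * ?u e) * ?l\<^sup>2)"
        by (simp add: distrib_left right_diff_distrib sum.distrib sum_subtractf cmetric_nth sum_distrib_left sum_distrib_right mult_ac)
      also have "(\<Sum>e\<in>UNIV. G x $ c $ e * christoffel G e a b x) = (\<Sum>e\<in>UNIV. christoffel G e a b x * G x $ e $ c)"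
        using G.sym[OF x, of c] by (simp add: mult.commute)
      finally show ?thesis
        unfolding low sum_delta_left by (simp add: G'[OF x] mult.assoc flip: sum_distrib_left)
    qed
    have "pd a (\<lambda>y. G' y $ b $ c) x = pd a (\<lambda>y. q y * G y $ b $ c) x"
      by (rule G.cong(1)[OF x]) (simp add: G')
    also have "\<dots> = q x * pd a (\<lambda>y. G y $ b $ c) x + pd a q x * G x $ b $ c"
      by (rule pd_mult[OF G.hs[OF x] q(1) twice_diffD(1)[OF G.G x]])
    also have "pd a q x = 2 * q x * \<Upsilon> a" using q(2) by (simp add: \<Upsilon>_def)
    finally have pdG': "pd a (\<lambda>y. G' y $ b $ c) x =
      q x * pd a (\<lambda>y. G y $ b $ c) x + 2 * q x * \<Upsilon> a * G x $ b $ c" .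
    have *: "(\<Sum>e\<in>UNIV. christoffel G e a c x * G x $ b $ e) = (\<Sum>e\<in>UNIV. christoffel G e a c x * G x $ e $ b)"
      using G.sym[OF x, of b] by simp
    show "pd a (\<lambda>y. G' y $ b $ c) x =
      (\<Sum>e\<in>UNIV. G' x $ c $ e * (christoffel G e a b x + (if e = a then 1 else 0) * \<Upsilon> b
        + (if e = b then 1 else 0) * \<Upsilon> a - ?g $ a $ b * ?u e)) +
      (\<Sum>e\<in>UNIV. G' x $ b $ e * (christoffel G e a c x + (if e = a then 1 else 0) * \<Upsilon> c
        + (if e = c then 1 else 0) * \<Upsilon> a - ?g $ a $ c * ?u e))"
      unfolding pdG' 1 G.compat[OF x]
        *
        G.sym[OF x, of c a] G.sym[OF x, of c b] G.sym[OF x, of b a]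
      by (simp add: distrib_left right_diff_distrib mult.assoc mult.left_commute)
  qed
qed

text \<open>Conformal invariance of the equation: the change of connection alters the derivative of
  \<open>K\<close> by a totally skew term, absorbed in the skew part, and by a pure trace term,
  which shifts \<open>N\<close> by the contraction of \<Upsilon> with \<open>K\<close>.\<close>

lemma div2_conformal:
  assumes "local_metric W G" and "local_metric W G'" and x: "x \<in> W"
    and q: "q differentiable (at x within halfspace)" "q x > 0"
    and G': "\<And>y. y \<in> W \<Longrightarrow> G' y = q y *\<^sub>R G y"
    and K: "\<And>a b. K b a x = - K a b x" and cky: "cky_form G K x N"
  defines "Z \<equiv> \<lambda>d. \<Sum>e\<in>UNIV. (\<Sum>f\<in>UNIV. cinverse G x $ e $ f * (pd f q x / (2 * q x))) * K e d x"
  shows "cky_form G' K x (\<lambda>d. N d + Z d)"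
    and "div2 G' K d x = div2 G K d x + (real CARD('n) - 1) * Z (d :: 'n::finite)"
proof -
  interpret G: local_metric W G by fact
  interpret G': local_metric W G' by fact
  define \<Upsilon> where "\<Upsilon> a = pd a q x / (2 * q x)" for a
  let ?g = "cmetric G x"
  define u where "u e = (\<Sum>f\<in>UNIV. cinverse G x $ e $ f * \<Upsilon> f)" for e
  have Z: "Z d = (\<Sum>e\<in>UNIV. u e * K e d x)" for d by (simp add: Z_def u_def \<Upsilon>_def)
  have g: "?g $ a $ b = ?g $ b $ a" for a b by (simp add: cmetric_nth G.sym[OF x])
  have ch: "christoffel G' e a b x = christoffel G e a b x + (if e = a then 1 else 0) * \<Upsilon> b
    + (if e = b then 1 else 0) * \<Upsilon> a - ?g $ a $ b * u e" for e a b
    unfolding \<Upsilon>_def u_def by (rule christoffel_conformal[OF assms(1,2) x q G'])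
  have "(\<Sum>d\<in>UNIV. ?g $ d $ a * u d) = \<Upsilon> a" for a
  proof -
    have "(\<Sum>b\<in>UNIV. ?g $ a $ b * cinverse G x $ b $ c) = (if a = c then 1 else 0)" for a c
    proof -
      have "?g ** cinverse G x = mat 1"
        unfolding cinverse_def
        by (rule matrix_inv_right(1)) (use scale_density_pos[where G=G, OF G.nz[OF x]] G.nz[OF x] in \<open>simp add: cmetric_def det_scaleR\<close>)
      then have "(?g ** cinverse G x) $ a $ c = mat 1 $ a $ c" by simp
      then show ?thesis by (simp add: matrix_matrix_mult_def mat_def)
    qed
    from contraction[OF this, of a \<Upsilon>] show ?thesis by (simp add: u_def g[of a])
  qed
  then have tr: "(\<Sum>d\<in>UNIV. christoffel G' d d a x) = (\<Sum>d\<in>UNIV. christoffel G d d a x) + real CARD('n) * \<Upsilon> a" for a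
    by (simp only: ch sum.distrib sum_subtractf sum_delta_left) (simp)
  have df: "density_form G' 3 a x = density_form G 3 a x + 3 * \<Upsilon> a" for a
    by (simp add: density_form_def tr field_simps)
  \<comment> \<open>The Christoffel change contributes -2 \<Upsilon>_a K_bd and the weight
    contributes +3 \<Upsilon>_a K_bd. The net coefficient 1 is what makes the three \<Upsilon>-terms
    cyclic, hence skew: weight 3 is forced here.\<close>
  have c2: "cd2 G' 3 K a b d x = cd2 G 3 K a b d x + (\<Upsilon> a * K b d x + \<Upsilon> b * K d a x + \<Upsilon> d * K a b x)
      + ?g $ a $ b * Z d - ?g $ a $ d * Z b" for a b d
  proof -
    have 1: "(\<Sum>e\<in>UNIV. christoffel G' e a b x * f e) = (\<Sum>e\<in>UNIV. christoffel G e a b x * f e)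
        + \<Upsilon> b * f a + \<Upsilon> a * f b - ?g $ a $ b * (\<Sum>e\<in>UNIV. u e * f e)" for a b f
    proof -
      have "(\<Sum>e\<in>UNIV. christoffel G' e a b x * f e) = (\<Sum>e\<in>UNIV. christoffel G e a b x * f e)
        + (\<Sum>e\<in>UNIV. (if e = a then 1 else 0) * (\<Upsilon> b * f e)) + (\<Sum>e\<in>UNIV. (if e = b then 1 else 0) * (\<Upsilon> a * f e))
        - ?g $ a $ b * (\<Sum>e\<in>UNIV. u e * f e)"
        by (simp add: ch distrib_right left_diff_distrib sum.distrib sum_subtractf sum_distrib_left mult.assoc)
      then show ?thesis by (simp only: sum_delta_left)
    qed
    have 2: "(\<Sum>e\<in>UNIV. u e * K b e x) = - Z b"
      by (simp add: Z K[of b] sum_negf)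
    show ?thesis
      unfolding cd2_def 1 2 Z[symmetric] df using K[of a b] K[of d a] K[of b d]
      by (simp add: algebra_simps)
  qed
  obtain t where t: "\<And>a b d. cd2 G 3 K a b d x = t a b d + ?g $ a $ b * N d - ?g $ a $ d * N b"
    "\<And>a b d. t b a d = - t a b d" "\<And>a b d. t a d b = - t a b d"
    using cky unfolding cky_form_def by blast
  have cm: "cmetric G' x = ?g" by (rule cmetric_rescale[where G=G and G'=G' and x=x, OF G'[OF x] q(2)])
  show cky': "cky_form G' K x (\<lambda>d. N d + Z d)"
    unfolding cky_form_def cm
  proof (intro exI[of _ "\<lambda>a b d. t a b d + (\<Upsilon> a * K b d x + \<Upsilon> b * K d a x + \<Upsilon> d * K a b x)"] conjI allI)
    fix a b d
    show "cd2 G' 3 K a b d x = t a b d + (\<Upsilon> a * K b d x + \<Upsilon> b * K d a x + \<Upsilon> d * K a b x)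
      + ?g $ a $ b * (N d + Z d) - ?g $ a $ d * (N b + Z b)"
      by (simp add: c2 t(1) algebra_simps)
    show "t b a d + (\<Upsilon> b * K a d x + \<Upsilon> a * K d b x + \<Upsilon> d * K b a x) =
      - (t a b d + (\<Upsilon> a * K b d x + \<Upsilon> b * K d a x + \<Upsilon> d * K a b x))"
      by (simp add: t(2)[of b a] K[of a d] K[of b d] K[of a b])
    show "t a d b + (\<Upsilon> a * K d b x + \<Upsilon> d * K b a x + \<Upsilon> b * K a d x) =
      - (t a b d + (\<Upsilon> a * K b d x + \<Upsilon> b * K d a x + \<Upsilon> d * K a b x))"
      by (simp add: t(3)[of a b d] K[of a d] K[of b d] K[of a b])
  qed
  show "div2 G' K d x = div2 G K d x + (real CARD('n) - 1) * Z d"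
    using cky_form_div2[where G=G' and x=x, OF G'.nz[OF x] G'.sym[OF x] cky', of d]
      cky_form_div2[where G=G and x=x, OF G.nz[OF x] G.sym[OF x] cky, of d] by (simp add: distrib_left)
qed

section \<open>Conservation along geodesics\<close>

lemma has_real_derivative_chain:
  fixes y :: "real \<Rightarrow> real ^ 'n::finite"
  assumes y: "(y has_vector_derivative v) (at t within S)" and S: "y ` S \<subseteq> halfspace"
    and f: "f differentiable (at (y t) within halfspace)"
  shows "((\<lambda>s. f (y s)) has_real_derivative (\<Sum>b\<in>UNIV. v $ b * pd b f (y t))) (at t within S)"
proof -
  have "(f has_derivative (\<lambda>h. \<Sum>b\<in>UNIV. h $ b * pd b f (y t))) (at (y t) within y ` S)"
    using has_derivative_subset[OF differentiable_has_pd[OF f] S] .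
  from has_derivative_in_compose[OF y[unfolded has_vector_derivative_def] this]
  have "((\<lambda>s. f (y s)) has_derivative (\<lambda>h. \<Sum>b\<in>UNIV. (h *\<^sub>R v) $ b * pd b f (y t))) (at t within S)" .
  moreover have "(\<lambda>h. \<Sum>b\<in>UNIV. (h *\<^sub>R v) $ b * pd b f (y t)) = (*) (\<Sum>b\<in>UNIV. v $ b * pd b f (y t))"
    by (rule ext) (simp add: sum_distrib_left mult_ac)
  ultimately show ?thesis by (simp only: has_field_derivative_def)
qed

text \<open>\<open>h1\<close> stands for something linear in the velocity and \<open>h2\<close> for
  something quadratic. Both grow at rates set by the same \<alpha>, so the normalised ratio is
  stationary for every parametrisation of the curve.\<close>

lemma ratio_stationary:
  assumes h1: "(h1 has_real_derivative \<alpha> * h1 t) (at t)" and h2: "(h2 has_real_derivative 2 * \<alpha> * h2 t) (at t)"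
    and nz: "h2 t \<noteq> 0"
  shows "((\<lambda>t. sgn (h2 t) * (h1 t / sqrt \<bar>h2 t\<bar>)) has_real_derivative 0) (at t)"
proof -
  have "continuous (at t) (\<lambda>s. h2 s * h2 t)"
    using DERIV_isCont[OF h2] by (intro continuous_intros)
  moreover have "h2 t * h2 t \<in> {0<..}" using nz by (metis greaterThan_iff not_real_square_gt_zero)
  ultimately have "\<exists>U. open U \<and> t \<in> U \<and> (\<forall>s\<in>U. h2 s * h2 t \<in> {0<..})"
    unfolding continuous_at_open using open_greaterThan[of "0::real"] by blast
  then obtain U where U: "open U" "t \<in> U" "\<And>s. s \<in> U \<Longrightarrow> h2 s * h2 t > 0" by auto
  have abs: "((\<lambda>t. \<bar>h2 t\<bar>) has_real_derivative 2 * \<alpha> * \<bar>h2 t\<bar>) (at t)"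
  proof (rule has_field_derivative_transform_within_open)
    show "((\<lambda>s. sgn (h2 t) * h2 s) has_real_derivative 2 * \<alpha> * \<bar>h2 t\<bar>) (at t)"
      using DERIV_cmult[OF h2, of "sgn (h2 t)"] by (simp add: abs_sgn mult_ac)
    show "open U" "t \<in> U" by fact+
    show "sgn (h2 t) * h2 s = \<bar>h2 s\<bar>" if "s \<in> U" for s
      using U(3)[OF that] by (auto simp: sgn_if zero_less_mult_iff)
  qed
  have "((\<lambda>t. sqrt \<bar>h2 t\<bar>) has_real_derivative (inverse (sqrt \<bar>h2 t\<bar>) / 2) * (2 * \<alpha> * \<bar>h2 t\<bar>)) (at t)"
    by (rule DERIV_chain2[OF DERIV_real_sqrt abs]) (use nz in simp)
  moreover have "(inverse (sqrt \<bar>h2 t\<bar>) / 2) * (2 * \<alpha> * \<bar>h2 t\<bar>) = \<alpha> * sqrt \<bar>h2 t\<bar>"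
  proof -
    define s where "s = sqrt \<bar>h2 t\<bar>"
    have "s > 0" "\<bar>h2 t\<bar> = s * s" using nz by (simp_all add: s_def)
    then show ?thesis unfolding s_def[symmetric] by simp
  qed
  ultimately have "((\<lambda>t. sqrt \<bar>h2 t\<bar>) has_real_derivative \<alpha> * sqrt \<bar>h2 t\<bar>) (at t)" by (simp only:)
  from DERIV_divide[OF h1 this] nz
  have "((\<lambda>t. h1 t / sqrt \<bar>h2 t\<bar>) has_real_derivative 0) (at t)" by (simp add: mult_ac)
  from DERIV_cmult[OF this, of "sgn (h2 t)"]
  have D: "((\<lambda>s. sgn (h2 t) * (h1 s / sqrt \<bar>h2 s\<bar>)) has_real_derivative 0) (at t)" by simp
  show ?thesis
  proof (rule has_field_derivative_transform_within_open[OF D U(1,2)])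
    show "sgn (h2 t) * (h1 s / sqrt \<bar>h2 s\<bar>) = sgn (h2 s) * (h1 s / sqrt \<bar>h2 s\<bar>)" if "s \<in> U" for s
      using U(3)[OF that] by (auto simp: sgn_if zero_less_mult_iff)
  qed
qed

section \<open>The Killing covector along a curve\<close>

context local_metric
begin

lemma twice_diff_unweighted:
  assumes "twice_diff W k"
  shows "twice_diff W (\<lambda>z. k z * inverse (scale_density G z ^ 3))"
proof -
  let ?l = "scale_density G"
  have l: "?l z > 0" if "z \<in> W" for z using scale_density_pos[where G=G] nz[OF that] by blast
  have "twice_diff W (\<lambda>z. ?l z * (?l z * ?l z))"
    by (intro twice_diff_mult[OF W] scale_density_twice_diff)
  then have "twice_diff W (\<lambda>z. ?l z ^ 3)" by (simp add: power3_eq_cube mult.assoc)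
  then have "twice_diff W (\<lambda>z. inverse (?l z ^ 3))"
    by (rule twice_diff_inverse[OF W]) (use l in force)
  then show ?thesis by (intro twice_diff_mult[OF W] assms)
qed

text \<open>The inverse conformal metric carries the density to the power -2 and the derivative of
  \<open>K\<close> to the power 3. One power is left, and dividing by it gives the ordinary
  divergence of the weight zero form.\<close>

lemma div2_unweighted:
  assumes z: "z \<in> W" and K: "\<And>b c. twice_diff W (K b c)"
  shows "div2 G K d z / scale_density G z = (\<Sum>p\<in>UNIV. \<Sum>q\<in>UNIV. matrix_inv (G z) $ p $ q *
    cd2 G 0 (\<lambda>b c y. K b c y * inverse (scale_density G y ^ 3)) q p d z)"
  using scale_density_pos[where G=G, OF nz[OF z]]
  by (simp add: div2_def cinverse_nth[where G=G, OF nz[OF z]] cd2_weight[OF z K] sum_divide_distrib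
      power2_eq_square power3_eq_cube)

text \<open>The pairing of the velocity with the Killing covector is multiplied at rate \<alpha> and
  the squared length at rate 2 \<alpha>, so \<open>ratio_stationary\<close> applies. The sign factor
  reproduces the causal sign of the first integral.\<close>

lemma killing_along_pregeodesic:
  fixes y v :: "real \<Rightarrow> real ^ 'n"
  assumes card: "CARD('n) \<ge> 3" and x: "y t \<in> W" and K: "\<And>b c. twice_diff W (K b c)"
    and K_anti: "\<And>x b c. x \<in> W \<Longrightarrow> K c b x = - K b c x"
    and cky: "\<And>x. x \<in> W \<Longrightarrow> cky_form G K x (N x)"
    and einstein: "\<And>i j. Ric G i j (y t) = \<Lambda> * G (y t) $ i $ j"
    and y: "(y has_vector_derivative v t) (at t)" and v: "(v has_vector_derivative w) (at t)"
    and pregeodesic: "\<And>e. w $ e + (\<Sum>a\<in>UNIV. \<Sum>b\<in>UNIV. christoffel G e a b (y t) * v t $ a * v t $ b) = \<alpha> * v t $ e"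
    and nonnull: "v t \<bullet> (G (y t) *v v t) \<noteq> 0"
  shows "((\<lambda>s. sgn (v s \<bullet> (G (y s) *v v s)) * ((\<Sum>a\<in>UNIV. v s $ a * (div2 G K a (y s) / scale_density G (y s))) /
     sqrt \<bar>v s \<bullet> (G (y s) *v v s)\<bar>)) has_real_derivative 0) (at t)"
proof -
  let ?l = "scale_density G" and ?x = "y t" and ?n = "real CARD('n) - 1"
  define \<kappa> where "\<kappa> b c z = K b c z * inverse (?l z ^ 3)" for b c z
  define \<nu> where "\<nu> a z = div2 G K a z / ?l z" for a z
  have l: "?l z > 0" if "z \<in> W" for z using scale_density_pos[where G=G] nz[OF that] by blast
  have \<kappa>: "twice_diff W (\<kappa> b c)" for b c
    unfolding \<kappa>_def[abs_def] by (rule twice_diff_unweighted[OF K])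
  have cd2: "cd2 G 3 K a b c z = ?l z ^ 3 * cd2 G 0 \<kappa> a b c z" if "z \<in> W" for a b c z
    unfolding \<kappa>_def[abs_def] by (rule cd2_weight[OF that K])
  have \<nu>_eq: "\<nu> d z = (\<Sum>p\<in>UNIV. \<Sum>q\<in>UNIV. matrix_inv (G z) $ p $ q * cd2 G 0 \<kappa> q p d z)" if z: "z \<in> W" for d z
    unfolding \<nu>_def \<kappa>_def[abs_def] by (rule div2_unweighted[OF z K])
  have d\<nu>: "\<nu> d differentiable (at ?x within halfspace)" for d
  proof -
    have "cd2 G 0 \<kappa> a b c = (\<lambda>x. pd a (\<kappa> b c) x - (\<Sum>e\<in>UNIV. christoffel G e a b x * \<kappa> e c x)
      - (\<Sum>e\<in>UNIV. christoffel G e a c x * \<kappa> b e x))" for a b c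
      by (intro ext) (simp add: cd2_def density_form_def)
    then have "(\<lambda>z. \<Sum>p\<in>UNIV. \<Sum>q\<in>UNIV. matrix_inv (G z) $ p $ q * cd2 G 0 \<kappa> q p d z) differentiable (at ?x within halfspace)"
      by (auto intro!: differentiable_sum differentiable_mult differentiable_diff
          differentiable_christoffel[OF x] twice_diffD(1,2)[OF \<kappa> x]
          twice_diffD(1)[OF twice_diff_matrix_inv[OF W G nz] x])
    then show ?thesis
      using cong(2)[OF x, of "\<nu> d" "\<lambda>z. \<Sum>p\<in>UNIV. \<Sum>q\<in>UNIV. matrix_inv (G z) $ p $ q * cd2 G 0 \<kappa> q p d z"] \<nu>_eq
      by simp
  qed
  define n where "n c z = inverse ?n * \<nu> c z" for c z
  have n0: "?n > 0" using card by simp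
  have dn: "n c differentiable (at ?x within halfspace)" for c
    unfolding n_def[abs_def] by (intro differentiable_mult differentiable_const d\<nu>)
  \<comment> \<open>What the trace part leaves of the derivative of \<kappa>; the cube of the
    density times it is the skew tensor \<open>t\<close> of \<open>cky_form\<close>, from which it
    inherits its symmetries.\<close>
  define \<tau> where "\<tau> a b c z = cd2 G 0 \<kappa> a b c z - G z $ a $ b * n c z + G z $ a $ c * n b z" for a b c z
  have \<tau>: "\<tau> b a c z = - \<tau> a b c z \<and> \<tau> a c b z = - \<tau> a b c z" if z: "z \<in> W" for a b c z
  proof -
    obtain t where t: "\<And>a b d. cd2 G 3 K a b d z = t a b d + cmetric G z $ a $ b * N z d - cmetric G z $ a $ d * N z b"
      "\<And>a b d. t b a d = - t a b d" "\<And>a b d. t a d b = - t a b d"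
      using cky[OF z] unfolding cky_form_def by blast
    have "N z d = ?l z * n d z" for d
    proof -
      have "div2 G K d z = ?n * N z d"
        by (rule cky_form_div2[where G=G and x=z, OF nz[OF z] sym[OF z] cky[OF z]])
      then show ?thesis using l[OF z] n0 unfolding n_def \<nu>_def by simp
    qed
    then have "?l z ^ 3 * \<tau> a b c z = t a b c" for a b c
      using t(1)[of a b c] by (simp add: \<tau>_def cd2[OF z] cmetric_nth algebra_simps power2_eq_square power3_eq_cube)
    then have "?l z ^ 3 * \<tau> b a c z = ?l z ^ 3 * - \<tau> a b c z" "?l z ^ 3 * \<tau> a c b z = ?l z ^ 3 * - \<tau> a b c z"
      using t(2)[of b a c] t(3)[of a c b] by (metis mult_minus_right)+
    moreover have "?l z ^ 3 \<noteq> 0" using l[OF z] by simp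
    ultimately show ?thesis using mult_left_cancel by blast
  qed
  have kill: "cd1 G 0 n d c ?x + cd1 G 0 n c d ?x = 0" for d c
  proof (rule killing[OF card x \<kappa> _ dn _ _ _ einstein, where \<tau> = \<tau>])
    show "\<kappa> c b ?x = - \<kappa> b c ?x" for b c by (simp add: \<kappa>_def K_anti[OF x, of c b])
    show "cd2 G 0 \<kappa> a b c z = \<tau> a b c z + G z $ a $ b * n c z - G z $ a $ c * n b z" for a b c z
      by (simp add: \<tau>_def)
    show "\<tau> b a c z = - \<tau> a b c z" "\<tau> a c b z = - \<tau> a b c z" if "z \<in> W" for a b c z
      using \<tau>[OF that, of b a c] \<tau>[OF that, of a c b] by simp_all
  qed
  have kill': "cd1 G 0 \<nu> c d ?x = - cd1 G 0 \<nu> d c ?x" for d c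
  proof -
    have "cd1 G 0 n d c ?x = inverse ?n * cd1 G 0 \<nu> d c ?x" for d c
      by (simp add: cd1_def density_form_def n_def[abs_def] pd_mult[OF hs[OF x]] d\<nu> pd_const[OF hs[OF x]]
          right_diff_distrib sum_distrib_left mult.left_commute)
    then have "inverse ?n * (cd1 G 0 \<nu> d c ?x + cd1 G 0 \<nu> c d ?x) = 0" using kill[of d c] by (simp add: distrib_left)
    then show ?thesis using n0 by (simp add: add_eq_0_iff)
  qed
  let ?v = "v t"
  let ?\<Gamma> = "\<lambda>e. \<Sum>a\<in>UNIV. \<Sum>b\<in>UNIV. christoffel G e a b ?x * ?v $ a * ?v $ b"
  have w: "w $ e = \<alpha> * ?v $ e - ?\<Gamma> e" for e using pregeodesic[of e] by simp
  have v': "((\<lambda>s. v s $ a) has_real_derivative w $ a) (at t)" for a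
    using bounded_linear.has_vector_derivative[OF bounded_linear_vec_nth v]
    by (simp add: has_real_derivative_iff_has_vector_derivative)
  obtain S where S: "open S" "t \<in> S" "y ` S \<subseteq> W"
  proof -
    have "isCont y t" using y has_vector_derivative_continuous by blast
    then show ?thesis using that W(1) x continuous_at_open[of t y] by (metis image_subsetI)
  qed
  have chain: "((\<lambda>s. f (y s)) has_real_derivative (\<Sum>b\<in>UNIV. ?v $ b * pd b f ?x)) (at t)"
    if "f differentiable (at ?x within halfspace)" for f
  proof -
    have "y ` S \<subseteq> halfspace" using S(3) W(2) by auto
    then show ?thesis
      using has_real_derivative_chain[where y=y and t=t and S=S and v="?v" and f=f] that y S(1,2)
      by (simp add: at_within_open[of t S])
  qed
  define h1 where "h1 s = (\<Sum>a\<in>UNIV. v s $ a * \<nu> a (y s))" for s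
  define h2 where "h2 s = (\<Sum>a\<in>UNIV. \<Sum>b\<in>UNIV. v s $ a * (G (y s) $ a $ b * v s $ b))" for s
  have "(h1 has_real_derivative (\<Sum>a\<in>UNIV. w $ a * \<nu> a ?x + (\<Sum>b\<in>UNIV. ?v $ b * pd b (\<nu> a) ?x) * ?v $ a)) (at t)"
    unfolding h1_def[abs_def] by (rule DERIV_sum, rule DERIV_mult[OF v' chain[OF d\<nu>]])
  moreover have "(\<Sum>a\<in>UNIV. w $ a * \<nu> a ?x + (\<Sum>b\<in>UNIV. ?v $ b * pd b (\<nu> a) ?x) * ?v $ a) = \<alpha> * h1 t"
  proof -
    \<comment> \<open>The Killing equation, contracted with the symmetric product of velocities.
      Written out, it equates the derivative term of \<open>h1\<close> with the Christoffel term
      coming from the acceleration.\<close>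
    have "0 = (\<Sum>a\<in>UNIV. \<Sum>b\<in>UNIV. (?v $ a * ?v $ b) * cd1 G 0 \<nu> b a ?x)"
      by (rule sum_sym_antisym[symmetric]) (rule mult.commute, rule kill')
    also have "\<dots> = (\<Sum>a\<in>UNIV. \<Sum>b\<in>UNIV. ?v $ b * pd b (\<nu> a) ?x * ?v $ a)
        - (\<Sum>a\<in>UNIV. \<Sum>b\<in>UNIV. \<Sum>e\<in>UNIV. christoffel G e b a ?x * ?v $ b * ?v $ a * \<nu> e ?x)"
      by (simp add: cd1_def density_form_def right_diff_distrib sum_subtractf sum_distrib_left mult_ac)
    also have "(\<Sum>a\<in>UNIV. \<Sum>b\<in>UNIV. \<Sum>e\<in>UNIV. christoffel G e b a ?x * ?v $ b * ?v $ a * \<nu> e ?x) =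
        (\<Sum>e\<in>UNIV. ?\<Gamma> e * \<nu> e ?x)"
    proof -
      have "(\<Sum>a\<in>UNIV. \<Sum>b\<in>UNIV. \<Sum>e\<in>UNIV. christoffel G e b a ?x * ?v $ b * ?v $ a * \<nu> e ?x) =
        (\<Sum>a\<in>UNIV. \<Sum>e\<in>UNIV. \<Sum>b\<in>UNIV. christoffel G e b a ?x * ?v $ b * ?v $ a * \<nu> e ?x)"
        by (rule sum.cong[OF refl], rule sum.swap)
      also have "\<dots> = (\<Sum>e\<in>UNIV. \<Sum>a\<in>UNIV. \<Sum>b\<in>UNIV. christoffel G e b a ?x * ?v $ b * ?v $ a * \<nu> e ?x)"
        by (rule sum.swap)
      also have "\<dots> = (\<Sum>e\<in>UNIV. \<Sum>b\<in>UNIV. \<Sum>a\<in>UNIV. christoffel G e b a ?x * ?v $ b * ?v $ a * \<nu> e ?x)"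
        by (rule sum.cong[OF refl], rule sum.swap)
      finally show ?thesis by (simp add: sum_distrib_right)
    qed
    finally have "(\<Sum>a\<in>UNIV. \<Sum>b\<in>UNIV. ?v $ b * pd b (\<nu> a) ?x * ?v $ a) = (\<Sum>e\<in>UNIV. ?\<Gamma> e * \<nu> e ?x)"
      by simp
    moreover have "(\<Sum>a\<in>UNIV. w $ a * \<nu> a ?x) = \<alpha> * h1 t - (\<Sum>e\<in>UNIV. ?\<Gamma> e * \<nu> e ?x)"
      by (simp only: w h1_def left_diff_distrib sum_subtractf sum_distrib_left mult.assoc)
    ultimately show ?thesis by (simp only: sum.distrib sum_distrib_right)
  qed
  ultimately have h1: "(h1 has_real_derivative \<alpha> * h1 t) (at t)" by (simp only:)
  have dG: "(\<lambda>z. G z $ a $ b) differentiable (at ?x within halfspace)" for a b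
    using twice_diffD(1)[OF G x] .
  have "(h2 has_real_derivative (\<Sum>a\<in>UNIV. \<Sum>b\<in>UNIV. w $ a * (G ?x $ a $ b * ?v $ b)
      + ((\<Sum>c\<in>UNIV. ?v $ c * pd c (\<lambda>z. G z $ a $ b) ?x) * ?v $ b + w $ b * G ?x $ a $ b) * ?v $ a)) (at t)"
    unfolding h2_def[abs_def] by (rule DERIV_sum, rule DERIV_sum, rule DERIV_mult[OF v' DERIV_mult[OF chain[OF dG] v']])
  moreover have "(\<Sum>a\<in>UNIV. \<Sum>b\<in>UNIV. w $ a * (G ?x $ a $ b * ?v $ b)
      + ((\<Sum>c\<in>UNIV. ?v $ c * pd c (\<lambda>z. G z $ a $ b) ?x) * ?v $ b + w $ b * G ?x $ a $ b) * ?v $ a) = 2 * \<alpha> * h2 t"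
  proof -
    let ?T = "\<Sum>e\<in>UNIV. \<Sum>b\<in>UNIV. ?\<Gamma> e * (G ?x $ e $ b * ?v $ b)"
    have sw: "(\<Sum>a\<in>UNIV. \<Sum>b\<in>UNIV. f b * (G ?x $ a $ b * ?v $ a)) = (\<Sum>e\<in>UNIV. \<Sum>b\<in>UNIV. f e * (G ?x $ e $ b * ?v $ b))" for f
      by (subst sum.swap) (simp add: sym[OF x])
    have ww: "(\<Sum>a\<in>UNIV. \<Sum>b\<in>UNIV. w $ a * (G ?x $ a $ b * ?v $ b)) = \<alpha> * h2 t - ?T"
      by (simp add: w h2_def left_diff_distrib sum_subtractf sum_distrib_left mult.assoc)
    have 1: "(\<Sum>a\<in>UNIV. \<Sum>b\<in>UNIV. (\<Sum>c\<in>UNIV. ?v $ c * (\<Sum>e\<in>UNIV. christoffel G e c a ?x * G ?x $ e $ b)) * ?v $ b * ?v $ a) = ?T"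
    proof -
      have "(\<Sum>a\<in>UNIV. \<Sum>b\<in>UNIV. (\<Sum>c\<in>UNIV. ?v $ c * (\<Sum>e\<in>UNIV. christoffel G e c a ?x * G ?x $ e $ b)) * ?v $ b * ?v $ a) =
        (\<Sum>a\<in>UNIV. \<Sum>b\<in>UNIV. \<Sum>c\<in>UNIV. \<Sum>e\<in>UNIV. christoffel G e c a ?x * ?v $ c * ?v $ a * (G ?x $ e $ b * ?v $ b))"
        by (simp add: sum_distrib_left sum_distrib_right mult_ac)
      also have "\<dots> = (\<Sum>a\<in>UNIV. \<Sum>c\<in>UNIV. \<Sum>b\<in>UNIV. \<Sum>e\<in>UNIV. christoffel G e c a ?x * ?v $ c * ?v $ a * (G ?x $ e $ b * ?v $ b))"
        by (rule sum.cong[OF refl], rule sum.swap)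
      also have "\<dots> = (\<Sum>a\<in>UNIV. \<Sum>c\<in>UNIV. \<Sum>e\<in>UNIV. \<Sum>b\<in>UNIV. christoffel G e c a ?x * ?v $ c * ?v $ a * (G ?x $ e $ b * ?v $ b))"
        by (rule sum.cong[OF refl], rule sum.cong[OF refl], rule sum.swap)
      also have "\<dots> = (\<Sum>c\<in>UNIV. \<Sum>a\<in>UNIV. \<Sum>e\<in>UNIV. \<Sum>b\<in>UNIV. christoffel G e c a ?x * ?v $ c * ?v $ a * (G ?x $ e $ b * ?v $ b))"
        by (rule sum.swap)
      also have "\<dots> = (\<Sum>c\<in>UNIV. \<Sum>e\<in>UNIV. \<Sum>a\<in>UNIV. \<Sum>b\<in>UNIV. christoffel G e c a ?x * ?v $ c * ?v $ a * (G ?x $ e $ b * ?v $ b))"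
        by (rule sum.cong[OF refl], rule sum.swap)
      also have "\<dots> = (\<Sum>e\<in>UNIV. \<Sum>c\<in>UNIV. \<Sum>a\<in>UNIV. \<Sum>b\<in>UNIV. christoffel G e c a ?x * ?v $ c * ?v $ a * (G ?x $ e $ b * ?v $ b))"
        by (rule sum.swap)
      also have "\<dots> = (\<Sum>e\<in>UNIV. ?\<Gamma> e * (\<Sum>b\<in>UNIV. G ?x $ e $ b * ?v $ b))"
        by (simp only: sum_distrib_right[symmetric] sum_distrib_left[symmetric])
      finally show ?thesis by (simp only: sum_distrib_left[symmetric])
    qed
    have 2: "(\<Sum>a\<in>UNIV. \<Sum>b\<in>UNIV. (\<Sum>c\<in>UNIV. ?v $ c * (\<Sum>e\<in>UNIV. christoffel G e c b ?x * G ?x $ a $ e)) * ?v $ b * ?v $ a) = ?T"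
    proof (subst sum.swap, rule trans[OF _ 1], intro sum.cong refl)
      fix a b
      have "(\<Sum>e\<in>UNIV. christoffel G e c a ?x * G ?x $ b $ e) = (\<Sum>e\<in>UNIV. christoffel G e c a ?x * G ?x $ e $ b)" for c
        by (rule sum.cong[OF refl]) (simp only: sym[OF x, of b])
      then show "(\<Sum>c\<in>UNIV. ?v $ c * (\<Sum>e\<in>UNIV. christoffel G e c a ?x * G ?x $ b $ e)) * ?v $ a * ?v $ b =
        (\<Sum>c\<in>UNIV. ?v $ c * (\<Sum>e\<in>UNIV. christoffel G e c a ?x * G ?x $ e $ b)) * ?v $ b * ?v $ a"
        by (simp only: mult_ac)
    qed
    \<comment> \<open>Metric compatibility yields two copies of \<open>?T\<close>, which cancel the
      two produced by the acceleration.\<close>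
    have "(\<Sum>a\<in>UNIV. \<Sum>b\<in>UNIV. (\<Sum>c\<in>UNIV. ?v $ c * pd c (\<lambda>z. G z $ a $ b) ?x) * ?v $ b * ?v $ a) = 2 * ?T"
      unfolding compat[OF x] distrib_left sum.distrib distrib_right 1 2 by simp
    moreover have "(\<Sum>a\<in>UNIV. \<Sum>b\<in>UNIV. w $ b * G ?x $ a $ b * ?v $ a) = \<alpha> * h2 t - ?T"
      using sw[of "\<lambda>b. w $ b"] ww by (simp only: mult.assoc)
    ultimately show ?thesis
      unfolding distrib_right sum.distrib ww by simp
  qed
  ultimately have h2: "(h2 has_real_derivative 2 * \<alpha> * h2 t) (at t)" by (simp only:)
  have h2_eq: "v s \<bullet> (G (y s) *v v s) = h2 s" for s
    unfolding h2_def inner_vec_def matrix_vector_mult_def by (simp add: sum_distrib_left)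
  show ?thesis
    unfolding h2_eq \<nu>_def[symmetric] h1_def[symmetric]
    by (rule ratio_stationary[OF h1 h2]) (use nonnull in \<open>simp only: h2_eq not_False_eq_True\<close>)
qed

end

section \<open>Change of coordinates\<close>

lemma matrix_add_rdistrib: "(A + B) ** C = A ** C + B ** (C :: real ^ 'c ^ 'b::finite)"
  by (simp add: vec_eq_iff matrix_matrix_mult_def distrib_right sum.distrib)

lemma matrix_sub_rdistrib: "(A - B) ** C = A ** C - B ** (C :: real ^ 'c ^ 'b::finite)"
  by (simp add: vec_eq_iff matrix_matrix_mult_def left_diff_distrib sum_subtractf)

lemma matrix_sub_ldistrib: "C ** (A - B) = C ** A - C ** (B :: real ^ 'c ^ 'b::finite)"
  by (simp add: vec_eq_iff matrix_matrix_mult_def right_diff_distrib sum_subtractf)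

lemma at_within_halfspace: "open W \<Longrightarrow> W \<subseteq> halfspace \<Longrightarrow> x \<in> W \<Longrightarrow> at x within halfspace = at x"
  by (meson at_within_interior interior_maximal subsetD)

definition pd_matrix :: "'n::finite \<Rightarrow> (real ^ 'n \<Rightarrow> real ^ 'b ^ 'a) \<Rightarrow> real ^ 'n \<Rightarrow> real ^ 'b ^ 'a" where
  "pd_matrix a M x = (\<chi> i j. pd a (\<lambda>y. M y $ i $ j) x)"

definition diff_matrix :: "(real ^ 'n::finite \<Rightarrow> real ^ 'b ^ 'a) \<Rightarrow> real ^ 'n \<Rightarrow> bool" where
  "diff_matrix M x \<longleftrightarrow> (\<forall>i j. (\<lambda>y. M y $ i $ j) differentiable (at x within halfspace))"

lemma diff_matrix_mult:
  assumes "diff_matrix M x" "diff_matrix N x"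
  shows "diff_matrix (\<lambda>y. M y ** N y) x"
  using assms by (auto simp: diff_matrix_def matrix_matrix_mult_def intro!: differentiable_sum differentiable_mult)

lemma diff_matrix_transpose: "diff_matrix M x \<Longrightarrow> diff_matrix (\<lambda>y. transpose (M y)) x"
  by (simp add: diff_matrix_def transpose_def)

lemma pd_matrix_mult:
  assumes "x \<in> halfspace" "diff_matrix M x" "diff_matrix N x"
  shows "pd_matrix a (\<lambda>y. M y ** N y) x = pd_matrix a M x ** N x + M x ** pd_matrix a N x"
  using assms(2,3) by (simp add: vec_eq_iff pd_matrix_def matrix_matrix_mult_def diff_matrix_def
      pd_sum[OF assms(1)] pd_mult[OF assms(1)] differentiable_mult sum.distrib add.commute)

lemma pd_matrix_transpose: "pd_matrix a (\<lambda>y. transpose (M y)) x = transpose (pd_matrix a M x)"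
  by (simp add: vec_eq_iff pd_matrix_def transpose_def)

lemma sum_matrix_mult:
  fixes M :: "'i \<Rightarrow> real ^ 'b::finite ^ 'a::finite" and A :: "real ^ 'c::finite ^ 'b" and A' :: "real ^ 'a ^ 'c"
  shows "(\<Sum>h\<in>I. M h) ** A = (\<Sum>h\<in>I. M h ** A)" "A' ** (\<Sum>h\<in>I. M h) = (\<Sum>h\<in>I. A' ** M h)"
proof -
  have "(\<Sum>k\<in>UNIV. (\<Sum>h\<in>I. M h $ i $ k) * A $ k $ j) = (\<Sum>h\<in>I. \<Sum>k\<in>UNIV. M h $ i $ k * A $ k $ j)" for i j
    unfolding sum_distrib_right by (rule sum.swap)
  then show "(\<Sum>h\<in>I. M h) ** A = (\<Sum>h\<in>I. M h ** A)"
    by (simp add: vec_eq_iff matrix_matrix_mult_def)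
  have "(\<Sum>k\<in>UNIV. A' $ i $ k * (\<Sum>h\<in>I. M h $ k $ j)) = (\<Sum>h\<in>I. \<Sum>k\<in>UNIV. A' $ i $ k * M h $ k $ j)" for i j
    unfolding sum_distrib_left by (rule sum.swap)
  then show "A' ** (\<Sum>h\<in>I. M h) = (\<Sum>h\<in>I. A' ** M h)"
    by (simp add: vec_eq_iff matrix_matrix_mult_def)
qed

lemma scaleR_matrix_mult:
  fixes M :: "real ^ 'b::finite ^ 'a::finite" and N :: "real ^ 'c::finite ^ 'b"
  shows "(c *\<^sub>R M) ** N = c *\<^sub>R (M ** N)" "M ** (c *\<^sub>R N) = c *\<^sub>R (M ** N)"
  by (simp_all add: vec_eq_iff matrix_matrix_mult_def sum_distrib_left mult_ac)

lemma transpose_add: "transpose (M + N) = transpose M + (transpose N :: real ^ 'a ^ 'b)"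
  by (simp add: vec_eq_iff transpose_def)

text \<open>An open piece of one chart range is carried into another, with the metric pulled back.
  It is instantiated for the Einstein metric only, as all other scales are compared with that one
  inside a single chart.\<close>

locale coordinate_change = G: local_metric W G + G': local_metric W' G'
  for W W' :: "(real ^ 'n::finite) set" and G G' :: "real ^ 'n \<Rightarrow> real ^ 'n ^ 'n" +
  fixes \<phi> :: "real ^ 'n \<Rightarrow> real ^ 'n" and B :: "real ^ 'n \<Rightarrow> real ^ 'n ^ 'n"
  assumes \<phi>: "\<And>x. x \<in> W \<Longrightarrow> \<phi> x \<in> W'" "\<And>c. twice_diff W (\<lambda>x. \<phi> x $ c)"
    and B: "\<And>c a x. B x $ c $ a = pd a (\<lambda>x. \<phi> x $ c) x"
    and pull: "\<And>x. x \<in> W \<Longrightarrow> G x = transpose (B x) ** G' (\<phi> x) ** B x"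
begin

lemma chain:
  assumes x: "x \<in> W" and f: "f differentiable (at (\<phi> x) within halfspace)"
  shows "pd a (\<lambda>y. f (\<phi> y)) x = (\<Sum>c\<in>UNIV. B x $ c $ a * pd c f (\<phi> x))"
    and "(\<lambda>y. f (\<phi> y)) differentiable (at x within halfspace)"
proof -
  have "((\<lambda>y. \<phi> y $ c) has_derivative frechet_derivative (\<lambda>y. \<phi> y $ c) (at x within halfspace)) (at x within halfspace)" for c
    using twice_diffD(1)[OF \<phi>(2) x] frechet_derivative_works by blast
  then have \<phi>': "(\<phi> has_derivative (\<lambda>h. \<chi> c. frechet_derivative (\<lambda>y. \<phi> y $ c) (at x within halfspace) h)) (at x within halfspace)"
    by (subst has_derivative_componentwise_within) (auto simp: Basis_vec_def inner_axis)
  have xW: "at x within halfspace = at x"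
    by (rule at_within_halfspace[OF G.W x])
  have \<phi>xW: "at (\<phi> x) within halfspace = at (\<phi> x)"
    by (rule at_within_halfspace[OF G'.W \<phi>(1)[OF x]])
  have "(f has_derivative (\<lambda>h. \<Sum>i\<in>UNIV. h $ i * pd i f (\<phi> x))) (at (\<phi> x))"
    using differentiable_has_pd[OF f] \<phi>xW by simp
  from diff_chain_at[OF \<phi>'[unfolded xW] this]
  have *: "((\<lambda>y. f (\<phi> y)) has_derivative
      (\<lambda>h. \<Sum>i\<in>UNIV. frechet_derivative (\<lambda>y. \<phi> y $ i) (at x) h * pd i f (\<phi> x))) (at x within halfspace)"
    by (simp add: o_def xW)
  show "pd a (\<lambda>y. f (\<phi> y)) x = (\<Sum>c\<in>UNIV. B x $ c $ a * pd c f (\<phi> x))"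
    using pd_eqI[OF * G.hs[OF x], of a] by (simp add: B pd_def xW)
  show "(\<lambda>y. f (\<phi> y)) differentiable (at x within halfspace)"
    using * differentiable_def by blast
qed

lemma detB: "x \<in> W \<Longrightarrow> det (B x) \<noteq> 0"
  using G.nz[of x] by (auto simp: pull det_mul)

lemma diff_B: "x \<in> W \<Longrightarrow> diff_matrix B x"
  unfolding diff_matrix_def B by (simp add: twice_diffD(2)[OF \<phi>(2)])

text \<open>The connection matrix of \<open>G'\<close> in the direction of the image of the
  \<open>a\<close>-th coordinate vector. In this notation the transformation law reads B \<Gamma>_a
  = C_a B + d_a B.\<close>

definition C :: "'n \<Rightarrow> real ^ 'n \<Rightarrow> real ^ 'n ^ 'n" where
  "C a x = (\<Sum>h\<in>UNIV. B x $ h $ a *\<^sub>R (\<chi> e b. christoffel G' e h b (\<phi> x)))"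

lemma pd_matrix_pull:
  assumes x: "x \<in> W" and M: "diff_matrix M (\<phi> x)"
  shows "pd_matrix a (\<lambda>y. transpose (B y) ** M (\<phi> y) ** B y) x =
    transpose (pd_matrix a B x) ** M (\<phi> x) ** B x
    + transpose (B x) ** (\<Sum>h\<in>UNIV. B x $ h $ a *\<^sub>R pd_matrix h M (\<phi> x)) ** B x
    + transpose (B x) ** M (\<phi> x) ** pd_matrix a B x"
proof -
  have M\<phi>: "diff_matrix (\<lambda>y. M (\<phi> y)) x"
    unfolding diff_matrix_def
  proof (intro allI)
    fix i j
    have "(\<lambda>z. M z $ i $ j) differentiable (at (\<phi> x) within halfspace)" using M by (simp add: diff_matrix_def)
    from chain(2)[OF x this] show "(\<lambda>y. M (\<phi> y) $ i $ j) differentiable (at x within halfspace)" .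
  qed
  have "pd_matrix a (\<lambda>y. M (\<phi> y)) x = (\<Sum>h\<in>UNIV. B x $ h $ a *\<^sub>R pd_matrix h M (\<phi> x))"
  proof -
    have "pd a (\<lambda>y. M (\<phi> y) $ i $ j) x = (\<Sum>h\<in>UNIV. B x $ h $ a * pd h (\<lambda>z. M z $ i $ j) (\<phi> x))" for i j
    proof -
      have "(\<lambda>z. M z $ i $ j) differentiable (at (\<phi> x) within halfspace)" using M by (simp add: diff_matrix_def)
      from chain(1)[OF x this] show ?thesis .
    qed
    then show ?thesis by (simp add: vec_eq_iff pd_matrix_def)
  qed
  then show ?thesis
    by (simp add: pd_matrix_mult[OF G.hs[OF x]] diff_matrix_mult diff_matrix_transpose diff_B[OF x] M\<phi>
        pd_matrix_transpose matrix_add_rdistrib)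
qed

text \<open>The candidate obtained by solving the law for \<Gamma>_a is compatible with the pulled
  back metric, by differentiating \<open>pull\<close>, and symmetric;
  \<open>christoffel_unique\<close> concludes.\<close>

lemma christoffel_pull:
  assumes x: "x \<in> W"
  shows "B x ** (\<chi> e b. christoffel G e a b x) = C a x ** B x + pd_matrix a B x"
proof -
  let ?M = "\<lambda>a. C a x ** B x + pd_matrix a B x"
  let ?\<Gamma> = "\<lambda>a. matrix_inv (B x) ** ?M a"
  have B\<Gamma>: "B x ** ?\<Gamma> a = ?M a" for a
    using matrix_inv_right(1)[OF detB[OF x]] by (simp add: matrix_mul_assoc)
  have G\<Gamma>: "G x ** ?\<Gamma> a = transpose (B x) ** G' (\<phi> x) ** ?M a" for a
  proof -
    have "G x ** ?\<Gamma> a = (transpose (B x) ** G' (\<phi> x)) ** (B x ** ?\<Gamma> a)"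
      by (simp only: pull[OF x] matrix_mul_assoc)
    then show ?thesis by (simp only: B\<Gamma>)
  qed
  have symG: "transpose (G x) = G x" "transpose (G' (\<phi> x)) = G' (\<phi> x)"
    using G.sym[OF x] G'.sym[OF \<phi>(1)[OF x]] by (auto simp: vec_eq_iff transpose_def)
  have dG': "diff_matrix G' (\<phi> x)"
    using twice_diffD(1)[OF G'.G \<phi>(1)[OF x]] by (simp add: diff_matrix_def)
  have pdG': "(\<Sum>h\<in>UNIV. B x $ h $ a *\<^sub>R pd_matrix h G' (\<phi> x)) = transpose (C a x) ** G' (\<phi> x) + G' (\<phi> x) ** C a x" for a
  proof -
    have "pd_matrix h G' (\<phi> x) = transpose (\<chi> e b. christoffel G' e h b (\<phi> x)) ** G' (\<phi> x)
        + G' (\<phi> x) ** (\<chi> e b. christoffel G' e h b (\<phi> x))" for h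
      by (simp add: vec_eq_iff pd_matrix_def G'.compat[OF \<phi>(1)[OF x]] matrix_matrix_mult_def transpose_def mult.commute)
    moreover have "transpose (C a x) = (\<Sum>h\<in>UNIV. B x $ h $ a *\<^sub>R transpose (\<chi> e b. christoffel G' e h b (\<phi> x)))"
      by (simp add: vec_eq_iff C_def transpose_def)
    ultimately show ?thesis
      by (simp add: C_def sum_matrix_mult scaleR_matrix_mult scaleR_add_right sum.distrib)
  qed
  have "pd_matrix a G x = transpose (G x ** ?\<Gamma> a) + G x ** ?\<Gamma> a" for a
  proof -
    have "pd_matrix a G x = pd_matrix a (\<lambda>y. transpose (B y) ** G' (\<phi> y) ** B y) x"
    proof -
      have "pd a (\<lambda>y. G y $ i $ j) x = pd a (\<lambda>y. (transpose (B y) ** G' (\<phi> y) ** B y) $ i $ j) x" for i j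
        by (rule G.cong(1)[OF x]) (simp only: pull)
      then show ?thesis by (simp only: pd_matrix_def)
    qed
    also have "\<dots> = transpose (?M a) ** G' (\<phi> x) ** B x + transpose (B x) ** G' (\<phi> x) ** ?M a"
      unfolding pd_matrix_pull[OF x dG'] pdG'
      by (simp add: transpose_add matrix_transpose_mul matrix_add_rdistrib matrix_add_ldistrib matrix_mul_assoc)
    also have "\<dots> = transpose (G x ** ?\<Gamma> a) + G x ** ?\<Gamma> a"
      unfolding G\<Gamma> by (simp add: matrix_transpose_mul symG matrix_mul_assoc)
    finally show ?thesis .
  qed
  then have compat: "pd a (\<lambda>y. G y $ b $ c) x = (G x ** ?\<Gamma> a) $ c $ b + (G x ** ?\<Gamma> a) $ b $ c" for a b c
    by (simp add: pd_matrix_def vec_eq_iff transpose_def)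
  \<comment> \<open>Torsion-freeness of the candidate rests on the symmetry of the Christoffel
    symbols of \<open>G'\<close> and on the symmetry of the second derivatives of \<phi>.\<close>
  have symM: "?M a $ e $ b = ?M b $ e $ a" for a b e
  proof -
    have "(C a x ** B x) $ e $ b = (\<Sum>k\<in>UNIV. \<Sum>h\<in>UNIV. B x $ h $ a * christoffel G' e h k (\<phi> x) * B x $ k $ b)" for a b
      by (simp add: C_def matrix_matrix_mult_def sum_distrib_right)
    moreover have "(\<Sum>k\<in>UNIV. \<Sum>h\<in>UNIV. B x $ h $ a * christoffel G' e h k (\<phi> x) * B x $ k $ b) =
        (\<Sum>k\<in>UNIV. \<Sum>h\<in>UNIV. B x $ h $ b * christoffel G' e h k (\<phi> x) * B x $ k $ a)"
      by (subst sum.swap) (simp add: G'.christoffel_sym[OF \<phi>(1)[OF x]] mult_ac)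
    moreover have "pd_matrix a B x $ e $ b = pd_matrix b B x $ e $ a"
      using twice_diffD(3)[OF \<phi>(2) x] by (simp add: pd_matrix_def B)
    ultimately show ?thesis by simp
  qed
  have "christoffel G e a b x = ?\<Gamma> a $ e $ b" for e a b
  proof (rule christoffel_unique[where G=G and x=x, OF G.nz[OF x] G.sym[OF x]])
    show "?\<Gamma> a $ e $ b = ?\<Gamma> b $ e $ a" for e a b
      using symM by (simp add: matrix_matrix_mult_def)
    show "pd a (\<lambda>y. G y $ b $ c) x = (\<Sum>e\<in>UNIV. G x $ c $ e * ?\<Gamma> a $ e $ b) + (\<Sum>e\<in>UNIV. G x $ b $ e * ?\<Gamma> a $ e $ c)" for a b c
      unfolding compat by (simp add: matrix_matrix_mult_def)
  qed
  then have "(\<chi> e b. christoffel G e a b x) = ?\<Gamma> a" by (simp add: vec_eq_iff)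
  then show ?thesis by (simp only: B\<Gamma>)
qed

text \<open>The inhomogeneous terms of \<open>christoffel_pull\<close> cancel the derivatives of
  \<open>B\<close> that arise from differentiating the pulled back components, so the covariant
  derivative is again a tensor.\<close>

lemma cd2_pull:
  assumes x: "x \<in> W" and M': "\<And>b c. M' b c differentiable (at (\<phi> x) within halfspace)"
    and M: "\<And>y b c. y \<in> W \<Longrightarrow> M b c y = (transpose (B y) ** (\<chi> b c. M' b c (\<phi> y)) ** B y) $ b $ c"
  shows "(\<chi> b c. cd2 G 0 M a b c x) = transpose (B x) **
    (\<Sum>h\<in>UNIV. B x $ h $ a *\<^sub>R (\<chi> b c. cd2 G' 0 M' h b c (\<phi> x))) ** B x"
proof -
  let ?\<Gamma> = "\<chi> e b. christoffel G e a b x"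
  let ?\<Gamma>' = "\<lambda>h. \<chi> e b. christoffel G' e h b (\<phi> x)"
  let ?M = "\<chi> b c. M b c x" and ?M' = "\<lambda>z. \<chi> b c. M' b c z"
  have cd: "(\<chi> b c. cd2 H 0 L a b c z) = (\<chi> b c. pd a (L b c) z)
      - transpose (\<chi> e b. christoffel H e a b z) ** (\<chi> b c. L b c z)
      - (\<chi> b c. L b c z) ** (\<chi> e b. christoffel H e a b z)" for H L a z
    by (simp add: vec_eq_iff cd2_def density_form_def matrix_matrix_mult_def transpose_def mult.commute)
  have dM': "diff_matrix ?M' (\<phi> x)" using M' by (simp add: diff_matrix_def)
  have Mx: "?M = transpose (B x) ** ?M' (\<phi> x) ** B x" using M[OF x] by (simp add: vec_eq_iff)
  have "(\<chi> b c. pd a (M b c) x) = pd_matrix a (\<lambda>y. transpose (B y) ** ?M' (\<phi> y) ** B y) x"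
  proof -
    have "pd a (M i j) x = pd a (\<lambda>y. (transpose (B y) ** ?M' (\<phi> y) ** B y) $ i $ j) x" for i j
      by (rule G.cong(1)[OF x]) (rule M)
    then show ?thesis by (simp only: pd_matrix_def)
  qed
  also have "\<dots> = transpose (pd_matrix a B x) ** ?M' (\<phi> x) ** B x
    + transpose (B x) ** (\<Sum>h\<in>UNIV. B x $ h $ a *\<^sub>R pd_matrix h ?M' (\<phi> x)) ** B x
    + transpose (B x) ** ?M' (\<phi> x) ** pd_matrix a B x"
    by (rule pd_matrix_pull[OF x dM'])
  finally have pdM: "(\<chi> b c. pd a (M b c) x) = \<dots>" .
  have M\<Gamma>: "?M ** ?\<Gamma> = transpose (B x) ** ?M' (\<phi> x) ** (C a x ** B x + pd_matrix a B x)"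
    unfolding Mx christoffel_pull[OF x, symmetric] by (simp only: matrix_mul_assoc)
  have \<Gamma>M: "transpose ?\<Gamma> ** ?M = transpose (C a x ** B x + pd_matrix a B x) ** ?M' (\<phi> x) ** B x"
    unfolding Mx christoffel_pull[OF x, symmetric] matrix_transpose_mul by (simp only: matrix_mul_assoc)
  have tC: "transpose (C a x) = (\<Sum>h\<in>UNIV. B x $ h $ a *\<^sub>R transpose (?\<Gamma>' h))"
    by (simp add: vec_eq_iff C_def transpose_def)
  have "(\<Sum>h\<in>UNIV. B x $ h $ a *\<^sub>R (\<chi> b c. cd2 G' 0 M' h b c (\<phi> x))) =
     (\<Sum>h\<in>UNIV. B x $ h $ a *\<^sub>R pd_matrix h ?M' (\<phi> x)) - transpose (C a x) ** ?M' (\<phi> x) - ?M' (\<phi> x) ** C a x"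
    unfolding cd tC by (simp add: C_def sum_matrix_mult scaleR_matrix_mult scaleR_diff_right sum_subtractf pd_matrix_def)
  then show ?thesis
    unfolding cd pdM M\<Gamma> \<Gamma>M
    by (simp add: transpose_add matrix_transpose_mul matrix_add_rdistrib matrix_add_ldistrib matrix_mul_assoc
        matrix_sub_rdistrib matrix_sub_ldistrib)
qed

lemma scale_density_pull:
  assumes x: "x \<in> W"
  shows "scale_density G x = \<bar>det (B x)\<bar> powr (- 1 / real CARD('n)) * scale_density G' (\<phi> x)"
proof -
  have "\<bar>det (G x)\<bar> = (\<bar>det (B x)\<bar> powr 2) * \<bar>det (G' (\<phi> x))\<bar>"
    using detB[OF x] by (simp add: pull[OF x] det_mul abs_mult power2_eq_square)
  then have "scale_density G x =
      (\<bar>det (B x)\<bar> powr 2) powr (- 1 / (2 * real CARD('n))) * \<bar>det (G' (\<phi> x))\<bar> powr (- 1 / (2 * real CARD('n)))"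
    unfolding scale_density_def by (simp only: powr_mult powr_ge_zero abs_ge_zero)
  also have "(\<bar>det (B x)\<bar> powr 2) powr (- 1 / (2 * real CARD('n))) = \<bar>det (B x)\<bar> powr (- 1 / real CARD('n))"
    unfolding powr_powr by simp
  finally show ?thesis by (simp only: scale_density_def)
qed

lemma matrix_inv_pull:
  assumes x: "x \<in> W"
  shows "B x ** matrix_inv (G x) ** transpose (B x) = matrix_inv (G' (\<phi> x))"
proof -
  let ?Bt = "transpose (B x)" and ?H = "matrix_inv (G x)"
  have inv: "matrix_inv ?Bt ** ?Bt = mat 1" "?Bt ** matrix_inv ?Bt = mat 1"
    using matrix_inv_right[of ?Bt] detB[OF x] by simp_all
  have "?Bt ** (G' (\<phi> x) ** B x ** ?H) = mat 1"
    using matrix_inv_right(1)[OF G.nz[OF x]] by (simp add: pull[OF x] matrix_mul_assoc)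
  then have "G' (\<phi> x) ** B x ** ?H = matrix_inv ?Bt"
    by (rule matrix_inv_unique[symmetric])
  then have "G' (\<phi> x) ** (B x ** ?H ** ?Bt) = mat 1"
    using inv by (simp add: matrix_mul_assoc)
  then show ?thesis by (rule matrix_inv_unique[symmetric])
qed

text \<open>After division by the density, the divergence is a covector of weight zero built from
  tensorial pieces, hence it pulls back with a single Jacobian factor.\<close>

lemma div2_pull:
  assumes x: "x \<in> W" and K: "\<And>b c. twice_diff W (K b c)" "\<And>b c. twice_diff W' (K' b c)"
    and law: "\<And>y. y \<in> W \<Longrightarrow> (\<chi> b c. K b c y) = \<bar>det (B y)\<bar> powr (- 3 / real CARD('n)) *\<^sub>R
      (transpose (B y) ** (\<chi> b c. K' b c (\<phi> y)) ** B y)"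
  shows "div2 G K d x / scale_density G x =
    (\<Sum>l\<in>UNIV. B x $ l $ d * (div2 G' K' l (\<phi> x) / scale_density G' (\<phi> x)))"
proof -
  let ?\<phi>x = "\<phi> x" and ?H = "matrix_inv (G x)" and ?H' = "matrix_inv (G' (\<phi> x))"
  define M where "M b c y = K b c y * inverse (scale_density G y ^ 3)" for b c y
  define M' where "M' b c y = K' b c y * inverse (scale_density G' y ^ 3)" for b c y
  have "M b c y = (transpose (B y) ** (\<chi> b c. M' b c (\<phi> y)) ** B y) $ b $ c" if y: "y \<in> W" for b c y
  proof -
    let ?b = "\<bar>det (B y)\<bar>" and ?s = "scale_density G' (\<phi> y)"
    have s: "?s > 0" by (rule scale_density_pos) (rule G'.nz[OF \<phi>(1)[OF y]])
    have b: "?b > 0" using detB[OF y] by simp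
    \<comment> \<open>The Jacobian factor of a density of weight 3 is the cube of the factor of the
      scale density, so the quotient \<open>M\<close> transforms without any determinant.\<close>
    have "scale_density G y ^ 3 = ?b powr (- 3 / real CARD('n)) * ?s ^ 3"
      unfolding scale_density_pull[OF y] power_mult_distrib
      using b by (simp add: powr_power)
    moreover have "?b powr (- 3 / real CARD('n)) \<noteq> 0" using b by simp
    moreover have "K b c y = ?b powr (- 3 / real CARD('n)) * (transpose (B y) ** (\<chi> b c. K' b c (\<phi> y)) ** B y) $ b $ c"
      using law[OF y] by (simp add: vec_eq_iff)
    ultimately have "M b c y = (transpose (B y) ** (\<chi> b c. K' b c (\<phi> y)) ** B y) $ b $ c * inverse (?s ^ 3)"
      using s by (simp add: M_def)
    then show ?thesis
      by (simp add: M'_def matrix_matrix_mult_def sum_distrib_right sum_distrib_left mult_ac)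
  qed
  then have D: "(\<chi> b c. cd2 G 0 M a b c x) = transpose (B x) **
    (\<Sum>h\<in>UNIV. B x $ h $ a *\<^sub>R (\<chi> b c. cd2 G' 0 M' h b c ?\<phi>x)) ** B x" for a
    by (intro cd2_pull[OF x]) (auto simp: M'_def[abs_def] intro: twice_diffD(1)[OF G'.twice_diff_unweighted[OF K(2)] \<phi>(1)[OF x]])
  have cdD: "cd2 G 0 M q p d x = (\<Sum>k\<in>UNIV. \<Sum>h\<in>UNIV. B x $ k $ p * B x $ h $ q * (\<Sum>l\<in>UNIV. cd2 G' 0 M' h k l ?\<phi>x * B x $ l $ d))" for p q
  proof -
    have "cd2 G 0 M q p d x = (transpose (B x) ** ((\<Sum>h\<in>UNIV. B x $ h $ q *\<^sub>R (\<chi> b c. cd2 G' 0 M' h b c ?\<phi>x)) ** B x)) $ p $ d"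
      using arg_cong[OF D[of q], of "\<lambda>m. m $ p $ d"] by (simp only: matrix_mul_assoc vec_lambda_beta)
    also have "\<dots> = (\<Sum>h\<in>UNIV. B x $ h $ q * (\<Sum>k\<in>UNIV. B x $ k $ p * (\<Sum>l\<in>UNIV. cd2 G' 0 M' h k l ?\<phi>x * B x $ l $ d)))"
      unfolding sum_matrix_mult scaleR_matrix_mult by (simp add: matrix_matrix_mult_def transpose_def)
    also have "\<dots> = (\<Sum>h\<in>UNIV. \<Sum>k\<in>UNIV. B x $ k $ p * B x $ h $ q * (\<Sum>l\<in>UNIV. cd2 G' 0 M' h k l ?\<phi>x * B x $ l $ d))"
      by (simp only: sum_distrib_left[of "B x $ _ $ q"] mult_ac)
    also have "\<dots> = (\<Sum>k\<in>UNIV. \<Sum>h\<in>UNIV. B x $ k $ p * B x $ h $ q * (\<Sum>l\<in>UNIV. cd2 G' 0 M' h k l ?\<phi>x * B x $ l $ d))"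
      by (rule sum.swap)
    finally show ?thesis .
  qed
  have H': "?H' $ k $ h = (\<Sum>q\<in>UNIV. \<Sum>p\<in>UNIV. B x $ k $ p * ?H $ p $ q * B x $ h $ q)" for k h
    unfolding matrix_inv_pull[OF x, symmetric] by (simp add: matrix_matrix_mult_def transpose_def sum_distrib_right)
  have "div2 G K d x / scale_density G x = (\<Sum>p\<in>UNIV. \<Sum>q\<in>UNIV. ?H $ p $ q * cd2 G 0 M q p d x)"
    unfolding M_def[abs_def] by (rule G.div2_unweighted[OF x K(1)])
  \<comment> \<open>From here on the sums are only reordered, until the two Jacobians surrounding
    the inverse of \<open>G\<close> can be recognised as the inverse of \<open>G'\<close>.\<close>
  also have "\<dots> = (\<Sum>p\<in>UNIV. \<Sum>q\<in>UNIV. \<Sum>k\<in>UNIV. \<Sum>h\<in>UNIV. B x $ k $ p * ?H $ p $ q * B x $ h $ q *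
      (\<Sum>l\<in>UNIV. cd2 G' 0 M' h k l ?\<phi>x * B x $ l $ d))"
    unfolding cdD by (simp only: sum_distrib_left[of "?H $ _ $ _"] mult_ac)
  also have "\<dots> = (\<Sum>p\<in>UNIV. \<Sum>k\<in>UNIV. \<Sum>q\<in>UNIV. \<Sum>h\<in>UNIV. B x $ k $ p * ?H $ p $ q * B x $ h $ q *
      (\<Sum>l\<in>UNIV. cd2 G' 0 M' h k l ?\<phi>x * B x $ l $ d))"
    by (rule sum.cong[OF refl], rule sum.swap)
  also have "\<dots> = (\<Sum>k\<in>UNIV. \<Sum>p\<in>UNIV. \<Sum>q\<in>UNIV. \<Sum>h\<in>UNIV. B x $ k $ p * ?H $ p $ q * B x $ h $ q *
      (\<Sum>l\<in>UNIV. cd2 G' 0 M' h k l ?\<phi>x * B x $ l $ d))"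
    by (rule sum.swap)
  also have "\<dots> = (\<Sum>k\<in>UNIV. \<Sum>p\<in>UNIV. \<Sum>h\<in>UNIV. \<Sum>q\<in>UNIV. B x $ k $ p * ?H $ p $ q * B x $ h $ q *
      (\<Sum>l\<in>UNIV. cd2 G' 0 M' h k l ?\<phi>x * B x $ l $ d))"
    by (rule sum.cong[OF refl], rule sum.cong[OF refl], rule sum.swap)
  also have "\<dots> = (\<Sum>k\<in>UNIV. \<Sum>h\<in>UNIV. \<Sum>p\<in>UNIV. \<Sum>q\<in>UNIV. B x $ k $ p * ?H $ p $ q * B x $ h $ q *
      (\<Sum>l\<in>UNIV. cd2 G' 0 M' h k l ?\<phi>x * B x $ l $ d))"
    by (rule sum.cong[OF refl], rule sum.swap)
  also have "\<dots> = (\<Sum>k\<in>UNIV. \<Sum>h\<in>UNIV. \<Sum>q\<in>UNIV. \<Sum>p\<in>UNIV. B x $ k $ p * ?H $ p $ q * B x $ h $ q *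
      (\<Sum>l\<in>UNIV. cd2 G' 0 M' h k l ?\<phi>x * B x $ l $ d))"
    by (rule sum.cong[OF refl], rule sum.cong[OF refl], rule sum.swap)
  also have "\<dots> = (\<Sum>k\<in>UNIV. \<Sum>h\<in>UNIV. ?H' $ k $ h * (\<Sum>l\<in>UNIV. cd2 G' 0 M' h k l ?\<phi>x * B x $ l $ d))"
    unfolding H' by (simp only: sum_distrib_right)
  also have "\<dots> = (\<Sum>k\<in>UNIV. \<Sum>h\<in>UNIV. \<Sum>l\<in>UNIV. B x $ l $ d * (?H' $ k $ h * cd2 G' 0 M' h k l ?\<phi>x))"
    by (simp only: sum_distrib_left mult_ac)
  also have "\<dots> = (\<Sum>k\<in>UNIV. \<Sum>l\<in>UNIV. \<Sum>h\<in>UNIV. B x $ l $ d * (?H' $ k $ h * cd2 G' 0 M' h k l ?\<phi>x))"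
    by (rule sum.cong[OF refl], rule sum.swap)
  also have "\<dots> = (\<Sum>l\<in>UNIV. \<Sum>k\<in>UNIV. \<Sum>h\<in>UNIV. B x $ l $ d * (?H' $ k $ h * cd2 G' 0 M' h k l ?\<phi>x))"
    by (rule sum.swap)
  also have "\<dots> = (\<Sum>l\<in>UNIV. B x $ l $ d * (div2 G' K' l (\<phi> x) / scale_density G' (\<phi> x)))"
    unfolding G'.div2_unweighted[OF \<phi>(1)[OF x] K(2)] M'_def[abs_def] by (simp only: sum_distrib_left)
  finally show ?thesis .
qed

end

section \<open>Tractors along a curve\<close>

lemma UNIV_tindex: "(UNIV :: 'n tindex set) = insert TY (insert TX (range TZ))"
  using tindex.exhaust by auto

lemma sum_tindex: "(\<Sum>A\<in>UNIV. f A) = f TY + (f TX + (\<Sum>a\<in>UNIV. f (TZ a)))"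
  for f :: "'n::finite tindex \<Rightarrow> 'b::comm_monoid_add"
proof -
  have "inj (TZ :: 'n \<Rightarrow> 'n tindex)" by (simp add: inj_def)
  then have "(\<Sum>A\<in>range TZ. f A) = (\<Sum>a\<in>UNIV. f (TZ a))" using sum.reindex[of TZ UNIV f] by (simp add: o_def)
  moreover have "TY \<notin> insert TX (range (TZ :: 'n \<Rightarrow> 'n tindex))" "TX \<notin> range (TZ :: 'n \<Rightarrow> 'n tindex)" by auto
  moreover have "finite (range (TZ :: 'n \<Rightarrow> 'n tindex))" by (rule finite_imageI) simp
  ultimately show ?thesis unfolding UNIV_tindex by (simp only: sum.insert finite_insert not_False_eq_True)
qed

lemma trX_nth: "trX $ A = (if A = TX then 1 else 0)"
  by (simp add: trX_def axis_def)

lemma mk_tractor_nth [simp]: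
  "mk_tractor s m r $ TY = s" "mk_tractor s m r $ TZ a = m $ a" "mk_tractor s m r $ TX = r"
  by (simp_all add: mk_tractor_def trX_def trY_def trZ_def axis_def if_distrib[of "\<lambda>z. _ * z"] cong: if_cong)

lemma lowX_nth [simp]: "lowX G x $ TY = 1" "lowX G x $ TZ a = 0" "lowX G x $ TX = 0"
  by (simp_all add: lowX_def trX_def tractor_metric_def matrix_vector_mult_basis column_def)

lemma lowY_nth [simp]: "lowY G x $ TY = 0" "lowY G x $ TZ a = 0" "lowY G x $ TX = 1"
  by (simp_all add: lowY_def trY_def tractor_metric_def matrix_vector_mult_basis column_def)

lemma lowZ_nth:
  fixes G :: "real ^ 'n::finite \<Rightarrow> real ^ 'n ^ 'n"
  assumes "det (G x) \<noteq> 0" "\<And>a b. G x $ a $ b = G x $ b $ a"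
  shows "lowZ G a x $ TY = 0" "lowZ G a x $ TZ b = (if a = b then 1 else 0)" "lowZ G a x $ TX = 0"
proof -
  define z where "z = (\<Sum>b\<in>UNIV. cinverse G x $ a $ b *\<^sub>R (trZ b :: 'n tractor))"
  have v: "z $ TY = 0" "z $ TX = 0" "z $ TZ c = cinverse G x $ a $ c" for c
    by (simp_all add: z_def trZ_def axis_def if_distrib[of "\<lambda>z. _ * z"] cong: if_cong)
  have low: "lowZ G a x = tractor_metric G x *v z" by (simp add: lowZ_def z_def)
  have "lowZ G a x $ TZ b = (\<Sum>c\<in>UNIV. cinverse G x $ a $ c * cmetric G x $ c $ b)"
    using assms(2) by (simp add: low matrix_vector_mult_def sum_tindex v tractor_metric_def cmetric_nth mult.commute)
  then show "lowZ G a x $ TZ b = (if a = b then 1 else 0)"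
    using cinverse_cmetric[where G=G, OF assms(1), of a b] by simp
  show "lowZ G a x $ TY = 0" "lowZ G a x $ TX = 0"
    by (simp_all add: low matrix_vector_mult_def sum_tindex v tractor_metric_def)
qed

text \<open>Renaming summation indices by a transposition changes the sign of \<open>w\<close>; so
  the six signed terms of the alternation all contribute the same sum, and their average is that
  sum.\<close>

lemma alt3_contract:
  fixes w :: "'i::finite \<Rightarrow> 'i \<Rightarrow> 'i \<Rightarrow> real"
  assumes w1: "\<And>A B C. w B A C = - w A B C" and w2: "\<And>A B C. w A C B = - w A B C"
  shows "(\<Sum>A\<in>UNIV. \<Sum>B\<in>UNIV. \<Sum>C\<in>UNIV. alt3 T A B C * w A B C) = (\<Sum>A\<in>UNIV. \<Sum>B\<in>UNIV. \<Sum>C\<in>UNIV. T A B C * w A B C)"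
proof -
  define S where "S f = (\<Sum>A\<in>UNIV. \<Sum>B\<in>UNIV. \<Sum>C\<in>UNIV. f A B C)" for f :: "'i \<Rightarrow> 'i \<Rightarrow> 'i \<Rightarrow> real"
  have s1: "S (\<lambda>A B C. f B A C) = S f" for f unfolding S_def by (rule sum.swap)
  have s2: "S (\<lambda>A B C. f A C B) = S f" for f
    unfolding S_def by (rule sum.cong[OF refl], rule sum.swap)
  have neg: "S (\<lambda>A B C. - f A B C) = - S f" for f by (simp add: S_def sum_negf)
  have t1: "S (\<lambda>A B C. U B A C * w A B C) = - S (\<lambda>A B C. U A B C * w A B C)" for U
  proof -
    have "(\<lambda>A B C. U B A C * w A B C) = (\<lambda>A B C. - (U B A C * w B A C))"
    proof (intro ext)
      show "U B A C * w A B C = - (U B A C * w B A C)" for A B C using w1[of A B C] by simp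
    qed
    then have "S (\<lambda>A B C. U B A C * w A B C) = S (\<lambda>A B C. - (U B A C * w B A C))" by (rule arg_cong[where f = S])
    also have "\<dots> = S (\<lambda>A B C. - (U A B C * w A B C))" by (rule s1)
    also have "\<dots> = - S (\<lambda>A B C. U A B C * w A B C)" by (rule neg)
    finally show ?thesis .
  qed
  have t2: "S (\<lambda>A B C. U A C B * w A B C) = - S (\<lambda>A B C. U A B C * w A B C)" for U
  proof -
    have "(\<lambda>A B C. U A C B * w A B C) = (\<lambda>A B C. - (U A C B * w A C B))"
    proof (intro ext)
      show "U A C B * w A B C = - (U A C B * w A C B)" for A B C using w2[of A B C] by simp
    qed
    then have "S (\<lambda>A B C. U A C B * w A B C) = S (\<lambda>A B C. - (U A C B * w A C B))" by (rule arg_cong[where f = S])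
    also have "\<dots> = S (\<lambda>A B C. - (U A B C * w A B C))" by (rule s2)
    also have "\<dots> = - S (\<lambda>A B C. U A B C * w A B C)" by (rule neg)
    finally show ?thesis .
  qed
  let ?T = "S (\<lambda>A B C. T A B C * w A B C)"
  note e3 = t1[of T] and e4 = t2[of T]
  have e1: "S (\<lambda>A B C. T B C A * w A B C) = ?T" using t1[of "\<lambda>A B C. T A C B"] unfolding e4 by (simp only: minus_minus)
  have e2: "S (\<lambda>A B C. T C A B * w A B C) = ?T" using t2[of "\<lambda>A B C. T B A C"] unfolding e3 by (simp only: minus_minus)
  have e5: "S (\<lambda>A B C. T C B A * w A B C) = - ?T" using t1[of "\<lambda>A B C. T C A B"] unfolding e2 .
  have "(\<Sum>A\<in>UNIV. \<Sum>B\<in>UNIV. \<Sum>C\<in>UNIV. alt3 T A B C * w A B C) =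
      (S (\<lambda>A B C. T A B C * w A B C) + S (\<lambda>A B C. T B C A * w A B C) + S (\<lambda>A B C. T C A B * w A B C)
      - S (\<lambda>A B C. T B A C * w A B C) - S (\<lambda>A B C. T A C B * w A B C) - S (\<lambda>A B C. T C B A * w A B C)) / 6"
    by (simp add: S_def alt3_def left_diff_distrib distrib_right sum.distrib sum_subtractf
        diff_divide_distrib add_divide_distrib sum_divide_distrib)
  also have "\<dots> = ?T" unfolding e1 e2 e3 e4 e5 by simp
  finally show ?thesis by (simp only: S_def)
qed

lemma alt3_swap: "alt3 T b a c = - alt3 T a b c" "alt3 T a c b = - alt3 T a b c"
  unfolding alt3_def minus_divide_left by (rule arg_cong[where f = "\<lambda>z. z / 6"], simp)+

lemma bgg_splitting_swap:
  "bgg_splitting G k x B A C = - bgg_splitting G k x A B C"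
  "bgg_splitting G k x A C B = - bgg_splitting G k x A B C"
  unfolding bgg_splitting_def wedge3_def alt3_swap(1)[of _ B A C] alt3_swap(2)[of _ A C B]
  by (simp_all add: sum_negf)

text \<open>The 3-tractor contains the factor X, so only components with an index \<open>TX\<close>
  matter. Among the lowered frame only \<open>lowY\<close> has a \<open>TX\<close> entry, so the
  \<open>bgg_m\<close> and \<open>bgg_r\<close> slots vanish there, and the factors 3 and 6 just
  undo the normalisation of the alternation.\<close>

lemma bgg_splitting_components:
  fixes G :: "real ^ 'n::finite \<Rightarrow> real ^ 'n ^ 'n"
  assumes G: "det (G x) \<noteq> 0" "\<And>a b. G x $ a $ b = G x $ b $ a" and k: "\<And>b c. k c b x = - k b c x"
  shows "bgg_splitting G k x TX (TZ b) (TZ c) = k b c x"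
    and "bgg_splitting G k x TX (TZ b) TY = bgg_n G k b x"
proof -
  note z = lowZ_nth[where G=G and x=x, OF G]
  have d: "(\<Sum>b'\<in>UNIV. \<Sum>c'\<in>UNIV. f b' c' * ((if b' = b then 1 else 0) * (if c' = c then 1 else 0))) = f b c" for f :: "'n \<Rightarrow> 'n \<Rightarrow> real" and b c
  proof -
    have "(\<Sum>b'\<in>UNIV. \<Sum>c'\<in>UNIV. f b' c' * ((if b' = b then 1 else 0) * (if c' = c then 1 else 0))) =
      (\<Sum>b'\<in>UNIV. (if b' = b then 1 else 0) * (\<Sum>c'\<in>UNIV. (if c' = c then 1 else 0) * f b' c'))"
      by (simp add: sum_distrib_left mult_ac)
    then show ?thesis by (simp only: sum_delta_left)
  qed
  have w1: "wedge3 (lowY G x) (lowZ G b' x) (lowZ G c' x) TX (TZ b) (TZ c) =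
      ((if b' = b then 1 else 0) * (if c' = c then 1 else 0) - (if b' = c then 1 else 0) * (if c' = b then 1 else 0)) / 6"
    and w2: "wedge3 (lowZ G a' x) (lowZ G b' x) (lowZ G c' x) TX (TZ b) (TZ c) = 0"
    and w3: "wedge3 (lowX G x) (lowY G x) (lowZ G c' x) TX (TZ b) (TZ c) = 0"
    and w4: "wedge3 (lowX G x) (lowZ G b' x) (lowZ G c' x) TX (TZ b) (TZ c) = 0" for a' b' c'
    by (simp_all add: wedge3_def alt3_def z)
  have "(\<Sum>b'\<in>UNIV. \<Sum>c'\<in>UNIV. k b' c' x * wedge3 (lowY G x) (lowZ G b' x) (lowZ G c' x) TX (TZ b) (TZ c)) =
      ((\<Sum>b'\<in>UNIV. \<Sum>c'\<in>UNIV. k b' c' x * ((if b' = b then 1 else 0) * (if c' = c then 1 else 0)))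
       - (\<Sum>b'\<in>UNIV. \<Sum>c'\<in>UNIV. k b' c' x * ((if b' = c then 1 else 0) * (if c' = b then 1 else 0)))) / 6"
    unfolding w1 by (simp only: right_diff_distrib sum_subtractf sum_divide_distrib times_divide_eq_right diff_divide_distrib)
  also have "\<dots> = k b c x / 3" unfolding d using k[of c b] by simp
  finally show "bgg_splitting G k x TX (TZ b) (TZ c) = k b c x"
    unfolding bgg_splitting_def w2 w3 w4 by simp
  have v1: "wedge3 (lowY G x) (lowZ G b' x) (lowZ G c' x) TX (TZ b) TY = 0"
    and v2: "wedge3 (lowZ G a' x) (lowZ G b' x) (lowZ G c' x) TX (TZ b) TY = 0"
    and v3: "wedge3 (lowX G x) (lowY G x) (lowZ G c' x) TX (TZ b) TY = (if c' = b then 1 else 0) / 6"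
    and v4: "wedge3 (lowX G x) (lowZ G b' x) (lowZ G c' x) TX (TZ b) TY = 0" for a' b' c'
    by (simp_all add: wedge3_def alt3_def z)
  have "(\<Sum>c\<in>UNIV. bgg_n G k c x * ((if c = b then 1 else 0) / 6)) = bgg_n G k b x / 6"
    using sum_delta_left(2)[of b "\<lambda>c. bgg_n G k c x / 6"] by (simp add: mult.commute)
  then show "bgg_splitting G k x TX (TZ b) TY = bgg_n G k b x"
    unfolding bgg_splitting_def v1 v2 v3 v4 by simp
qed

lemma speed_eq:
  assumes "causal_sign G T y t \<noteq> 0"
  shows "speed G T y t > 0"
    and "velocity T y t \<bullet> (cmetric G (y t) *v velocity T y t) = causal_sign G T y t * (speed G T y t)\<^sup>2"
    and "speed G T y t = sqrt \<bar>velocity T y t \<bullet> (cmetric G (y t) *v velocity T y t)\<bar>"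
proof -
  define q where "q = velocity T y t \<bullet> (cmetric G (y t) *v velocity T y t)"
  have s: "causal_sign G T y t = sgn q" by (simp add: causal_sign_def q_def)
  then have q: "q \<noteq> 0" using assms by auto
  have sp: "speed G T y t = sqrt \<bar>q\<bar>" by (simp add: speed_def s q_def[symmetric] abs_sgn mult.commute)
  then show "speed G T y t > 0" using q by simp
  show "velocity T y t \<bullet> (cmetric G (y t) *v velocity T y t) = causal_sign G T y t * (speed G T y t)\<^sup>2"
    unfolding s sp q_def[symmetric] by (simp add: sgn_mult_abs)
  show "speed G T y t = sqrt \<bar>velocity T y t \<bullet> (cmetric G (y t) *v velocity T y t)\<bar>"
    using sp by (simp add: q_def)
qed

section \<open>Velocity, acceleration and the 3-tractor in components\<close>

context
  fixes G :: "real ^ 'n::finite \<Rightarrow> real ^ 'n ^ 'n" and T :: "real set" and y :: "real \<Rightarrow> real ^ 'n"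
  assumes nt: "\<And>s. s \<in> T \<Longrightarrow> at s within T \<noteq> bot"
begin

lemma vector_derivative_const_on:
  assumes "s \<in> T" "\<And>r. r \<in> T \<Longrightarrow> f r = c"
  shows "vector_derivative f (at s within T) = 0"
proof (rule vector_derivative_within[OF nt[OF assms(1)]])
  show "(f has_vector_derivative 0) (at s within T)"
    by (rule has_vector_derivative_transform[OF assms(1) _ has_vector_derivative_const[of c]]) (use assms in auto)
qed

lemma velocity_tractor_nth:
  assumes "s \<in> T"
  shows "velocity_tractor G T y s $ TY = 0" "velocity_tractor G T y s $ TZ a = wvelocity G T y s $ a"
proof -
  have tX: "((1 / speed G T y t) *\<^sub>R trX) $ TY = 0" "((1 / speed G T y t) *\<^sub>R trX) $ TZ a = 0"
    "((1 / speed G T y t) *\<^sub>R trX) $ TX = 1 / speed G T y t" for t and a :: 'n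
    by (simp_all add: trX_nth)
  have z: "vector_derivative (\<lambda>t. 0) (at s within T) = (0::real)" "vector_derivative (\<lambda>t. \<chi> a. 0) (at s within T) = (0::real ^ 'n)"
    using vector_derivative_const_on[OF assms, of "\<lambda>t. 0::real" 0] vector_derivative_const_on[OF assms, of "\<lambda>t. (\<chi> a. 0)::real ^ 'n"] by auto
  have m0: "cmetric G (y s) *v (\<chi> a. 0) = 0" by (simp add: vec_eq_iff matrix_vector_mult_def)
  show "velocity_tractor G T y s $ TY = 0" "velocity_tractor G T y s $ TZ a = wvelocity G T y s $ a"
    unfolding velocity_tractor_def ddt_tractor_def Let_def tX mk_tractor_nth
    by (simp_all add: ddt_density_def ddt_vector_def z m0 wvelocity_def)
qed

text \<open>The velocity tractor has no \<open>TY\<close> slot, so the Schouten term is absent from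
  the middle slot. Its \<open>TX\<close> slot enters there only as a multiple \<open>r\<close> of
  the velocity, which later disappears by skewness and so is left unevaluated.\<close>

lemma acceleration_tractor_nth:
  assumes t: "t \<in> T" and c: "causal_sign G T y t \<noteq> 0"
  shows "acceleration_tractor G T y t $ TY = - causal_sign G T y t * speed G T y t"
    "\<exists>r. \<forall>a. acceleration_tractor G T y t $ TZ a = speed G T y t * wacceleration G T y t $ a + r * wvelocity G T y t $ a"
proof -
  note sp = speed_eq[OF c]
  have m: "(\<chi> a. velocity_tractor G T y s $ TZ a) = wvelocity G T y s" if "s \<in> T" for s
    by (simp add: vec_eq_iff velocity_tractor_nth[OF that])
  have d0: "vector_derivative (\<lambda>t. velocity_tractor G T y t $ TY) (at t within T) = 0"
    by (rule vector_derivative_const_on[OF t]) (rule velocity_tractor_nth)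
  have "vector_derivative (\<lambda>t. \<chi> a. velocity_tractor G T y t $ TZ a) (at t within T) = vector_derivative (wvelocity G T y) (at t within T)"
    by (rule vector_derivative_cong_eq) (use m t in auto)
  then have dv: "ddt_vector G T y (- 1) (\<lambda>t. \<chi> a. velocity_tractor G T y t $ TZ a) t = ddt_vector G T y (- 1) (wvelocity G T y) t"
    by (simp add: ddt_vector_def m[OF t])
  have "velocity T y t \<bullet> (cmetric G (y t) *v wvelocity G T y t) = (velocity T y t \<bullet> (cmetric G (y t) *v velocity T y t)) / speed G T y t"
    by (simp add: wvelocity_def matrix_vector_mult_scaleR)
  also have "\<dots> = causal_sign G T y t * speed G T y t"
    unfolding sp(2) using sp(1) by (simp add: power2_eq_square)
  finally show "acceleration_tractor G T y t $ TY = - causal_sign G T y t * speed G T y t"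
    by (simp add: acceleration_tractor_def ddt_tractor_def Let_def ddt_density_def d0 velocity_tractor_nth[OF t] m[OF t])
  show "\<exists>r. \<forall>a. acceleration_tractor G T y t $ TZ a = speed G T y t * wacceleration G T y t $ a + r * wvelocity G T y t $ a"
    using sp(1) by (intro exI[of _ "velocity_tractor G T y t $ TX * speed G T y t"])
      (simp add: acceleration_tractor_def ddt_tractor_def Let_def dv velocity_tractor_nth[OF t] wacceleration_def wvelocity_def)
qed

lemma tractor_eq_tensor:
  fixes k :: "('p, 'n) tensor2" and ch :: "('p, 'n) chart"
  assumes t: "t \<in> T" and c: "causal_sign G T y t \<noteq> 0"
    and G: "det (G (y t)) \<noteq> 0" "\<And>a b. G (y t) $ a $ b = G (y t) $ b $ a"
    and K: "\<And>a b. K (y t) $ a $ b = - K (y t) $ b $ a"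
  shows "(\<Sum>A\<in>UNIV. \<Sum>B\<in>UNIV. \<Sum>C\<in>UNIV. three_tractor G T y t A B C * bgg_splitting G (comps K) (y t) A B C) =
    6 * (wvelocity G T y t \<bullet> (K (y t) *v wacceleration G T y t)
      - causal_sign G T y t / (real CARD('n) - 1) * (\<Sum>b\<in>UNIV. wvelocity G T y t $ b * div2 G (comps K) b (y t)))"
proof -
  let ?s = "speed G T y t" and ?e = "causal_sign G T y t" and ?u = "wvelocity G T y t" and ?a = "wacceleration G T y t"
  let ?U = "velocity_tractor G T y t" and ?A = "acceleration_tractor G T y t"
  let ?K = "bgg_splitting G (comps K) (y t)"
  have s: "?s > 0" by (rule speed_eq(1)[OF c])
  obtain r where r: "\<And>a. ?A $ TZ a = ?s * ?a $ a + r * ?u $ a"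
    using acceleration_tractor_nth(2)[OF t c] by blast
  have k: "comps K c b (y t) = - comps K b c (y t)" for b c using K[of c b] by (simp add: comps_def)
  note comp = bgg_splitting_components[where G=G and x="y t" and k="comps K", OF G k]
  have X1: "?K TX TX C = 0" for C
    using bgg_splitting_swap(1)[of G "comps K" "y t" TX TX C] by simp
  have X2: "?K TX C TX = 0" for C
    using bgg_splitting_swap(2)[of G "comps K" "y t" TX C TX] X1 by simp
  have "(\<Sum>A\<in>UNIV. \<Sum>B\<in>UNIV. \<Sum>C\<in>UNIV. three_tractor G T y t A B C * ?K A B C) =
      6 / ?s * (\<Sum>A\<in>UNIV. \<Sum>B\<in>UNIV. \<Sum>C\<in>UNIV. wedge3 trX ?U ?A A B C * ?K A B C)"
    by (simp add: three_tractor_def sum_distrib_left mult.assoc)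
  also have "(\<Sum>A\<in>UNIV. \<Sum>B\<in>UNIV. \<Sum>C\<in>UNIV. wedge3 trX ?U ?A A B C * ?K A B C) =
      (\<Sum>A\<in>UNIV. \<Sum>B\<in>UNIV. \<Sum>C\<in>UNIV. trX $ A * ?U $ B * ?A $ C * ?K A B C)"
    unfolding wedge3_def by (rule alt3_contract) (rule bgg_splitting_swap)+
  also have "\<dots> = (\<Sum>B\<in>UNIV. \<Sum>C\<in>UNIV. ?U $ B * ?A $ C * ?K TX B C)"
    by (subst sum_tindex) (simp add: trX_nth)
  also have "\<dots> = (\<Sum>b\<in>UNIV. ?u $ b * (- ?e * ?s) * bgg_n G (comps K) b (y t))
      + (\<Sum>b\<in>UNIV. \<Sum>c\<in>UNIV. ?u $ b * (?s * ?a $ c + r * ?u $ c) * K (y t) $ b $ c)"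
    by (simp add: sum_tindex X1 X2 velocity_tractor_nth[OF t] acceleration_tractor_nth(1)[OF t c] r comp sum.distrib comps_def sum_subtractf sum_negf)
  also have "(\<Sum>b\<in>UNIV. \<Sum>c\<in>UNIV. ?u $ b * (?s * ?a $ c + r * ?u $ c) * K (y t) $ b $ c) =
      ?s * (\<Sum>b\<in>UNIV. \<Sum>c\<in>UNIV. ?u $ b * ?a $ c * K (y t) $ b $ c) + r * (\<Sum>b\<in>UNIV. \<Sum>c\<in>UNIV. (?u $ b * ?u $ c) * K (y t) $ b $ c)"
    by (simp add: sum_distrib_left distrib_left distrib_right sum.distrib mult_ac)
  also have "(\<Sum>b\<in>UNIV. \<Sum>c\<in>UNIV. (?u $ b * ?u $ c) * K (y t) $ b $ c) = 0"
    by (rule sum_sym_antisym) (rule mult.commute, rule K)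
  also have "(\<Sum>b\<in>UNIV. \<Sum>c\<in>UNIV. ?u $ b * ?a $ c * K (y t) $ b $ c) = ?u \<bullet> (K (y t) *v ?a)"
    by (simp add: inner_vec_def matrix_vector_mult_def sum_distrib_left mult_ac)
  also have "(\<Sum>b\<in>UNIV. ?u $ b * (- ?e * ?s) * bgg_n G (comps K) b (y t)) =
      - ?s * (?e / (real CARD('n) - 1) * (\<Sum>b\<in>UNIV. ?u $ b * div2 G (comps K) b (y t)))"
    by (simp add: bgg_n_def sum_distrib_left sum_negf mult_ac)
  also have "6 / ?s * (- ?s * (?e / (real CARD('n) - 1) * (\<Sum>b\<in>UNIV. ?u $ b * div2 G (comps K) b (y t)))
      + (?s * (?u \<bullet> (K (y t) *v ?a)) + r * 0)) = 6 * (?u \<bullet> (K (y t) *v ?a)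
      - ?e / (real CARD('n) - 1) * (\<Sum>b\<in>UNIV. ?u $ b * div2 G (comps K) b (y t)))"
    using s by (simp add: right_diff_distrib distrib_left)
  finally show ?thesis .
qed

text \<open>The single component of the wedge product with indices \<open>TY\<close>,
  \<open>TX\<close> and two \<open>TZ\<close> is enough: it states that the velocity is proportional
  to \<sigma> times the acceleration plus or minus the gradient of \<sigma>.\<close>

lemma generalised_geodesic_equation:
  assumes t: "t \<in> T" and c: "causal_sign G T y t \<noteq> 0"
    and I: "\<And>E B C D. alt4 (\<lambda>E B C D. I $ E * three_tractor G T y t B C D) E B C D = 0"
  defines "X \<equiv> \<lambda>b. I $ TY * wacceleration G T y t $ b + causal_sign G T y t * I $ TZ b"
  shows "wvelocity G T y t $ b * X c' = wvelocity G T y t $ c' * X b"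
proof -
  let ?s = "speed G T y t" and ?e = "causal_sign G T y t" and ?u = "wvelocity G T y t" and ?a = "wacceleration G T y t"
  let ?S = "three_tractor G T y t"
  have s: "?s > 0" by (rule speed_eq(1)[OF c])
  obtain r where r: "\<And>a. acceleration_tractor G T y t $ TZ a = ?s * ?a $ a + r * ?u $ a"
    using acceleration_tractor_nth(2)[OF t c] by blast
  have S_alt: "?S = (\<lambda>A B C. alt3 (\<lambda>A B C. 6 / ?s * (trX $ A * velocity_tractor G T y t $ B * acceleration_tractor G T y t $ C)) A B C)"
    by (intro ext) (simp add: three_tractor_def wedge3_def alt3_def right_diff_distrib distrib_left)
  have swap: "?S B A C = - ?S A B C" "?S A C B = - ?S A B C" for A B C
    unfolding S_alt by (rule alt3_swap)+
  have alt: "alt3 (\<lambda>B C D. i * ?S B C D) B C D = i * ?S B C D" for i B C D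
  proof -
    have 1: "?S C B D = - ?S B C D" "?S B D C = - ?S B C D" by (rule swap)+
    have 2: "?S C D B = ?S B C D" using swap(2)[of C D B] 1(1) by linarith
    have 3: "?S D B C = ?S B C D" using swap(1)[of D B C] 1(2) by linarith
    have 4: "?S D C B = - ?S B C D" using swap(1)[of D C B] 2 by linarith
    show ?thesis unfolding alt3_def 1 2 3 4 by simp
  qed
  have S1: "?S TX (TZ b) (TZ c') = ?u $ b * ?a $ c' - ?u $ c' * ?a $ b" for b c'
  proof -
    have "?S TX (TZ b) (TZ c') = 6 / ?s * ((?u $ b * (?s * ?a $ c' + r * ?u $ c') - ?u $ c' * (?s * ?a $ b + r * ?u $ b)) / 6)"
      by (simp add: three_tractor_def wedge3_def alt3_def trX_nth velocity_tractor_nth[OF t] r)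
    also have "?u $ b * (?s * ?a $ c' + r * ?u $ c') - ?u $ c' * (?s * ?a $ b + r * ?u $ b) =
        ?s * (?u $ b * ?a $ c' - ?u $ c' * ?a $ b)"
      by (simp add: algebra_simps)
    finally show ?thesis using s by simp
  qed
  have S2: "?S TY (TZ b) (TZ c') = 0" for b c'
    by (simp add: three_tractor_def wedge3_def alt3_def trX_nth)
  have S3: "?S TY TX (TZ b) = - ?e * ?u $ b" for b
    using s by (simp add: three_tractor_def wedge3_def alt3_def trX_nth velocity_tractor_nth[OF t] acceleration_tractor_nth(1)[OF t c])
  have "I $ TY * ?S TX (TZ b) (TZ c') - I $ TX * ?S TY (TZ b) (TZ c') + I $ TZ b * ?S TY TX (TZ c') - I $ TZ c' * ?S TY TX (TZ b) = 0"
    using I[of TY TX "TZ b" "TZ c'"] by (simp add: alt4_def alt)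
  then show ?thesis
    by (simp add: S1 S2 S3 X_def algebra_simps)
qed

end

section \<open>Kinematics of curves\<close>

lemma interval_not_trivial:
  fixes T :: "real set"
  assumes "is_interval T" "interior T \<noteq> {}" "s \<in> T"
  shows "at s within T \<noteq> bot"
proof -
  have "T \<noteq> {x}" for x using assms(2) by (metis interior_singleton)
  moreover have "connected T" using assms(1) by (simp add: is_interval_connected)
  ultimately have "s islimpt T" using connected_imp_perfect assms(3) by blast
  then show ?thesis using trivial_limit_within by blast
qed

lemma at_within_openin:
  assumes "openin (top_of_set T) U" "s \<in> U"
  shows "at s within U = at s within T"
proof -
  obtain V where V: "open V" "U = T \<inter> V" using assms(1) openin_open by blast
  show ?thesis by (rule at_within_nhd[of s V]) (use V assms(2) in auto)
qed

text \<open>Locally the curve is the restriction of a smooth map on an open interval of time; its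
  one-sided derivatives are those of the extension, hence continuous up to the end points of
  \<open>T\<close>.\<close>

lemma smooth_curve:
  fixes y :: "real \<Rightarrow> real ^ 'n::finite"
  assumes nt: "\<And>s. s \<in> T \<Longrightarrow> at s within T \<noteq> bot" and S: "openin (top_of_set T) S" and y: "smooth_on S y"
  shows curve_velocity: "t \<in> S \<Longrightarrow> (y has_vector_derivative velocity T y t) (at t within T)"
    and curve_acceleration: "t \<in> S \<Longrightarrow> (velocity T y has_vector_derivative vector_derivative (velocity T y) (at t within T)) (at t within T)"
    and continuous_on_velocity: "continuous_on S (velocity T y)"
    and continuous_on_acceleration: "continuous_on S (\<lambda>t. vector_derivative (velocity T y) (at t within T))"
proof -
  have ST: "S \<subseteq> T" using openin_imp_subset[OF S] .
  have key: "(y has_vector_derivative velocity T y t) (at t within T) \<and>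
    (velocity T y has_vector_derivative vector_derivative (velocity T y) (at t within T)) (at t within T) \<and>
    continuous (at t within S) (\<lambda>t. vector_derivative (velocity T y) (at t within T))" if t: "t \<in> S" for t
  proof -
    have "\<exists>W F. open W \<and> t \<in> W \<and> (\<forall>k. ck_on k W F) \<and> (\<forall>s\<in>S \<inter> W. F s = y s)"
      using y t by (simp add: smooth_on_def)
    then obtain W F where F: "open W" "t \<in> W" "\<And>k. ck_on k W F" "\<And>s. s \<in> S \<inter> W \<Longrightarrow> F s = y s"
      by (elim exE) blast
    have U: "openin (top_of_set T) (S \<inter> W)" using S F(1) by (simp add: openin_Int_open)
    define F1 where "F1 s = frechet_derivative F (at s) 1" for s
    define F2 where "F2 s = frechet_derivative F1 (at s) 1" for s
    have d: "\<And>s. s \<in> W \<Longrightarrow> F differentiable (at s)" "\<And>s. s \<in> W \<Longrightarrow> F1 differentiable (at s)"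
      "continuous_on W F2"
      using F(3)[of "Suc (Suc 0)"] by (auto simp: F1_def[abs_def] F2_def[abs_def])
    have vd: "(f has_vector_derivative frechet_derivative f (at s) 1) (at s within T)"
      if "f differentiable (at s)" for f :: "real \<Rightarrow> real ^ 'n" and s
      using has_derivative_line[of f 0 s 1] that by (simp add: has_vector_derivative_at_within)
    have y1: "(y has_vector_derivative F1 s) (at s within T)" if s: "s \<in> S \<inter> W" for s
    proof -
      have "(F has_vector_derivative F1 s) (at s within (S \<inter> W))"
        unfolding at_within_openin[OF U s] F1_def using vd d(1) s by blast
      then have "(y has_vector_derivative F1 s) (at s within (S \<inter> W))"
        by (rule has_vector_derivative_transform[OF s, rotated]) (simp add: F(4))
      then show ?thesis unfolding at_within_openin[OF U s] .
    qed
    have v: "velocity T y s = F1 s" if s: "s \<in> S \<inter> W" for s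
      unfolding velocity_def by (rule vector_derivative_within[OF nt y1[OF s]]) (use s ST in auto)
    have v1: "(velocity T y has_vector_derivative F2 s) (at s within T)" if s: "s \<in> S \<inter> W" for s
    proof -
      have "(F1 has_vector_derivative F2 s) (at s within (S \<inter> W))"
        unfolding at_within_openin[OF U s] F2_def using vd d(2) s by blast
      then have "(velocity T y has_vector_derivative F2 s) (at s within (S \<inter> W))"
        by (rule has_vector_derivative_transform[OF s, rotated]) (simp add: v)
      then show ?thesis unfolding at_within_openin[OF U s] .
    qed
    have a: "vector_derivative (velocity T y) (at s within T) = F2 s" if s: "s \<in> S \<inter> W" for s
      by (rule vector_derivative_within[OF nt v1[OF s]]) (use s ST in auto)
    have tW: "t \<in> S \<inter> W" using t F(2) by simp
    have "continuous (at t within (S \<inter> W)) F2"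
      using d(3) F(1,2) continuous_at_imp_continuous_at_within continuous_on_eq_continuous_at by blast
    then have "continuous (at t within (S \<inter> W)) (\<lambda>t. vector_derivative (velocity T y) (at t within T))"
      by (rule continuous_transform_within[OF _ zero_less_one tW]) (simp add: a)
    moreover have "at t within (S \<inter> W) = at t within S"
      using at_within_openin[OF U tW] at_within_openin[OF S t] by simp
    ultimately show ?thesis using y1[OF tW] v1[OF tW] v[OF tW] a[OF tW] by simp
  qed
  show "(y has_vector_derivative velocity T y t) (at t within T)"
    "(velocity T y has_vector_derivative vector_derivative (velocity T y) (at t within T)) (at t within T)" if "t \<in> S"
    using key[OF that] by auto
  show "continuous_on S (\<lambda>t. vector_derivative (velocity T y) (at t within T))"
    using key by (auto simp: continuous_on_eq_continuous_within)
  show "continuous_on S (velocity T y)"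
    unfolding continuous_on_eq_continuous_within
  proof
    fix t assume t: "t \<in> S"
    have "continuous (at t within T) (velocity T y)"
      using key[OF t] has_vector_derivative_continuous by blast
    then show "continuous (at t within S) (velocity T y)" using continuous_within_subset ST by blast
  qed
qed

text \<open>A first-order statement that also covers boundary points, where
  \<open>local_metric\<close> does not apply.\<close>

lemma differentiable_cmetric:
  fixes G :: "real ^ 'n::finite \<Rightarrow> real ^ 'n ^ 'n"
  assumes G: "\<And>i j. (\<lambda>x. G x $ i $ j) differentiable (at x within halfspace)" and x: "x \<in> halfspace" and nz: "det (G x) \<noteq> 0"
  shows "scale_density G differentiable (at x within halfspace)"
    and "(\<lambda>x. cmetric G x $ a $ b) differentiable (at x within halfspace)"
proof -
  have "(\<lambda>x. det (G x)) differentiable (at x within halfspace)" by (rule differentiable_det[OF G])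
  from pd_compose(2)[OF x this DERIV_abs_powr[OF nz]]
  show l: "scale_density G differentiable (at x within halfspace)" by (simp add: scale_density_def[abs_def])
  show "(\<lambda>x. cmetric G x $ a $ b) differentiable (at x within halfspace)"
    unfolding cmetric_nth power2_eq_square by (intro differentiable_mult l G)
qed

text \<open>Differentiating the factor 1/speed and applying the density correction both produce only
  multiples of the velocity, gathered in \<beta>. Skew pairings and equations modulo the velocity do
  not see them.\<close>

lemma wacceleration_formula:
  fixes y :: "real \<Rightarrow> real ^ 'n::finite"
  assumes nt: "\<And>s. s \<in> T \<Longrightarrow> at s within T \<noteq> bot" and S: "openin (top_of_set T) S" and y: "smooth_on S y"
    and hs: "\<And>s. s \<in> S \<Longrightarrow> y s \<in> halfspace"
    and c: "\<And>s. s \<in> S \<Longrightarrow> causal_sign G T y s \<noteq> 0" and t: "t \<in> S"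
    and cm: "\<And>a b. (\<lambda>x. cmetric G x $ a $ b) differentiable (at (y t) within halfspace)"
  defines "w \<equiv> vector_derivative (velocity T y) (at t within T)"
  shows "\<exists>\<beta>. \<forall>b. (speed G T y t)\<^sup>2 * wacceleration G T y t $ b = w $ b +
    (\<Sum>a\<in>UNIV. \<Sum>d\<in>UNIV. christoffel G b a d (y t) * velocity T y t $ a * velocity T y t $ d) + \<beta> * velocity T y t $ b"
proof -
  let ?v = "velocity T y" and ?s = "speed G T y"
  have tT: "t \<in> T" using openin_imp_subset[OF S] t by auto
  have y1: "(y has_vector_derivative ?v t) (at t within S)"
    using curve_velocity[OF nt S y t] unfolding at_within_openin[OF S t] .
  have v1: "(?v has_vector_derivative w) (at t within S)"
    using curve_acceleration[OF nt S y t] unfolding w_def at_within_openin[OF S t] .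
  have vc: "((\<lambda>s. ?v s $ a) has_real_derivative w $ a) (at t within S)" for a
    using bounded_linear.has_vector_derivative[OF bounded_linear_vec_nth v1]
    by (simp add: has_real_derivative_iff_has_vector_derivative)
  define q where "q s = (\<Sum>a\<in>UNIV. \<Sum>b\<in>UNIV. ?v s $ a * (cmetric G (y s) $ a $ b * ?v s $ b))" for s
  have q: "?v s \<bullet> (cmetric G (y s) *v ?v s) = q s" for s
    unfolding q_def inner_vec_def matrix_vector_mult_def by (simp add: sum_distrib_left)
  have "y ` S \<subseteq> halfspace" using hs by auto
  note ch = has_real_derivative_chain[where y=y and t=t and S=S and v="?v t", OF y1 this cm]
  have "\<exists>q'. (q has_real_derivative q') (at t within S)"
    unfolding q_def[abs_def]
    by (rule exI, rule DERIV_sum, rule DERIV_sum, rule DERIV_mult[OF vc DERIV_mult[OF ch vc]])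
  then obtain q' where q': "(q has_real_derivative q') (at t within S)" by blast
  have qn: "q s \<noteq> 0" if "s \<in> S" for s
    using c[OF that] by (auto simp: causal_sign_def q)
  have sp: "?s s = sqrt \<bar>q s\<bar>" if "s \<in> S" for s using speed_eq(3)[OF c[OF that]] by (simp only: q)
  \<comment> \<open>As a real power of an absolute value, the factor can be differentiated whatever
    the sign of \<open>q\<close>.\<close>
  have sp_powr: "1 / ?s s = \<bar>q s\<bar> powr (- 1 / 2)" if "s \<in> S" for s
    unfolding sp[OF that] minus_divide_left[symmetric] powr_minus powr_half_sqrt[OF abs_ge_zero]
    by (rule divide_inverse[of 1, unfolded mult_1_left])
  have "\<exists>r'. ((\<lambda>s. \<bar>q s\<bar> powr (- 1 / 2)) has_real_derivative r') (at t within S)"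
    using DERIV_chain2[OF DERIV_abs_powr[OF qn[OF t]] q'] by blast
  then obtain r' where "((\<lambda>s. \<bar>q s\<bar> powr (- 1 / 2)) has_real_derivative r') (at t within S)" by blast
  from has_vector_derivative_scaleR[OF this v1]
  have "((\<lambda>s. \<bar>q s\<bar> powr (- 1 / 2) *\<^sub>R ?v s) has_vector_derivative (1 / ?s t) *\<^sub>R w + r' *\<^sub>R ?v t) (at t within S)"
    by (simp only: sp_powr[OF t])
  then have "(wvelocity G T y has_vector_derivative (1 / ?s t) *\<^sub>R w + r' *\<^sub>R ?v t) (at t within S)"
    by (rule has_vector_derivative_transform[OF t, rotated]) (simp only: wvelocity_def sp_powr)
  then have "(wvelocity G T y has_vector_derivative (1 / ?s t) *\<^sub>R w + r' *\<^sub>R ?v t) (at t within T)"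
    unfolding at_within_openin[OF S t] .
  then have dw: "vector_derivative (wvelocity G T y) (at t within T) = (1 / ?s t) *\<^sub>R w + r' *\<^sub>R ?v t"
    by (rule vector_derivative_within[OF nt[OF tT]])
  define D where "D = (\<Sum>a\<in>UNIV. ?v t $ a * density_form G (- 1) a (y t))"
  have s0: "?s t > 0" by (rule speed_eq(1)[OF c[OF t]])
  have "?s t * wacceleration G T y t $ b = (1 / ?s t) * w $ b + r' * ?v t $ b + D * ((1 / ?s t) * ?v t $ b)
      + (\<Sum>a\<in>UNIV. \<Sum>d\<in>UNIV. christoffel G b a d (y t) * ?v t $ a * ((1 / ?s t) * ?v t $ d))" for b
    using s0 by (simp add: wacceleration_def ddt_vector_def dw D_def[symmetric] wvelocity_def)
  also have "(\<Sum>a\<in>UNIV. \<Sum>d\<in>UNIV. christoffel G b a d (y t) * ?v t $ a * ((1 / ?s t) * ?v t $ d)) =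
      (1 / ?s t) * (\<Sum>a\<in>UNIV. \<Sum>d\<in>UNIV. christoffel G b a d (y t) * ?v t $ a * ?v t $ d)" for b
    unfolding sum_distrib_left by (simp only: mult_ac)
  finally have e: "?s t * wacceleration G T y t $ b = (1 / ?s t) * w $ b + r' * ?v t $ b + D * ((1 / ?s t) * ?v t $ b)
      + (1 / ?s t) * (\<Sum>a\<in>UNIV. \<Sum>d\<in>UNIV. christoffel G b a d (y t) * ?v t $ a * ?v t $ d)" for b .
  show ?thesis
  proof (intro exI[of _ "?s t * r' + D"] allI)
    fix b
    have "(?s t)\<^sup>2 * wacceleration G T y t $ b = ?s t * (?s t * wacceleration G T y t $ b)"
      by (simp only: power2_eq_square mult.assoc)
    also have "\<dots> = w $ b + (\<Sum>a\<in>UNIV. \<Sum>d\<in>UNIV. christoffel G b a d (y t) * ?v t $ a * ?v t $ d) + (?s t * r' + D) * ?v t $ b"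
      unfolding e using s0 by (simp add: distrib_left distrib_right)
    finally show "(?s t)\<^sup>2 * wacceleration G T y t $ b = w $ b +
      (\<Sum>a\<in>UNIV. \<Sum>d\<in>UNIV. christoffel G b a d (y t) * ?v t $ a * ?v t $ d) + (?s t * r' + D) * ?v t $ b" .
  qed
qed

text \<open>Only \<open>y'' + \<Gamma>(y', y')\<close> survives from the weighted acceleration, since \<open>k\<close> is skew.\<close>

lemma tensor_formula:
  fixes y :: "real \<Rightarrow> real ^ 'n::finite"
  assumes nt: "\<And>s. s \<in> T \<Longrightarrow> at s within T \<noteq> bot" and S: "openin (top_of_set T) S" and y: "smooth_on S y"
    and hs: "\<And>s. s \<in> S \<Longrightarrow> y s \<in> halfspace"
    and c: "\<And>s. s \<in> S \<Longrightarrow> causal_sign G T y s \<noteq> 0" and t: "t \<in> S"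
    and cm: "\<And>a b. (\<lambda>x. cmetric G x $ a $ b) differentiable (at (y t) within halfspace)"
    and K: "\<And>a b. K (y t) $ a $ b = - K (y t) $ b $ a"
  defines "w \<equiv> vector_derivative (velocity T y) (at t within T)"
  shows "wvelocity G T y t \<bullet> (K (y t) *v wacceleration G T y t) = inverse (speed G T y t) ^ 3 *
    (\<Sum>b\<in>UNIV. \<Sum>e\<in>UNIV. velocity T y t $ b * K (y t) $ b $ e * (w $ e +
      (\<Sum>a\<in>UNIV. \<Sum>d\<in>UNIV. christoffel G e a d (y t) * velocity T y t $ a * velocity T y t $ d)))"
proof -
  let ?v = "velocity T y t" and ?s = "speed G T y t" and ?a = "wacceleration G T y t"
  let ?w = "\<lambda>e. w $ e + (\<Sum>a\<in>UNIV. \<Sum>d\<in>UNIV. christoffel G e a d (y t) * ?v $ a * ?v $ d)"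
  obtain \<beta> where \<beta>: "\<And>b. ?s\<^sup>2 * ?a $ b = ?w b + \<beta> * ?v $ b"
    using wacceleration_formula[OF nt S y hs c t cm] unfolding w_def by blast
  have s: "?s > 0" by (rule speed_eq(1)[OF c[OF t]])
  have z: "(\<Sum>b\<in>UNIV. \<Sum>e\<in>UNIV. (?v $ b * ?v $ e) * K (y t) $ b $ e) = 0"
    by (rule sum_sym_antisym) (rule mult.commute, rule K)
  have "wvelocity G T y t \<bullet> (K (y t) *v ?a) = inverse ?s * (\<Sum>b\<in>UNIV. \<Sum>e\<in>UNIV. ?v $ b * K (y t) $ b $ e * ?a $ e)"
    by (simp add: wvelocity_def inner_vec_def matrix_vector_mult_def sum_distrib_left divide_inverse mult_ac)
  also have "(\<Sum>b\<in>UNIV. \<Sum>e\<in>UNIV. ?v $ b * K (y t) $ b $ e * ?a $ e) = (inverse ?s)\<^sup>2 * (\<Sum>b\<in>UNIV. \<Sum>e\<in>UNIV. ?v $ b * K (y t) $ b $ e * (?s\<^sup>2 * ?a $ e))"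
    unfolding sum_distrib_left by (intro sum.cong refl) (use s in \<open>simp add: power_inverse field_simps\<close>)
  also have "(\<Sum>b\<in>UNIV. \<Sum>e\<in>UNIV. ?v $ b * K (y t) $ b $ e * (?s\<^sup>2 * ?a $ e)) =
      (\<Sum>b\<in>UNIV. \<Sum>e\<in>UNIV. ?v $ b * K (y t) $ b $ e * ?w e) + \<beta> * (\<Sum>b\<in>UNIV. \<Sum>e\<in>UNIV. (?v $ b * ?v $ e) * K (y t) $ b $ e)"
    unfolding \<beta> distrib_left[of "_ * _" "?w _"] sum.distrib sum_distrib_left[of \<beta>] by (simp only: mult_ac)
  finally show ?thesis unfolding z by (simp add: power2_eq_square power3_eq_cube mult.assoc)
qed

section \<open>Continuity of the tensor quantity up to the boundary\<close>

context
  fixes R :: "(real ^ 'n::finite) set" and G :: "real ^ 'n \<Rightarrow> real ^ 'n ^ 'n"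
  assumes R: "openin (top_of_set halfspace) R" and G: "smooth_on R G" and nz: "\<And>x. x \<in> R \<Longrightarrow> det (G x) \<noteq> 0"
begin

lemma smooth_on_entry: "smooth_on R (K :: real ^ 'n \<Rightarrow> real ^ 'n ^ 'n) \<Longrightarrow> smooth_on R (\<lambda>x. K x $ i $ j)"
  by (intro smooth_on_nth)

lemma continuous_on_entry:
  assumes "smooth_on R (K :: real ^ 'n \<Rightarrow> real ^ 'n ^ 'n)"
  shows "continuous_on R (\<lambda>x. K x $ i $ j)"
  unfolding continuous_on_eq_continuous_within
proof
  fix x assume x: "x \<in> R"
  have "continuous (at x within halfspace) (\<lambda>x. K x $ i $ j)"
    by (rule differentiable_imp_continuous_within) (rule smooth_on_differentiable[OF smooth_on_entry[OF assms] R x])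
  then show "continuous (at x within R) (\<lambda>x. K x $ i $ j)"
    using continuous_within_subset openin_imp_subset[OF R] by blast
qed

lemma continuous_on_christoffel: "continuous_on R (christoffel G k i j)"
  unfolding christoffel_def[abs_def]
  by (intro continuous_intros continuous_on_matrix_inv continuous_on_entry[OF G] nz
      smooth_on_continuous_pd[OF smooth_on_entry[OF G] R]) auto

lemma continuous_on_cmetric: "continuous_on R (\<lambda>x. cmetric G x $ i $ j)"
  unfolding cmetric_nth scale_density_def
  by (intro continuous_intros continuous_on_det continuous_on_entry[OF G]) (simp add: nz)

lemma continuous_on_cinverse: "continuous_on R (\<lambda>x. cinverse G x $ i $ j)"
  unfolding cinverse_def
  by (intro continuous_on_matrix_inv continuous_on_cmetric)
    (use scale_density_pos[where G=G] nz in \<open>force simp: cmetric_def det_scaleR\<close>)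

lemma continuous_on_div2:
  assumes "smooth_on R K"
  shows "continuous_on R (div2 G (comps K) a)"
proof -
  have K: "smooth_on R (comps K b c)" for b c
    using smooth_on_entry[OF assms] by (simp add: comps_def[abs_def])
  have K': "continuous_on R (comps K b c)" for b c
    using continuous_on_entry[OF assms] by (simp add: comps_def[abs_def])
  have "continuous_on R (cd2 G 3 (comps K) q p a)" for q p
    unfolding cd2_def[abs_def] density_form_def
    by (intro continuous_intros continuous_on_christoffel K' smooth_on_continuous_pd[OF K R])
  then show ?thesis
    unfolding div2_def[abs_def] by (intro continuous_intros continuous_on_cinverse)
qed

text \<open>\<open>tensor_formula\<close> replaces the acceleration by an algebraic expression in
  the first two derivatives of the curve, the metric and its Christoffel symbols, each continuous up
  to the boundary and up to the end points. The causal sign is continuous as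
  \<open>q t / \<bar>q t\<bar>\<close>, because \<open>q\<close> never vanishes.\<close>

lemma continuous_on_tensor_quantity:
  fixes y :: "real \<Rightarrow> real ^ 'n"
  assumes nt: "\<And>s. s \<in> T \<Longrightarrow> at s within T \<noteq> bot" and S: "openin (top_of_set T) S" and y: "smooth_on S y"
    and yR: "y ` S \<subseteq> R" and c: "\<And>s. s \<in> S \<Longrightarrow> causal_sign G T y s \<noteq> 0"
    and K: "smooth_on R K" and K_anti: "\<And>x a b. x \<in> R \<Longrightarrow> K x $ a $ b = - K x $ b $ a"
  shows "continuous_on S (\<lambda>t. wvelocity G T y t \<bullet> (K (y t) *v wacceleration G T y t)
         - causal_sign G T y t / (real CARD('n) - 1)
           * (\<Sum>b\<in>UNIV. wvelocity G T y t $ b * div2 G (comps K) b (y t)))"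
proof -
  let ?v = "velocity T y" and ?w = "\<lambda>t. vector_derivative (velocity T y) (at t within T)"
  define q where "q t = (\<Sum>a\<in>UNIV. \<Sum>b\<in>UNIV. ?v t $ a * (cmetric G (y t) $ a $ b * ?v t $ b))" for t
  have q: "?v s \<bullet> (cmetric G (y s) *v ?v s) = q s" for s
    unfolding q_def inner_vec_def matrix_vector_mult_def by (simp add: sum_distrib_left)
  have Rh: "R \<subseteq> halfspace" using openin_imp_subset[OF R] .
  have cy: "continuous_on S y"
    unfolding continuous_on_eq_continuous_within
  proof
    fix s assume s: "s \<in> S"
    have "continuous (at s within T) y"
      using curve_velocity[OF nt S y s] has_vector_derivative_continuous by blast
    then show "continuous (at s within S) y" using continuous_within_subset openin_imp_subset[OF S] by blast
  qed
  have comp: "continuous_on S (\<lambda>t. f (y t))" if "continuous_on R f" for f :: "real ^ 'n \<Rightarrow> real"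
    by (rule continuous_on_compose2[OF that cy yR])
  note cv = continuous_on_velocity[OF nt S y] and cw = continuous_on_acceleration[OF nt S y]
  have cvn: "continuous_on S (\<lambda>t. ?v t $ a)" and cwn: "continuous_on S (\<lambda>t. ?w t $ a)" for a
    using cv cw by (auto intro: continuous_on_component)
  have cq: "continuous_on S q"
    unfolding q_def[abs_def] by (intro continuous_intros cvn comp continuous_on_cmetric)
  have qn: "q s \<noteq> 0" if "s \<in> S" for s using c[OF that] by (auto simp: causal_sign_def q)
  have ci: "continuous_on S (\<lambda>t. inverse (sqrt \<bar>q t\<bar>))"
    by (intro continuous_on_inverse continuous_on_real_sqrt continuous_on_rabs cq) (simp add: qn)
  have cs: "continuous_on S (\<lambda>t. q t / \<bar>q t\<bar>)"
    by (intro continuous_on_divide continuous_on_rabs cq) (simp add: qn)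
  have "continuous_on S (\<lambda>t. inverse (sqrt \<bar>q t\<bar>) ^ 3 *
    (\<Sum>b\<in>UNIV. \<Sum>e\<in>UNIV. ?v t $ b * K (y t) $ b $ e * (?w t $ e +
      (\<Sum>a\<in>UNIV. \<Sum>d\<in>UNIV. christoffel G e a d (y t) * ?v t $ a * ?v t $ d)))
    - (q t / \<bar>q t\<bar>) * inverse (real CARD('n) - 1) * (\<Sum>b\<in>UNIV. inverse (sqrt \<bar>q t\<bar>) * ?v t $ b * div2 G (comps K) b (y t)))"
    (is "continuous_on S ?f")
    by (intro continuous_on_diff continuous_on_mult continuous_on_sum continuous_on_add continuous_on_power
        continuous_on_const ci cs cvn cwn comp[OF continuous_on_christoffel] comp[OF continuous_on_div2[OF K]]
        comp[OF continuous_on_entry[OF K]])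
  then show ?thesis
  proof (rule continuous_on_eq)
    fix t assume t: "t \<in> S"
    have yt: "y t \<in> R" using yR t by auto
    have hs: "\<And>s. s \<in> S \<Longrightarrow> y s \<in> halfspace" using yR Rh by auto
    have cm: "(\<lambda>x. cmetric G x $ a $ b) differentiable (at (y t) within halfspace)" for a b
      by (rule differentiable_cmetric(2)[where G=G, OF smooth_on_differentiable[OF smooth_on_entry[OF G] R yt] hs[OF t] nz[OF yt]])
    have "causal_sign G T y t = q t / \<bar>q t\<bar>" using qn[OF t] by (simp add: causal_sign_def q sgn_if)
    moreover have "speed G T y t = sqrt \<bar>q t\<bar>" using speed_eq(3)[OF c[OF t]] by (simp only: q)
    ultimately show "?f t = wvelocity G T y t \<bullet> (K (y t) *v wacceleration G T y t)
         - causal_sign G T y t / (real CARD('n) - 1) * (\<Sum>b\<in>UNIV. wvelocity G T y t $ b * div2 G (comps K) b (y t))"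
      using tensor_formula[where G=G and K=K and T=T and S=S and y=y and t=t, OF nt S y hs c t cm K_anti[OF yt]] by (simp add: wvelocity_def divide_inverse)
  qed
qed

end

section \<open>Generalised geodesics\<close>

lemma proportional_if_wedge_zero:
  fixes v :: "real ^ 'n::finite"
  assumes "v \<noteq> 0" "\<And>b c. v $ b * X c = v $ c * X b"
  shows "\<exists>\<mu>. \<forall>b. X b = \<mu> * v $ b"
proof -
  obtain c where c: "v $ c \<noteq> 0" using assms(1) by (auto simp: vec_eq_iff)
  have "X b = X c / v $ c * v $ b" for b using assms(2)[of c b] c by (simp add: field_simps)
  then show ?thesis by blast
qed

text \<open>Here \<open>G0\<close> is \<open>\<sigma>\<^sup>-\<^sup>2\<close> times the conformal metric: passing to its scale absorbs the acceleration term of the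
  first integral in the divergence term.\<close>

lemma generalised_geodesic_in_sigma_scale:
  fixes y :: "real \<Rightarrow> real ^ 'n::finite" and K :: "real ^ 'n \<Rightarrow> real ^ 'n ^ 'n"
  assumes nt: "\<And>s. s \<in> T \<Longrightarrow> at s within T \<noteq> bot" and S: "openin (top_of_set T) S" and y: "smooth_on S y"
    and hs: "\<And>s. s \<in> S \<Longrightarrow> y s \<in> halfspace"
    and c: "\<And>s. s \<in> S \<Longrightarrow> causal_sign G T y s \<noteq> 0" and t: "t \<in> S" and card: "CARD('n) \<ge> 3"
    and G: "local_metric W G" and G0: "local_metric W G0" and x: "y t \<in> W"
    and q: "q differentiable (at (y t) within halfspace)" "q (y t) > 0"
    and G0q: "\<And>z. z \<in> W \<Longrightarrow> G0 z = q z *\<^sub>R G z"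
    and \<sigma>: "\<sigma> differentiable (at (y t) within halfspace)" "\<sigma> (y t) \<noteq> 0"
    and \<sigma>q: "\<And>z. z \<in> W \<Longrightarrow> (\<sigma> z)\<^sup>2 * q z = (scale_density G z)\<^sup>2"
    and K: "\<And>a b. K (y t) $ a $ b = - K (y t) $ b $ a"
    and cky: "cky_form G (comps K) (y t) N"
    and geod: "\<And>E B C D. alt4 (\<lambda>E B C D. scale_tractor G \<sigma> (y t) $ E * three_tractor G T y t B C D) E B C D = 0"
  defines "v \<equiv> velocity T y t" and "w \<equiv> vector_derivative (velocity T y) (at t within T)"
  shows "wvelocity G T y t \<bullet> (K (y t) *v wacceleration G T y t)
       - causal_sign G T y t / (real CARD('n) - 1) * (\<Sum>b\<in>UNIV. wvelocity G T y t $ b * div2 G (comps K) b (y t)) =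
      - 1 / (real CARD('n) - 1) * (sgn (v \<bullet> (G0 (y t) *v v)) *
        ((\<Sum>a\<in>UNIV. v $ a * (div2 G0 (comps K) a (y t) / scale_density G0 (y t))) / sqrt \<bar>v \<bullet> (G0 (y t) *v v)\<bar>))" (is ?formula)
    and "\<exists>\<alpha>. \<forall>e. w $ e + (\<Sum>a\<in>UNIV. \<Sum>b\<in>UNIV. christoffel G0 e a b (y t) * v $ a * v $ b) = \<alpha> * v $ e" (is ?geodesic)
proof -
  interpret G: local_metric W G by fact
  interpret G0: local_metric W G0 by fact
  let ?x = "y t" and ?s = "speed G T y t" and ?e = "causal_sign G T y t" and ?u = "wvelocity G T y t" and ?a = "wacceleration G T y t"
  let ?n = "real CARD('n) - 1"
  have tT: "t \<in> T" using openin_imp_subset[OF S] t by auto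
  note h = hs[OF t]
  have s: "?s > 0" and vv: "v \<bullet> (cmetric G ?x *v v) = ?e * ?s\<^sup>2"
    using speed_eq(1,2)[OF c[OF t]] by (simp_all add: v_def)
  have v0: "v \<noteq> 0" using vv s c[OF t] by auto
  define \<Upsilon> where "\<Upsilon> a = pd a q ?x / (2 * q ?x)" for a
  define U where "U b = (\<Sum>a\<in>UNIV. cinverse G ?x $ b $ a * \<Upsilon> a)" for b
  have dG: "(\<lambda>x. G x $ i $ j) differentiable (at ?x within halfspace)" for i j using twice_diffD(1)[OF G.G x] .
  note dcm = differentiable_cmetric[where G=G and x="?x", OF dG h G.nz[OF x]]
  \<comment> \<open>Differentiating \<sigma>^2 q = \<sigma>_g^2, whose right side is parallel, gives
    the gradient of \<sigma> as -\<sigma> times \<Upsilon>.\<close>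
  have cd: "cd0 G 1 \<sigma> a ?x = - \<sigma> ?x * \<Upsilon> a" for a
  proof -
    have "pd a (\<lambda>z. \<sigma> z * \<sigma> z * q z) ?x = pd a (\<lambda>z. scale_density G z * scale_density G z) ?x"
      by (rule G.cong(1)[OF x]) (use \<sigma>q in \<open>simp add: power2_eq_square\<close>)
    moreover have "pd a (\<lambda>z. \<sigma> z * \<sigma> z * q z) ?x = \<sigma> ?x * \<sigma> ?x * pd a q ?x + (\<sigma> ?x * pd a \<sigma> ?x + pd a \<sigma> ?x * \<sigma> ?x) * q ?x"
      by (simp add: pd_mult[OF h] \<sigma>(1) q(1) differentiable_mult)
    moreover have "pd a (\<lambda>z. scale_density G z * scale_density G z) ?x =
        - 2 * density_form G 1 a ?x * ((\<sigma> ?x)\<^sup>2 * q ?x)"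
      unfolding pd_mult[OF h dcm(1) dcm(1)] G.pd_scale_density[OF x] \<sigma>q[OF x] by (simp add: power2_eq_square)
    ultimately have "\<sigma> ?x * (\<sigma> ?x * pd a q ?x + 2 * q ?x * pd a \<sigma> ?x + 2 * q ?x * (density_form G 1 a ?x * \<sigma> ?x)) = 0"
      by (simp add: power2_eq_square algebra_simps)
    then have "\<sigma> ?x * pd a q ?x + 2 * q ?x * pd a \<sigma> ?x + 2 * q ?x * (density_form G 1 a ?x * \<sigma> ?x) = 0"
      using mult_eq_0_iff \<sigma>(2) by blast
    then have "\<sigma> ?x * pd a q ?x + 2 * q ?x * (pd a \<sigma> ?x + density_form G 1 a ?x * \<sigma> ?x) = 0"
      by (simp add: algebra_simps)
    then show ?thesis using q(2) by (simp add: cd0_def \<Upsilon>_def field_simps)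
  qed
  have I: "scale_tractor G \<sigma> ?x $ TY = \<sigma> ?x" "scale_tractor G \<sigma> ?x $ TZ b = - \<sigma> ?x * U b" for b
    by (simp_all add: scale_tractor_def Let_def matrix_vector_mult_def cd U_def sum_distrib_left sum_negf mult_ac)
  have "?u $ b * (\<sigma> ?x * ?a $ c' + ?e * (- \<sigma> ?x * U c')) = ?u $ c' * (\<sigma> ?x * ?a $ b + ?e * (- \<sigma> ?x * U b))" for b c'
    using generalised_geodesic_equation[OF nt tT c[OF t] geod, of b c'] by (simp only: I)
  then have "\<sigma> ?x / ?s * (v $ b * (?a $ c' - ?e * U c')) = \<sigma> ?x / ?s * (v $ c' * (?a $ b - ?e * U b))" for b c'
    by (simp add: wvelocity_def v_def algebra_simps)
  then have "v $ b * (?a $ c' - ?e * U c') = v $ c' * (?a $ b - ?e * U b)" for b c'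
    using \<sigma>(2) s by simp
  then obtain \<mu> where "\<And>b. ?a $ b - ?e * U b = \<mu> * v $ b"
    using proportional_if_wedge_zero[OF v0, of "\<lambda>b. ?a $ b - ?e * U b"] by blast
  \<comment> \<open>The factor \<sigma> has cancelled from the geodesic condition: up to a multiple
    of the velocity, the acceleration is the causal sign times the raised \<Upsilon>.\<close>
  then have a: "?a $ b = ?e * U b + \<mu> * v $ b" for b by (simp add: algebra_simps)
  obtain \<beta> where \<beta>: "\<And>b. ?s\<^sup>2 * ?a $ b = w $ b + (\<Sum>a\<in>UNIV. \<Sum>d\<in>UNIV. christoffel G b a d ?x * v $ a * v $ d) + \<beta> * v $ b"
    using wacceleration_formula[where G=G and T=T and S=S and y=y and t=t, OF nt S y hs c t dcm(2)] unfolding w_def v_def by blast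
  define m where "m = (\<Sum>a\<in>UNIV. \<Upsilon> a * v $ a)"
  have ch0: "christoffel G0 e a b ?x = christoffel G e a b ?x + (if e = a then 1 else 0) * \<Upsilon> b
    + (if e = b then 1 else 0) * \<Upsilon> a - cmetric G ?x $ a $ b * U e" for e a b
    unfolding \<Upsilon>_def U_def by (rule christoffel_conformal[OF G G0 x q G0q])
  \<comment> \<open>Contracted twice with the velocity, the two delta terms give multiples of the
    velocity, and the metric term gives the squared length times \<open>U\<close>.\<close>
  have ch: "(\<Sum>a\<in>UNIV. \<Sum>b\<in>UNIV. christoffel G0 e a b ?x * v $ a * v $ b) =
    (\<Sum>a\<in>UNIV. \<Sum>b\<in>UNIV. christoffel G e a b ?x * v $ a * v $ b) + 2 * m * v $ e - ?e * ?s\<^sup>2 * U e" for e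
  proof -
    have "christoffel G0 e a b ?x * v $ a * v $ b = christoffel G e a b ?x * v $ a * v $ b
       + (if e = a then 1 else 0) * (v $ a * (\<Upsilon> b * v $ b)) + (if e = b then 1 else 0) * (v $ b * (\<Upsilon> a * v $ a))
       - U e * (v $ a * (cmetric G ?x $ a $ b * v $ b))" for a b
      unfolding ch0 by (simp only: algebra_simps)
    then have "(\<Sum>a\<in>UNIV. \<Sum>b\<in>UNIV. christoffel G0 e a b ?x * v $ a * v $ b) =
      (\<Sum>a\<in>UNIV. \<Sum>b\<in>UNIV. christoffel G e a b ?x * v $ a * v $ b)
      + (\<Sum>a\<in>UNIV. \<Sum>b\<in>UNIV. (if e = a then 1 else 0) * (v $ a * (\<Upsilon> b * v $ b)))
      + (\<Sum>a\<in>UNIV. \<Sum>b\<in>UNIV. (if e = b then 1 else 0) * (v $ b * (\<Upsilon> a * v $ a)))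
      - (\<Sum>a\<in>UNIV. \<Sum>b\<in>UNIV. U e * (v $ a * (cmetric G ?x $ a $ b * v $ b)))"
      by (simp only: sum.distrib sum_subtractf)
    also have "(\<Sum>a\<in>UNIV. \<Sum>b\<in>UNIV. (if e = a then 1 else 0) * (v $ a * (\<Upsilon> b * v $ b))) = v $ e * m"
    proof -
      have "(\<Sum>a\<in>UNIV. \<Sum>b\<in>UNIV. (if e = a then 1 else 0) * (v $ a * (\<Upsilon> b * v $ b))) =
        (\<Sum>a\<in>UNIV. (if e = a then 1 else 0) * (v $ a * m))"
        by (simp only: m_def sum_distrib_left)
      then show ?thesis by (simp only: sum_delta_left)
    qed
    also have "(\<Sum>a\<in>UNIV. \<Sum>b\<in>UNIV. (if e = b then 1 else 0) * (v $ b * (\<Upsilon> a * v $ a))) = v $ e * m"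
      by (simp only: sum_delta_left m_def sum_distrib_left)
    also have "(\<Sum>a\<in>UNIV. \<Sum>b\<in>UNIV. U e * (v $ a * (cmetric G ?x $ a $ b * v $ b))) = U e * (v \<bullet> (cmetric G ?x *v v))"
      unfolding inner_vec_def matrix_vector_mult_def by (simp add: sum_distrib_left)
    finally show ?thesis unfolding vv by (simp add: algebra_simps)
  qed
  \<comment> \<open>The term in \<open>U\<close> from the change of connection cancels the term in
    \<open>U\<close> of the acceleration; only multiples of the velocity remain.\<close>
  have "w $ e + (\<Sum>a\<in>UNIV. \<Sum>b\<in>UNIV. christoffel G0 e a b ?x * v $ a * v $ b) = (?s\<^sup>2 * \<mu> - \<beta> + 2 * m) * v $ e" for e
    unfolding ch using \<beta>[of e] unfolding a by (simp add: algebra_simps)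
  then show ?geodesic by blast
  have Ka: "comps K b a ?x = - comps K a b ?x" for a b using K[of b a] by (simp add: comps_def)
  have div: "div2 G0 (comps K) d ?x = div2 G (comps K) d ?x + ?n * (\<Sum>e\<in>UNIV. U e * K ?x $ e $ d)" for d
    using div2_conformal(2)[where G=G and G'=G0, OF G G0 x q G0q Ka cky, of d]
    by (simp add: U_def \<Upsilon>_def comps_def)
  have g0: "v \<bullet> (cmetric G ?x *v v) = (scale_density G0 ?x)\<^sup>2 * (v \<bullet> (G0 ?x *v v))"
  proof -
    have "cmetric G ?x = cmetric G0 ?x"
      by (rule cmetric_rescale[where G=G and G'=G0 and x="?x", OF G0q[OF x] q(2), symmetric])
    then show ?thesis by (simp add: cmetric_def scaleR_matrix_vector_assoc[symmetric])
  qed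
  have l0: "scale_density G0 ?x > 0" by (rule scale_density_pos) (rule G0.nz[OF x])
  have e: "?e = sgn (v \<bullet> (G0 ?x *v v))"
    using g0 l0 by (simp add: causal_sign_def v_def[symmetric] sgn_mult)
  have sp: "?s = scale_density G0 ?x * sqrt \<bar>v \<bullet> (G0 ?x *v v)\<bar>"
    using speed_eq(3)[OF c[OF t]] l0 by (simp add: v_def[symmetric] g0 abs_mult real_sqrt_mult)
  have z: "(\<Sum>b\<in>UNIV. \<Sum>c\<in>UNIV. (v $ b * v $ c) * K ?x $ b $ c) = 0"
    by (rule sum_sym_antisym) (rule mult.commute, rule K)
  define k where "k = (\<Sum>b\<in>UNIV. \<Sum>c\<in>UNIV. v $ b * K ?x $ b $ c * U c)"
  have "?u \<bullet> (K ?x *v ?a) = inverse ?s * (\<Sum>b\<in>UNIV. \<Sum>c\<in>UNIV. v $ b * K ?x $ b $ c * ?a $ c)"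
    by (simp add: wvelocity_def v_def inner_vec_def matrix_vector_mult_def sum_distrib_left divide_inverse mult_ac)
  also have "(\<Sum>b\<in>UNIV. \<Sum>c\<in>UNIV. v $ b * K ?x $ b $ c * ?a $ c) =
     ?e * k + \<mu> * (\<Sum>b\<in>UNIV. \<Sum>c\<in>UNIV. (v $ b * v $ c) * K ?x $ b $ c)"
    unfolding a distrib_left sum.distrib k_def sum_distrib_left by (simp only: mult_ac)
  finally have uKa: "?u \<bullet> (K ?x *v ?a) = inverse ?s * (?e * k)" unfolding z by simp
  have "(\<Sum>d\<in>UNIV. v $ d * (\<Sum>e\<in>UNIV. U e * K ?x $ e $ d)) = (\<Sum>d\<in>UNIV. \<Sum>e\<in>UNIV. - (v $ d * K ?x $ d $ e * U e))"
    unfolding sum_distrib_left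
  proof (intro sum.cong refl)
    show "v $ d * (U e * K ?x $ e $ d) = - (v $ d * K ?x $ d $ e * U e)" for d e using K[of d e] by simp
  qed
  then have vU: "(\<Sum>d\<in>UNIV. v $ d * (\<Sum>e\<in>UNIV. U e * K ?x $ e $ d)) = - k" by (simp add: k_def sum_negf)
  \<comment> \<open>The conformal shift of the divergence is -(n-1) times the same number
    \<open>k\<close> that the acceleration term contributes. After division by -(n-1) the two terms
    of the first integral merge into one.\<close>
  have vdiv: "(\<Sum>d\<in>UNIV. v $ d * div2 G0 (comps K) d ?x) = (\<Sum>d\<in>UNIV. v $ d * div2 G (comps K) d ?x) - ?n * k"
  proof -
    have "(\<Sum>d\<in>UNIV. v $ d * div2 G0 (comps K) d ?x) = (\<Sum>d\<in>UNIV. v $ d * div2 G (comps K) d ?x)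
       + ?n * (\<Sum>d\<in>UNIV. v $ d * (\<Sum>e\<in>UNIV. U e * K ?x $ e $ d))"
    proof -
      have "(\<Sum>d\<in>UNIV. v $ d * (f d + ?n * g d)) = (\<Sum>d\<in>UNIV. v $ d * f d) + ?n * (\<Sum>d\<in>UNIV. v $ d * g d)" for f g
        by (simp add: distrib_left sum.distrib sum_distrib_left mult.left_commute)
      then show ?thesis unfolding div .
    qed
    then show ?thesis unfolding vU by simp
  qed
  have udiv: "(\<Sum>b\<in>UNIV. ?u $ b * div2 G (comps K) b ?x) = inverse ?s * (\<Sum>d\<in>UNIV. v $ d * div2 G (comps K) d ?x)"
    by (simp add: wvelocity_def v_def sum_distrib_left divide_inverse mult_ac)
  have n0: "?n > 0" using card by simp
  have "(\<Sum>a\<in>UNIV. v $ a * (div2 G0 (comps K) a ?x / scale_density G0 ?x)) / sqrt \<bar>v \<bullet> (G0 ?x *v v)\<bar>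
     = inverse ?s * (\<Sum>d\<in>UNIV. v $ d * div2 G0 (comps K) d ?x)"
    unfolding sp by (simp add: sum_divide_distrib sum_distrib_left divide_inverse mult_ac)
  then have E: "(\<Sum>a\<in>UNIV. v $ a * (div2 G0 (comps K) a ?x / scale_density G0 ?x)) / sqrt \<bar>v \<bullet> (G0 ?x *v v)\<bar>
     = inverse ?s * ((\<Sum>d\<in>UNIV. v $ d * div2 G (comps K) d ?x) - ?n * k)"
    unfolding vdiv .
  have gen: "i * (f * k) - f / n * (i * D) = - 1 / n * (f * (i * (D - n * k)))" if "n \<noteq> 0" for i f n D :: real
    using that by (simp add: field_simps)
  have "?n \<noteq> 0" using n0 by simp
  then show ?formula
    unfolding uKa udiv E e[symmetric] by (rule gen)
qed

section \<open>Charts of a Poincare-Einstein manifold\<close>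

locale atlas =
  fixes A :: "('p::{t2_space, second_countable_topology}, 'n::finite) chart set"
  assumes smooth_manifold: "smooth_manifold A"
begin

lemma chart_cover: "\<exists>ch\<in>A. p \<in> chart_dom ch"
  using smooth_manifold by (auto simp: smooth_manifold_def)

context
  fixes ch assumes ch: "ch \<in> A"
begin

lemma open_chart_dom: "open (chart_dom ch)"
  and openin_chart_ran: "openin (top_of_set halfspace) (chart_ran ch)"
  and chart_homeomorphism: "homeomorphism (chart_dom ch) (chart_ran ch) (coord ch) (point ch)"
  using smooth_manifold ch by (auto simp: smooth_manifold_def)

lemma point_coord: "p \<in> chart_dom ch \<Longrightarrow> point ch (coord ch p) = p"
  and coord_point: "x \<in> chart_ran ch \<Longrightarrow> coord ch (point ch x) = x"
  and coord_in: "p \<in> chart_dom ch \<Longrightarrow> coord ch p \<in> chart_ran ch"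
  and point_in: "x \<in> chart_ran ch \<Longrightarrow> point ch x \<in> chart_dom ch"
  and continuous_on_point: "continuous_on (chart_ran ch) (point ch)"
  using chart_homeomorphism by (auto simp: homeomorphism_def)

lemma chart_ran_halfspace: "chart_ran ch \<subseteq> halfspace"
  using openin_imp_subset[OF openin_chart_ran] .

lemma metric_facts:
  assumes "metric A g"
  shows "smooth_on (chart_ran ch) (g ch)" "x \<in> chart_ran ch \<Longrightarrow> det (g ch x) \<noteq> 0"
    "x \<in> chart_ran ch \<Longrightarrow> g ch x $ a $ b = g ch x $ b $ a"
proof -
  show "smooth_on (chart_ran ch) (g ch)" "x \<in> chart_ran ch \<Longrightarrow> det (g ch x) \<noteq> 0"
    using assms ch by (auto simp: metric_def tensor2_field_def)
  have "transpose (g ch x) = g ch x" if "x \<in> chart_ran ch" using assms ch that by (auto simp: metric_def)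
  then show "g ch x $ a $ b = g ch x $ b $ a" if "x \<in> chart_ran ch"
    using arg_cong[OF \<open>x \<in> chart_ran ch \<Longrightarrow> transpose (g ch x) = g ch x\<close>[OF that], of "\<lambda>m. m $ b $ a"]
    by (simp add: transpose_def)
qed

lemma smooth_entry: "smooth_on (chart_ran ch) (M :: real ^ 'n \<Rightarrow> real ^ 'n ^ 'n) \<Longrightarrow> smooth_on (chart_ran ch) (\<lambda>x. M x $ i $ j)"
  by (intro smooth_on_nth)

end

lemma local_metric_chart:
  assumes "ch \<in> A" "metric A g" "open W" "W \<subseteq> chart_ran ch"
  shows "local_metric W (g ch)"
proof
  show "open W" by fact
  show "W \<subseteq> halfspace" using assms chart_ran_halfspace by blast
  show "twice_diff W (\<lambda>y. g ch y $ i $ j)" for i j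
    by (rule smooth_on_twice_diff[OF smooth_entry[OF assms(1) metric_facts(1)[OF assms(1,2)]] openin_chart_ran[OF assms(1)] assms(3,4)])
  show "g ch x $ i $ j = g ch x $ j $ i" "det (g ch x) \<noteq> 0" if "x \<in> W" for x i j
    using metric_facts[OF assms(1,2)] that assms(4) by auto
qed

end

locale poincare_einstein_manifold = atlas A
  for A :: "('p::{t2_space, second_countable_topology}, 'n::finite) chart set" +
  fixes g0 :: "('p, 'n) tensor2" and r :: "'p \<Rightarrow> real"
  assumes g0: "metric A g0" and r: "defining_function A r"
    and einstein: "einstein_on A (- boundary A) (rescale (\<lambda>p. 1 / (r p)\<^sup>2) g0)"
begin

lemma r_zero: "r p = 0 \<longleftrightarrow> p \<in> boundary A"
  using r by (auto simp: defining_function_def)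

text \<open>Being an interior point is imposed on the point and not on its coordinates, so
  transition maps preserve this set at once.\<close>

definition interior_ran :: "('p, 'n) chart \<Rightarrow> (real ^ 'n) set" where
  "interior_ran ch = {x \<in> chart_ran ch. point ch x \<notin> boundary A}"

text \<open>The Einstein metric. At boundary points division by zero makes it the zero matrix, so it
  is only evaluated over \<open>interior_ran\<close>.\<close>

definition ge :: "('p, 'n) tensor2" where
  "ge = rescale (\<lambda>p. 1 / (r p)\<^sup>2) g0"

context
  fixes ch assumes ch: "ch \<in> A"
begin

lemma r_smooth: "smooth_on (chart_ran ch) (\<lambda>x. r (point ch x))"
  using r ch by (auto simp: defining_function_def smooth_function_def)

lemma inner_positive: "x \<in> interior_ran ch \<Longrightarrow> 0 < x $ bindex"
proof -
  assume x: "x \<in> interior_ran ch"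
  then have "x \<in> halfspace" using chart_ran_halfspace[OF ch] by (auto simp: interior_ran_def)
  moreover have "x $ bindex \<noteq> 0"
    using x ch coord_point[OF ch] point_in[OF ch] unfolding interior_ran_def boundary_def by fastforce
  ultimately show ?thesis by (simp add: halfspace_def)
qed

lemma inner_r: "x \<in> interior_ran ch \<Longrightarrow> r (point ch x) \<noteq> 0"
  by (simp add: interior_ran_def r_zero)

lemma inner_subset: "interior_ran ch \<subseteq> chart_ran ch"
  by (auto simp: interior_ran_def)

text \<open>The set is where the continuous function \<open>r\<close> is nonzero, hence relatively
  open in the half-space; as it avoids the bounding hyperplane, it is open in the whole
  space.\<close>

lemma open_inner: "open (interior_ran ch)"
proof -
  have "continuous_on (chart_ran ch) (\<lambda>x. r (point ch x))"
    unfolding continuous_on_eq_continuous_within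
  proof
    fix x assume "x \<in> chart_ran ch"
    then have "continuous (at x within halfspace) (\<lambda>x. r (point ch x))"
      by (intro differentiable_imp_continuous_within smooth_on_differentiable[OF r_smooth openin_chart_ran[OF ch]])
    then show "continuous (at x within chart_ran ch) (\<lambda>x. r (point ch x))"
      using continuous_within_subset chart_ran_halfspace[OF ch] by blast
  qed
  then have "openin (top_of_set (chart_ran ch)) (chart_ran ch \<inter> (\<lambda>x. r (point ch x)) -` (- {0}))"
    by (rule continuous_openin_preimage_gen) auto
  then have "openin (top_of_set halfspace) (chart_ran ch \<inter> (\<lambda>x. r (point ch x)) -` (- {0}))"
    using openin_trans openin_chart_ran[OF ch] by blast
  moreover have "chart_ran ch \<inter> (\<lambda>x. r (point ch x)) -` (- {0}) = interior_ran ch"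
    by (auto simp: interior_ran_def r_zero)
  ultimately obtain V where V: "open V" "interior_ran ch = halfspace \<inter> V" using openin_open by metis
  have "interior_ran ch = V \<inter> {x. 0 < x $ bindex}"
    using V(2) inner_positive by (auto simp: halfspace_def)
  moreover have "open {x :: real ^ 'n. 0 < x $ bindex}"
    by (intro open_Collect_less continuous_intros)
  ultimately show ?thesis using V(1) by (simp add: open_Int)
qed

lemma inner_halfspace: "interior_ran ch \<subseteq> halfspace"
  using inner_subset chart_ran_halfspace[OF ch] by blast

lemma twice_diff_function:
  assumes "smooth_function A f"
  shows "twice_diff (interior_ran ch) (\<lambda>x. f (point ch x))"
  using assms ch by (intro smooth_on_twice_diff[OF _ openin_chart_ran[OF ch] open_inner inner_subset])
    (auto simp: smooth_function_def)

lemma twice_diff_tensor: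
  assumes "tensor2_field A u M"
  shows "twice_diff (interior_ran ch) (comps (M ch) b c)"
proof -
  have "smooth_on (chart_ran ch) (M ch)" using assms ch by (simp add: tensor2_field_def)
  then have "smooth_on (chart_ran ch) (\<lambda>x. M ch x $ b $ c)" by (intro smooth_on_nth)
  from smooth_on_twice_diff[OF this openin_chart_ran[OF ch] open_inner inner_subset]
  show ?thesis by (simp add: comps_def[abs_def])
qed

lemma ge_eq: "ge ch x = (1 / (r (point ch x))\<^sup>2) *\<^sub>R g0 ch x"
  by (simp add: ge_def rescale_def)

lemma local_metric_inner: "metric A g \<Longrightarrow> local_metric (interior_ran ch) (g ch)"
  by (rule local_metric_chart[OF ch _ open_inner inner_subset])

lemma twice_diff_inverse_square: "twice_diff (interior_ran ch) (\<lambda>x. 1 / (r (point ch x))\<^sup>2)"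
proof -
  have "twice_diff (interior_ran ch) (\<lambda>x. inverse (r (point ch x) * r (point ch x)))"
    using r inner_r
    by (intro twice_diff_inverse[OF open_inner inner_halfspace] twice_diff_mult[OF open_inner inner_halfspace]
        twice_diff_function) (auto simp: defining_function_def)
  then show ?thesis by (simp add: divide_inverse power2_eq_square)
qed

lemma local_metric_ge: "local_metric (interior_ran ch) (ge ch)"
proof -
  interpret g0: local_metric "interior_ran ch" "g0 ch" by (rule local_metric_inner[OF g0])
  show ?thesis
  proof
    show "open (interior_ran ch)" "interior_ran ch \<subseteq> halfspace" by (rule open_inner, rule inner_halfspace)
    show "twice_diff (interior_ran ch) (\<lambda>y. ge ch y $ i $ j)" for i j
      unfolding ge_eq vector_scaleR_component real_scaleR_def
      by (intro twice_diff_mult[OF open_inner inner_halfspace] twice_diff_inverse_square g0.G)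
    show "ge ch x $ i $ j = ge ch x $ j $ i" "det (ge ch x) \<noteq> 0" if "x \<in> interior_ran ch" for x i j
      using g0.sym[OF that, of i j] g0.nz[OF that] inner_r[OF that] by (simp_all add: ge_eq det_scaleR)
  qed
qed

lemma cky_inner:
  assumes k: "conformal_killing_yano A c k" and g: "g \<in> c" "metric A g" and x: "x \<in> interior_ran ch"
  shows "cky_form (g ch) (comps (k ch)) x (\<lambda>d. div2 (g ch) (comps (k ch)) d x / (real CARD('n) - 1))"
    and "comps (k ch) b a x = - comps (k ch) a b x"
proof -
  interpret g: local_metric "interior_ran ch" "g ch" by (rule local_metric_inner[OF g(2)])
  have k2: "tensor2_field A 3 k" using k by (simp add: conformal_killing_yano_def)
  have anti: "comps (k ch) b a z = - comps (k ch) a b z" if z: "z \<in> chart_ran ch" for a b z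
  proof -
    have "transpose (k ch z) = - k ch z" using k ch z by (simp add: conformal_killing_yano_def)
    then have "transpose (k ch z) $ a $ b = (- k ch z) $ a $ b" by simp
    then show ?thesis by (simp add: comps_def transpose_def)
  qed
  then show "comps (k ch) b a x = - comps (k ch) a b x" using x inner_subset by auto
  have xr: "x \<in> chart_ran ch" using x inner_subset by auto
  have xh: "x \<in> halfspace" using x inner_halfspace by auto
  show "cky_form (g ch) (comps (k ch)) x (\<lambda>d. div2 (g ch) (comps (k ch)) d x / (real CARD('n) - 1))"
  proof (rule cky_form_if_equation)
    fix a b d
    have "pd a (comps (k ch) d b) x = pd a (\<lambda>z. - comps (k ch) b d z) x"
      by (rule pd_cong(1)[OF openin_chart_ran[OF ch] xr]) (rule anti)
    also have "\<dots> = - pd a (comps (k ch) b d) x"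
      by (rule pd_minus[OF xh]) (rule twice_diffD(1)[OF twice_diff_tensor[OF k2] x])
    finally have p: "pd a (comps (k ch) d b) x = - pd a (comps (k ch) b d) x" .
    show "cd2 (g ch) 3 (\<lambda>p q. comps (k ch) q p) a b d x = - cd2 (g ch) 3 (comps (k ch)) a b d x"
      unfolding cd2_def p anti[OF xr, of b d] anti[OF xr, of _ d] anti[OF xr, of b _]
      by (simp add: sum_negf algebra_simps)
    show "cd2 (g ch) 3 (comps (k ch)) a b d x =
      alt3 (\<lambda>a b d. cd2 (g ch) 3 (comps (k ch)) a b d x) a b d
      - 2 / (real CARD('n) - 1) *
        alt2 (\<lambda>b d. cmetric (g ch) x $ a $ b * div2 (g ch) (\<lambda>p q. comps (k ch) q p) d x) b d"
      using k g(1) ch xr unfolding conformal_killing_yano_def Let_def by blast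
  qed
qed

text \<open>The Killing-Yano hypothesis speaks of metrics in the class only. Conformal invariance
  with the factor r^-2 carries it to the Einstein metric over interior points.\<close>

lemma cky_ge:
  assumes k: "conformal_killing_yano A c k" and g: "g0 \<in> c" and x: "x \<in> interior_ran ch"
  shows "\<exists>N. cky_form (ge ch) (comps (k ch)) x N"
proof -
  have "cky_form (ge ch) (comps (k ch)) x (\<lambda>d. div2 (g0 ch) (comps (k ch)) d x / (real CARD('n) - 1)
    + (\<Sum>e\<in>UNIV. (\<Sum>f\<in>UNIV. cinverse (g0 ch) x $ e $ f * (pd f (\<lambda>x. 1 / (r (point ch x))\<^sup>2) x / (2 * (1 / (r (point ch x))\<^sup>2)))) * comps (k ch) e d x))"
  proof (rule div2_conformal(1)[where G="g0 ch" and G'="ge ch" and W="interior_ran ch" and q="\<lambda>x. 1 / (r (point ch x))\<^sup>2"])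
    show "local_metric (interior_ran ch) (g0 ch)" by (rule local_metric_inner[OF g0])
    show "local_metric (interior_ran ch) (ge ch)" by (rule local_metric_ge)
    show "x \<in> interior_ran ch" by (rule x)
    show "(\<lambda>x. 1 / (r (point ch x))\<^sup>2) differentiable at x within halfspace"
      by (rule twice_diffD(1)[OF twice_diff_inverse_square x])
    show "0 < 1 / (r (point ch x))\<^sup>2" using inner_r[OF x] by simp
    show "ge ch y = (1 / (r (point ch y))\<^sup>2) *\<^sub>R g0 ch y" for y by (rule ge_eq)
    show "comps (k ch) b a x = - comps (k ch) a b x" for a b by (rule cky_inner(2)[OF k g g0 x])
    show "cky_form (g0 ch) (comps (k ch)) x (\<lambda>d. div2 (g0 ch) (comps (k ch)) d x / (real CARD('n) - 1))"
      by (rule cky_inner(1)[OF k g g0 x])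
  qed
  then show ?thesis by blast
qed

end

end

section \<open>Independence of the chart\<close>

context poincare_einstein_manifold
begin

text \<open>The unit velocity paired with the Killing covector of the Einstein metric, times the
  causal sign: a scalar of weight zero, comparable between charts.\<close>

definition einstein_quantity :: "('p, 'n) tensor2 \<Rightarrow> real set \<Rightarrow> (real \<Rightarrow> 'p) \<Rightarrow> ('p, 'n) chart \<Rightarrow> real \<Rightarrow> real" where
  "einstein_quantity k T \<gamma> ch t =
     (let y = in_chart ch \<gamma>; v = velocity T y t; G = ge ch
      in sgn (v \<bullet> (G (y t) *v v)) *
         ((\<Sum>a\<in>UNIV. v $ a * (div2 G (comps (k ch)) a (y t) / scale_density G (y t))) / sqrt \<bar>v \<bullet> (G (y t) *v v)\<bar>))"

context
  fixes ch ch' assumes ch: "ch \<in> A" "ch' \<in> A"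
begin

definition overlap :: "(real ^ 'n) set" where
  "overlap = {x \<in> chart_ran ch. point ch x \<in> chart_dom ch'}"

lemma overlap_image: "overlap = coord ch ` (chart_dom ch \<inter> chart_dom ch')"
proof
  show "overlap \<subseteq> coord ch ` (chart_dom ch \<inter> chart_dom ch')"
  proof
    fix x assume x: "x \<in> overlap"
    then have "point ch x \<in> chart_dom ch \<inter> chart_dom ch'" using point_in[OF ch(1)] by (simp add: overlap_def)
    moreover have "x = coord ch (point ch x)" using x coord_point[OF ch(1)] by (simp add: overlap_def)
    ultimately show "x \<in> coord ch ` (chart_dom ch \<inter> chart_dom ch')" by (rule rev_image_eqI)
  qed
  show "coord ch ` (chart_dom ch \<inter> chart_dom ch') \<subseteq> overlap"
    using coord_in[OF ch(1)] point_coord[OF ch(1)] by (auto simp: overlap_def)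
qed

lemma openin_overlap: "openin (top_of_set halfspace) overlap"
proof -
  have "openin (top_of_set (chart_ran ch)) (chart_ran ch \<inter> point ch -` chart_dom ch')"
    by (rule continuous_openin_preimage_gen[OF continuous_on_point[OF ch(1)] open_chart_dom[OF ch(2)]])
  moreover have "chart_ran ch \<inter> point ch -` chart_dom ch' = overlap" by (auto simp: overlap_def)
  ultimately show ?thesis using openin_trans openin_chart_ran[OF ch(1)] by metis
qed

lemma smooth_transition: "smooth_on overlap (transition ch ch')"
  using smooth_manifold ch by (simp add: smooth_manifold_def overlap_image)

definition Jac :: "real ^ 'n \<Rightarrow> real ^ 'n ^ 'n" where
  "Jac x = (\<chi> c a. pd a (\<lambda>x. transition ch ch' x $ c) x)"

lemma jacobian_Jac:
  assumes x: "x \<in> overlap"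
  shows "jacobian ch ch' x = Jac x"
proof -
  let ?\<phi> = "transition ch ch'"
  let ?D = "\<lambda>c. frechet_derivative (\<lambda>y. ?\<phi> y $ c) (at x within halfspace)"
  have "(\<lambda>y. ?\<phi> y $ c) differentiable (at x within halfspace)" for c
    by (rule smooth_on_differentiable[OF smooth_on_nth[OF smooth_transition] openin_overlap x])
  then have "((\<lambda>y. ?\<phi> y $ c) has_derivative ?D c) (at x within halfspace)" for c
    using frechet_derivative_works by blast
  then have d: "(?\<phi> has_derivative (\<lambda>h. \<chi> c. ?D c h)) (at x within halfspace)"
    by (subst has_derivative_componentwise_within) (auto simp: Basis_vec_def inner_axis)
  have "x \<in> halfspace" using x openin_imp_subset[OF openin_overlap] by auto
  then have "frechet_derivative ?\<phi> (at x within halfspace) = (\<lambda>h. \<chi> c. ?D c h)"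
    using halfspace_derivative_unique[OF _ _ d] d frechet_derivative_works differentiable_def by blast
  then show ?thesis
    by (simp add: jacobian_def matrix_def Jac_def pd_def vec_eq_iff)
qed

lemma tensor_law:
  assumes "tensor2_field A u M" "x \<in> overlap"
  shows "M ch x = \<bar>det (Jac x)\<bar> powr (- u / real CARD('n)) *\<^sub>R
    (transpose (Jac x) ** M ch' (transition ch ch' x) ** Jac x)"
proof -
  have "M ch x = \<bar>det (jacobian ch ch' x)\<bar> powr (- u / real CARD('n)) *\<^sub>R
    (transpose (jacobian ch ch' x) ** M ch' (transition ch ch' x) ** jacobian ch ch' x)"
    using assms(1) ch assms(2)[unfolded overlap_image] unfolding tensor2_field_def Let_def by blast
  then show ?thesis unfolding jacobian_Jac[OF assms(2)] .
qed

lemma point_transition: "x \<in> overlap \<Longrightarrow> point ch' (transition ch ch' x) = point ch x"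
  by (simp add: overlap_def transition_def point_coord[OF ch(2)])

lemma coordinate_change_charts:
  "coordinate_change (interior_ran ch \<inter> overlap) (interior_ran ch') (ge ch) (ge ch') (transition ch ch') Jac"
proof -
  obtain V where V: "open V" "overlap = halfspace \<inter> V" using openin_overlap openin_open by metis
  have int: "interior_ran ch \<inter> overlap = interior_ran ch \<inter> V" using V inner_halfspace[OF ch(1)] by auto
  have op: "open (interior_ran ch \<inter> overlap)" unfolding int using V(1) open_inner[OF ch(1)] by (simp add: open_Int)
  interpret G: local_metric "interior_ran ch" "ge ch" by (rule local_metric_ge[OF ch(1)])
  interpret G': local_metric "interior_ran ch'" "ge ch'" by (rule local_metric_ge[OF ch(2)])
  interpret G1: local_metric "interior_ran ch \<inter> overlap" "ge ch"
    using G.W G.sym G.nz by unfold_locales (auto intro: op twice_diff_subset[OF G.G])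
  show ?thesis
  proof (intro_locales, unfold_locales)
    fix x assume x: "x \<in> interior_ran ch \<inter> overlap"
    have "transition ch ch' x \<in> chart_ran ch'"
      using x coord_in[OF ch(2)] by (auto simp: overlap_def transition_def)
    then show "transition ch ch' x \<in> interior_ran ch'"
      using x point_transition[of x] by (auto simp: interior_ran_def)
    have law: "g0 ch x = \<bar>det (Jac x)\<bar> powr (- 0 / real CARD('n)) *\<^sub>R
      (transpose (Jac x) ** g0 ch' (transition ch ch' x) ** Jac x)"
      by (rule tensor_law) (use g0 x in \<open>auto simp: metric_def\<close>)
    \<comment> \<open>The weight zero factor is \<open>0 powr 0 = 0\<close> for a singular Jacobian,
      so it may be replaced by 1 only once the Jacobian is known to be invertible; nondegeneracy of
      the metric provides this.\<close>
    have "det (g0 ch x) \<noteq> 0"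
      using metric_facts(2)[OF ch(1) g0] x inner_subset[OF ch(1)] by auto
    then have "det (Jac x) \<noteq> 0" using law by (auto simp: det_scaleR)
    then have "g0 ch x = transpose (Jac x) ** g0 ch' (transition ch ch' x) ** Jac x" using law by simp
    then show "ge ch x = transpose (Jac x) ** ge ch' (transition ch ch' x) ** Jac x"
      using x by (simp add: ge_eq[OF ch(1)] ge_eq[OF ch(2)] point_transition scaleR_matrix_mult)
  next
    show "twice_diff (interior_ran ch \<inter> overlap) (\<lambda>x. transition ch ch' x $ c)" for c
      by (rule smooth_on_twice_diff[OF smooth_on_nth[OF smooth_transition] openin_overlap op]) auto
    show "Jac x $ c $ a = pd a (\<lambda>x. transition ch ch' x $ c) x" for c a x by (simp add: Jac_def)
  qed
qed

text \<open>The velocity is pushed forward by the Jacobian while the metric and the weight zero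
  covector are pulled back by it, so the length and the pairing agree.\<close>

lemma einstein_quantity_chart:
  assumes k: "tensor2_field A 3 k" and nt: "at t within T \<noteq> bot"
    and S: "openin (top_of_set T) S" "t \<in> S" "\<And>s. s \<in> S \<Longrightarrow> \<gamma> s \<in> chart_dom ch \<inter> chart_dom ch'"
    and vel: "(in_chart ch \<gamma> has_vector_derivative velocity T (in_chart ch \<gamma>) t) (at t within T)"
    and interior: "in_chart ch \<gamma> t \<in> interior_ran ch"
  shows "einstein_quantity k T \<gamma> ch t = einstein_quantity k T \<gamma> ch' t"
proof -
  interpret coordinate_change "interior_ran ch \<inter> overlap" "interior_ran ch'" "ge ch" "ge ch'" "transition ch ch'" Jac
    by (rule coordinate_change_charts)
  let ?y = "in_chart ch \<gamma>" and ?y' = "in_chart ch' \<gamma>"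
  let ?v = "velocity T ?y t" and ?v' = "velocity T ?y' t" and ?x = "?y t"
  have yov: "?y s \<in> overlap" if "s \<in> S" for s
    using S(3)[OF that] by (auto simp: in_chart_def overlap_def coord_in[OF ch(1)] point_coord[OF ch(1)])
  have y': "?y' s = transition ch ch' (?y s)" if "s \<in> S" for s
    using S(3)[OF that] by (simp add: in_chart_def transition_def point_coord[OF ch(1)])
  have x: "?x \<in> interior_ran ch \<inter> overlap" using interior yov[OF S(2)] by auto
  have "?y ` S \<subseteq> halfspace" using yov openin_imp_subset[OF openin_overlap] by auto
  note chain = has_real_derivative_chain[where y="?y" and t=t and S=S and v="?v", OF vel[folded at_within_openin[OF S(1,2)]] this twice_diffD(1)[OF \<phi>(2) x]]
  have "((\<lambda>s. transition ch ch' (?y s) $ c) has_vector_derivative (Jac ?x *v ?v) $ c) (at t within S)" for c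
    using chain[of c] by (simp add: has_real_derivative_iff_has_vector_derivative matrix_vector_mult_def B mult.commute)
  then have "((\<lambda>s. transition ch ch' (?y s)) has_vector_derivative Jac ?x *v ?v) (at t within S)"
    unfolding has_vector_derivative_def
    by (subst has_derivative_componentwise_within) (auto simp: Basis_vec_def inner_axis)
  then have "(?y' has_vector_derivative Jac ?x *v ?v) (at t within S)"
    by (rule has_vector_derivative_transform[OF S(2), rotated]) (rule y')
  then have v': "?v' = Jac ?x *v ?v"
    unfolding velocity_def at_within_openin[OF S(1,2)] by (rule vector_derivative_within[OF nt])
  have x': "?y' t = transition ch ch' ?x" by (rule y'[OF S(2)])
  have q: "?v' \<bullet> (ge ch' (?y' t) *v ?v') = ?v \<bullet> (ge ch ?x *v ?v)"
  proof -
    have "?v \<bullet> (ge ch ?x *v ?v) = ?v \<bullet> (transpose (Jac ?x) *v (ge ch' (?y' t) *v (Jac ?x *v ?v)))"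
      unfolding pull[OF x] x' by (simp only: matrix_vector_mul_assoc matrix_mul_assoc)
    also have "\<dots> = (Jac ?x *v ?v) \<bullet> (ge ch' (?y' t) *v (Jac ?x *v ?v))"
      using dot_lmul_matrix[of ?v "transpose (Jac ?x)"] unfolding vector_transpose_matrix by simp
    finally show ?thesis unfolding v' ..
  qed
  have law: "(\<chi> b c. comps (k ch) b c y) = \<bar>det (Jac y)\<bar> powr (- 3 / real CARD('n)) *\<^sub>R
      (transpose (Jac y) ** (\<chi> b c. comps (k ch') b c (transition ch ch' y)) ** Jac y)" if "y \<in> interior_ran ch \<inter> overlap" for y
  proof -
    have "(\<chi> b c. comps (k c') b c z) = k c' z" for c' z by (simp add: comps_def vec_eq_iff)
    then show ?thesis using tensor_law[OF k, of y] that by simp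
  qed
  have td: "twice_diff (interior_ran ch \<inter> overlap) (comps (k ch) b c)" for b c
    by (rule twice_diff_subset[OF twice_diff_tensor[OF ch(1) k]]) auto
  have nu: "div2 (ge ch) (comps (k ch)) d ?x / scale_density (ge ch) ?x =
    (\<Sum>l\<in>UNIV. Jac ?x $ l $ d * (div2 (ge ch') (comps (k ch')) l (?y' t) / scale_density (ge ch') (?y' t)))" for d
    unfolding x' by (rule div2_pull[OF x td twice_diff_tensor[OF ch(2) k] law])
  have "(\<Sum>d\<in>UNIV. ?v $ d * (div2 (ge ch) (comps (k ch)) d ?x / scale_density (ge ch) ?x)) =
    (\<Sum>d\<in>UNIV. \<Sum>l\<in>UNIV. Jac ?x $ l $ d * ?v $ d * (div2 (ge ch') (comps (k ch')) l (?y' t) / scale_density (ge ch') (?y' t)))"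
    unfolding nu by (simp only: sum_distrib_left mult_ac)
  also have "\<dots> = (\<Sum>l\<in>UNIV. \<Sum>d\<in>UNIV. Jac ?x $ l $ d * ?v $ d * (div2 (ge ch') (comps (k ch')) l (?y' t) / scale_density (ge ch') (?y' t)))"
    by (rule sum.swap)
  also have "\<dots> = (\<Sum>l\<in>UNIV. ?v' $ l * (div2 (ge ch') (comps (k ch')) l (?y' t) / scale_density (ge ch') (?y' t)))"
    unfolding v' matrix_vector_mult_def by (simp only: vec_lambda_beta sum_distrib_right)
  finally show ?thesis
    unfolding einstein_quantity_def Let_def q by (simp only:)
qed

end

end

section \<open>Generalised geodesics and the boundary\<close>

locale poincare_einstein_geodesic = poincare_einstein_manifold A g0 r
  for A :: "('p::{t2_space, second_countable_topology}, 'n::finite) chart set"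
    and g0 :: "('p, 'n) tensor2" and r :: "'p \<Rightarrow> real" +
  fixes \<sigma> :: "('p, 'n) density" and k :: "('p, 'n) tensor2" and T :: "real set" and \<gamma> :: "real \<Rightarrow> 'p"
  assumes card: "CARD('n) \<ge> 3"
    and \<sigma>: "\<And>ch x. ch \<in> A \<Longrightarrow> x \<in> chart_ran ch \<Longrightarrow> \<sigma> ch x = r (point ch x) * scale_density (g0 ch) x"
    and geodesic: "generalised_geodesic A (conformal_class A g0) \<sigma> T \<gamma>"
    and cky: "conformal_killing_yano A (conformal_class A g0) k"
begin

lemma g0_in_class: "g0 \<in> conformal_class A g0"
proof -
  have "smooth_function A (\<lambda>_. 0)"
  proof -
    have "ck_on m UNIV (\<lambda>_::real ^ 'n. 0::real)" for m by (induction m) (auto simp: frechet_derivative_const)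
    then show ?thesis unfolding smooth_function_def smooth_on_def by (metis UNIV_I open_UNIV)
  qed
  moreover have "\<forall>ch\<in>A. \<forall>x\<in>chart_ran ch. g0 ch x = exp (2 * 0) *\<^sub>R g0 ch x" by simp
  ultimately show ?thesis unfolding conformal_class_def using g0 by (intro CollectI conjI exI[of _ "\<lambda>_. 0"])
qed

lemma class_metric: "g \<in> conformal_class A g0 \<Longrightarrow> metric A g"
  by (simp add: conformal_class_def)

lemma k_tensor: "tensor2_field A 3 k"
  using cky by (simp add: conformal_killing_yano_def)

lemma nontrivial: "s \<in> T \<Longrightarrow> at s within T \<noteq> bot"
  using geodesic interval_not_trivial by (auto simp: generalised_geodesic_def regular_curve_def)

definition times :: "('p, 'n) chart \<Rightarrow> real set" where
  "times ch = {t \<in> T. \<gamma> t \<in> chart_dom ch}"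

context
  fixes ch assumes ch: "ch \<in> A"
begin

lemma openin_times: "openin (top_of_set T) (times ch)"
proof -
  have "continuous_on T \<gamma>" using geodesic by (simp add: generalised_geodesic_def regular_curve_def)
  then have "openin (top_of_set T) (T \<inter> \<gamma> -` chart_dom ch)"
    by (rule continuous_openin_preimage_gen) (rule open_chart_dom[OF ch])
  moreover have "T \<inter> \<gamma> -` chart_dom ch = times ch" by (auto simp: times_def)
  ultimately show ?thesis by simp
qed

lemma smooth_in_chart: "smooth_on (times ch) (in_chart ch \<gamma>)"
proof -
  have "smooth_on {t \<in> T. \<gamma> t \<in> chart_dom ch} (\<lambda>t. coord ch (\<gamma> t))"
    using geodesic ch by (simp add: generalised_geodesic_def regular_curve_def)
  then show ?thesis by (simp add: times_def in_chart_def[abs_def])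
qed

lemma in_chart_ran: "t \<in> times ch \<Longrightarrow> in_chart ch \<gamma> t \<in> chart_ran ch"
  by (simp add: times_def in_chart_def coord_in[OF ch])

lemma in_chart_halfspace: "t \<in> times ch \<Longrightarrow> in_chart ch \<gamma> t \<in> halfspace"
  using in_chart_ran chart_ran_halfspace[OF ch] by blast

lemma point_in_chart: "t \<in> times ch \<Longrightarrow> point ch (in_chart ch \<gamma> t) = \<gamma> t"
  by (simp add: times_def in_chart_def point_coord[OF ch])

lemma causal:
  assumes "g \<in> conformal_class A g0" "t \<in> times ch"
  shows "causal_sign (g ch) T (in_chart ch \<gamma>) t \<noteq> 0"
  using geodesic ch assms by (auto simp: generalised_geodesic_def times_def)

lemma wedge:
  assumes "g \<in> conformal_class A g0" "t \<in> times ch"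
  shows "alt4 (\<lambda>E B C D. scale_tractor (g ch) (\<sigma> ch) (in_chart ch \<gamma> t) $ E
             * three_tractor (g ch) T (in_chart ch \<gamma>) t B C D) E B C D = 0"
  using geodesic ch assms by (auto simp: generalised_geodesic_def times_def)

lemma k_anti:
  assumes "x \<in> chart_ran ch"
  shows "k ch x $ a $ b = - k ch x $ b $ a"
proof -
  have "transpose (k ch x) = - k ch x" using cky ch assms by (simp add: conformal_killing_yano_def)
  then have "transpose (k ch x) $ b $ a = (- k ch x) $ b $ a" by simp
  then show ?thesis by (simp add: transpose_def)
qed

text \<open>A generalised geodesic meets the boundary along the conormal, hence transversally, hence only
  at an end point.\<close>

lemma boundary_transversal:
  assumes t: "t \<in> times ch" "t \<in> interior T" and b: "in_chart ch \<gamma> t $ bindex = 0"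
  shows False
proof -
  let ?y = "in_chart ch \<gamma>" and ?G = "g0 ch" and ?\<rho> = "\<lambda>x. r (point ch x)"
  let ?x = "?y t" and ?v = "velocity T ?y t"
  have xr: "?x \<in> chart_ran ch" and h: "?x \<in> halfspace" using in_chart_ran in_chart_halfspace t by auto
  have tT: "t \<in> T" using t by (simp add: times_def)
  have bd: "point ch z \<in> boundary A" if "z \<in> chart_ran ch" "z $ bindex = 0" for z
    using that ch point_in[OF ch] coord_point[OF ch] unfolding boundary_def by force
  have c: "causal_sign ?G T ?y t \<noteq> 0" by (rule causal[OF g0_in_class t(1)])
  have atT: "at t within T = at t" using t(2) by (rule at_within_interior)
  have vel: "(?y has_vector_derivative ?v) (at t)"
    using curve_velocity[OF nontrivial openin_times smooth_in_chart t(1)] by (simp only: atT)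
  \<comment> \<open>At an interior time the curve stays in the half-space on both sides, so the
    bounding coordinate has a local minimum and the velocity is tangent to the boundary.\<close>
  have vb: "?v $ bindex = 0"
  proof -
    have d: "((\<lambda>s. ?y s $ bindex) has_real_derivative ?v $ bindex) (at t)"
      using bounded_linear.has_vector_derivative[OF bounded_linear_vec_nth vel]
      by (simp add: has_real_derivative_iff_has_vector_derivative)
    obtain V where V: "open V" "times ch = T \<inter> V" using openin_times openin_open by metis
    have "open (interior T \<inter> V)" "t \<in> interior T \<inter> V" using V t by auto
    then obtain e where e: "e > 0" "ball t e \<subseteq> interior T \<inter> V" using open_contains_ball by meson
    show ?thesis
    proof (rule DERIV_local_min[OF d e(1)], intro allI impI)
      fix s assume "\<bar>t - s\<bar> < e"
      then have "s \<in> interior T \<inter> V" using e(2) by (auto simp: dist_real_def)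
      then have "s \<in> times ch" using V(2) interior_subset by blast
      then show "?y t $ bindex \<le> ?y s $ bindex" using in_chart_halfspace b by (auto simp: halfspace_def)
    qed
  qed
  have d\<rho>: "?\<rho> differentiable (at ?x within halfspace)"
    by (rule smooth_on_differentiable[OF r_smooth[OF ch] openin_chart_ran[OF ch] xr])
  \<comment> \<open>\<open>r\<close> vanishes on the bounding hyperplane near \<open>?x\<close>, so
    its derivative there has no tangential component.\<close>
  have tangential: "pd a ?\<rho> ?x = 0" if a: "a \<noteq> bindex" for a
  proof -
    let ?l = "\<lambda>s. ?x + s *\<^sub>R axis a 1"
    have l: "?l s $ bindex = 0" for s using a b by (simp add: axis_def)
    have lv: "(?l has_vector_derivative axis a 1) (at 0)"
      by (auto intro!: derivative_eq_intros simp: has_vector_derivative_def)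
    have lh: "?l ` UNIV \<subseteq> halfspace" using l by (auto simp: halfspace_def)
    have x0: "?l 0 = ?x" by simp
    have "((\<lambda>s. ?\<rho> (?l s)) has_real_derivative (\<Sum>b\<in>UNIV. axis a 1 $ b * pd b ?\<rho> (?l 0))) (at 0)"
      by (rule has_real_derivative_chain[where y="?l" and t=0 and S=UNIV and v="axis a 1", OF lv lh]) (use d\<rho> in simp)
    moreover have "(\<Sum>b\<in>UNIV. axis a 1 $ b * pd b ?\<rho> ?x) = pd a ?\<rho> ?x"
      using sum_delta_left(2)[of a "\<lambda>b. pd b ?\<rho> ?x"] by (simp add: axis_def eq_commute)
    ultimately have 1: "((\<lambda>s. ?\<rho> (?l s)) has_real_derivative pd a ?\<rho> ?x) (at 0)" unfolding x0 by (simp only:)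
    obtain V where V: "open V" "chart_ran ch = halfspace \<inter> V" using openin_chart_ran[OF ch] openin_open by metis
    have "open (?l -` V)" using V(1) by (intro open_vimage continuous_intros)
    moreover have "0 \<in> ?l -` V" using xr V(2) by simp
    moreover have "?\<rho> (?l s) = 0" if "s \<in> ?l -` V" for s
    proof -
      have "?l s \<in> chart_ran ch" using that lh V(2) by auto
      then show ?thesis using bd[OF _ l] r_zero by blast
    qed
    ultimately have "((\<lambda>s. ?\<rho> (?l s)) has_real_derivative 0) (at 0)"
      using has_field_derivative_transform_within_open[of "\<lambda>_. 0" 0 0 "?l -` V" "\<lambda>s. ?\<rho> (?l s)"] by simp
    then show ?thesis using DERIV_unique[OF 1] by blast
  qed
  have \<rho>0: "?\<rho> ?x = 0" using bd[OF xr b] r_zero by blast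
  let ?l = "scale_density ?G ?x"
  have nz: "det (?G ?x) \<noteq> 0" using metric_facts(2)[OF ch g0 xr] .
  have l: "?l > 0" by (rule scale_density_pos) (rule nz)
  have dG: "(\<lambda>x. ?G x $ i $ j) differentiable (at ?x within halfspace)" for i j
    by (rule smooth_on_differentiable[OF smooth_entry[OF ch metric_facts(1)[OF ch g0]] openin_chart_ran[OF ch] xr])
  \<comment> \<open>Where \<open>r\<close> vanishes, the connection term disappears, and the
    derivative of \<sigma> is the density times the differential of \<open>r\<close>. With the top
    slot of the scale tractor zero, the wedge condition compares the velocity with this gradient
    alone.\<close>
  have cd: "cd0 ?G 1 (\<sigma> ch) a ?x = ?l * pd a ?\<rho> ?x" for a
  proof -
    have "pd a (\<sigma> ch) ?x = pd a (\<lambda>x. ?\<rho> x * scale_density ?G x) ?x"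
      by (rule pd_cong(1)[OF openin_chart_ran[OF ch] xr]) (rule \<sigma>[OF ch])
    also have "\<dots> = ?l * pd a ?\<rho> ?x"
      unfolding pd_mult[OF h d\<rho> differentiable_cmetric(1)[where G="?G" and x="?x", OF dG h nz]] \<rho>0 by simp
    finally show ?thesis by (simp add: cd0_def \<sigma>[OF ch xr] \<rho>0)
  qed
  define \<mu> where "\<mu> b = (\<Sum>a\<in>UNIV. cinverse ?G ?x $ b $ a * (?l * pd a ?\<rho> ?x))" for b
  have I: "scale_tractor ?G (\<sigma> ch) ?x $ TY = 0" "scale_tractor ?G (\<sigma> ch) ?x $ TZ b = \<mu> b" for b
    by (simp_all add: scale_tractor_def Let_def matrix_vector_mult_def cd \<mu>_def \<sigma>[OF ch xr] \<rho>0)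
  have s: "speed ?G T ?y t > 0" by (rule speed_eq(1)[OF c])
  have "wvelocity ?G T ?y t $ b * (0 * wacceleration ?G T ?y t $ c' + causal_sign ?G T ?y t * \<mu> c') =
      wvelocity ?G T ?y t $ c' * (0 * wacceleration ?G T ?y t $ b + causal_sign ?G T ?y t * \<mu> b)" for b c'
    using generalised_geodesic_equation[where G="?G" and T=T and y="?y" and t=t, OF nontrivial tT c wedge[OF g0_in_class t(1)], of b c']
    by (simp only: I)
  then have "?v $ b * \<mu> c' = ?v $ c' * \<mu> b" for b c'
    using s c by (simp add: wvelocity_def field_simps)
  moreover have "?v \<noteq> 0" using speed_eq(2)[OF c] c s by auto
  ultimately obtain m where m: "\<And>b. \<mu> b = m * ?v $ b" using proportional_if_wedge_zero[of ?v \<mu>] by blast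
  \<comment> \<open>Lowering the index: the differential of \<open>r\<close> is a multiple of the
    metric dual of the velocity.\<close>
  have low: "?l * pd a ?\<rho> ?x = m * (cmetric ?G ?x *v ?v) $ a" for a
  proof -
    have "?G ?x $ i $ j = ?G ?x $ j $ i" for i j by (rule metric_facts(3)[OF ch g0 xr])
    have "cmetric ?G ?x ** cinverse ?G ?x = mat 1"
      unfolding cinverse_def by (rule matrix_inv_right(1)) (use l nz in \<open>simp add: cmetric_def det_scaleR\<close>)
    then have "(cmetric ?G ?x ** cinverse ?G ?x) $ i $ j = (if i = j then 1 else 0)" for i j by (simp add: mat_def)
    then have "(\<Sum>b\<in>UNIV. cmetric ?G ?x $ i $ b * cinverse ?G ?x $ b $ j) = (if i = j then 1 else 0)" for i j
      by (simp add: matrix_matrix_mult_def)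
    from contraction[OF this, of a "\<lambda>a. ?l * pd a ?\<rho> ?x"]
    have "?l * pd a ?\<rho> ?x = (\<Sum>b\<in>UNIV. cmetric ?G ?x $ a $ b * \<mu> b)" by (simp only: \<mu>_def)
    then show ?thesis unfolding m by (simp add: matrix_vector_mult_def sum_distrib_left mult_ac)
  qed
  \<comment> \<open>The velocity is tangent and the differential of \<open>r\<close> is conormal, so
    they pair to zero; but the pairing is also a multiple of \<open>m\<close> times the squared
    length. The velocity is not null, so \<open>m\<close> vanishes and with it the differential of
    \<open>r\<close>, against the choice of a defining function.\<close>
  have "?v $ a * pd a ?\<rho> ?x = 0" for a using vb tangential by (cases "a = bindex") auto
  then have "0 = (\<Sum>a\<in>UNIV. ?l * (?v $ a * pd a ?\<rho> ?x))"
    by (simp only: mult_zero_right sum.neutral_const)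
  also have "\<dots> = m * (?v \<bullet> (cmetric ?G ?x *v ?v))"
  proof -
    have "?l * (?v $ a * pd a ?\<rho> ?x) = m * (?v $ a * (cmetric ?G ?x *v ?v) $ a)" for a
      using low[of a] by (metis mult.left_commute)
    then show ?thesis by (simp only: inner_vec_def inner_real_def sum_distrib_left)
  qed
  finally have "m = 0" using c by (auto simp: causal_sign_def)
  then have "pd a ?\<rho> ?x = 0" for a using low[of a] l by simp
  then show False
    using r ch xr bd[OF xr b] unfolding defining_function_def by blast
qed

end

lemma interior_not_boundary:
  assumes "t \<in> interior T"
  shows "\<gamma> t \<notin> boundary A"
proof
  assume "\<gamma> t \<in> boundary A"
  then obtain ch where "ch \<in> A" "\<gamma> t \<in> chart_dom ch" "coord ch (\<gamma> t) $ bindex = 0"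
    unfolding boundary_def by blast
  moreover have "t \<in> T" using assms interior_subset by blast
  ultimately show False
    using boundary_transversal[of ch t] assms by (simp add: times_def in_chart_def)
qed

end

section \<open>The first integral\<close>

context poincare_einstein_geodesic
begin

context
  fixes ch assumes ch: "ch \<in> A"
begin

lemma interior_time:
  assumes "t \<in> times ch" "t \<in> interior T"
  shows "in_chart ch \<gamma> t \<in> interior_ran ch"
  using in_chart_ran[OF ch assms(1)] point_in_chart[OF ch assms(1)] interior_not_boundary[OF assms(2)]
  by (simp add: interior_ran_def)

text \<open>Makes the passage to the Einstein scale available for every metric of the class. The
  right side of the first claim no longer mentions \<open>g\<close>, which is why one constant will
  serve all scales.\<close>

lemma interior_quantity:
  assumes g: "g \<in> conformal_class A g0" and t: "t \<in> times ch" "t \<in> interior T"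
  shows "tensor_quantity T \<gamma> k g ch t = - 1 / (real CARD('n) - 1) * einstein_quantity k T \<gamma> ch t"
    and "\<exists>\<alpha>. \<forall>e. vector_derivative (velocity T (in_chart ch \<gamma>)) (at t within T) $ e
      + (\<Sum>a\<in>UNIV. \<Sum>b\<in>UNIV. christoffel (ge ch) e a b (in_chart ch \<gamma> t)
        * velocity T (in_chart ch \<gamma>) t $ a * velocity T (in_chart ch \<gamma>) t $ b)
      = \<alpha> * velocity T (in_chart ch \<gamma>) t $ e"
proof -
  let ?y = "in_chart ch \<gamma>"
  let ?x = "?y t"
  obtain \<omega> where \<omega>: "smooth_function A \<omega>" "\<And>ch x. ch \<in> A \<Longrightarrow> x \<in> chart_ran ch \<Longrightarrow> g ch x = exp (2 * \<omega> (point ch x)) *\<^sub>R g0 ch x"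
    using g by (auto simp: conformal_class_def)
  note gm = class_metric[OF g]
  have xi: "?x \<in> interior_ran ch" by (rule interior_time[OF t])
  have xr: "?x \<in> chart_ran ch" using xi inner_subset[OF ch] by blast
  \<comment> \<open>\<open>g\<close> is exp(2 \<omega>) times \<open>g0\<close> and the Einstein
    metric is r^-2 times \<open>g0\<close>, so \<open>q\<close> is the factor from \<open>g\<close>
    to the Einstein metric.\<close>
  define q where "q x = inverse (exp (2 * \<omega> (point ch x))) * (1 / (r (point ch x))\<^sup>2)" for x
  have q: "twice_diff (interior_ran ch) q"
    unfolding q_def[abs_def]
  proof (rule twice_diff_mult[OF open_inner[OF ch] inner_halfspace[OF ch] _ twice_diff_inverse_square[OF ch]])
    have "twice_diff (interior_ran ch) (\<lambda>x. exp (2 * \<omega> (point ch x)))"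
      by (rule twice_diff_compose[OF open_inner[OF ch] inner_halfspace[OF ch] twice_diff_function[OF ch \<omega>(1)],
            where h = "\<lambda>z. exp (2 * z)" and h' = "\<lambda>z. 2 * exp (2 * z)" and h'' = "\<lambda>z. 4 * exp (2 * z)"])
        (auto intro!: derivative_eq_intros)
    then show "twice_diff (interior_ran ch) (\<lambda>x. inverse (exp (2 * \<omega> (point ch x))))"
      by (rule twice_diff_inverse[OF open_inner[OF ch] inner_halfspace[OF ch]]) simp
  qed
  have q0: "q z > 0" if "z \<in> interior_ran ch" for z using inner_r[OF ch that] by (simp add: q_def)
  have ge: "ge ch z = q z *\<^sub>R g ch z" if z: "z \<in> interior_ran ch" for z
    using \<omega>(2)[OF ch, of z] z inner_subset[OF ch] by (auto simp: ge_eq[OF ch] q_def)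
  \<comment> \<open>\<sigma> is \<open>r\<close> times the density of \<open>g0\<close>, and the
    density of \<open>g\<close> is exp(-\<omega>) times that of \<open>g0\<close>; so \<sigma> is
    the density of the Einstein metric up to sign.\<close>
  have sq: "(\<sigma> ch z)\<^sup>2 * q z = (scale_density (g ch) z)\<^sup>2" if z: "z \<in> interior_ran ch" for z
  proof -
    have zr: "z \<in> chart_ran ch" using z inner_subset[OF ch] by auto
    let ?E = "exp (2 * \<omega> (point ch z))"
    have "scale_density (g ch) z = ?E powr (- 1 / 2) * scale_density (g0 ch) z"
      by (rule scale_density_rescale[where G="g0 ch" and G'="g ch" and x=z, OF \<omega>(2)[OF ch zr]]) simp
    moreover have "(?E powr (- 1 / 2))\<^sup>2 = inverse ?E"
    proof -
      have "(?E powr (- 1 / 2))\<^sup>2 = ?E powr (- 1 / 2 + - 1 / 2)" by (simp only: power2_eq_square powr_add)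
      also have "- 1 / 2 + - 1 / 2 = (- 1 :: real)" by simp
      also have "?E powr (- 1) = inverse ?E" by (subst powr_minus, subst powr_one) simp_all
      finally show ?thesis .
    qed
    ultimately show ?thesis
      using inner_r[OF ch z] by (simp add: \<sigma>[OF ch zr] q_def power_mult_distrib)
  qed
  have \<sigma>d: "\<sigma> ch differentiable (at ?x within halfspace)"
  proof -
    interpret G: local_metric "interior_ran ch" "g0 ch" by (rule local_metric_inner[OF ch g0])
    have "(\<lambda>x. r (point ch x) * scale_density (g0 ch) x) differentiable (at ?x within halfspace)"
      using twice_diffD(1)[OF twice_diff_function[OF ch] xi] r twice_diffD(1)[OF G.scale_density_twice_diff xi]
      by (intro differentiable_mult) (auto simp: defining_function_def)
    then show ?thesis
      using pd_cong(2)[OF openin_chart_ran[OF ch] xr, of "\<sigma> ch" "\<lambda>x. r (point ch x) * scale_density (g0 ch) x"] \<sigma>[OF ch] by blast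
  qed
  have \<sigma>0: "\<sigma> ch ?x \<noteq> 0"
    using inner_r[OF ch xi] scale_density_pos[where G="g0 ch" and x="?x", OF metric_facts(2)[OF ch g0 xr]] by (simp add: \<sigma>[OF ch xr])
  note main = generalised_geodesic_in_sigma_scale[where y="?y" and K="k ch" and T=T and S="times ch" and G="g ch" and ?G0.0="ge ch" and W="interior_ran ch" and q=q and \<sigma>="\<sigma> ch" and t=t,
      OF nontrivial openin_times[OF ch] smooth_in_chart[OF ch] in_chart_halfspace[OF ch] causal[OF ch g] t(1) card
        local_metric_inner[OF ch gm] local_metric_ge[OF ch] xi twice_diffD(1)[OF q xi] q0[OF xi] ge \<sigma>d \<sigma>0 sq
        k_anti[OF ch xr] cky_inner(1)[OF ch cky g gm xi] wedge[OF ch g t(1)]]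
  show "tensor_quantity T \<gamma> k g ch t = - 1 / (real CARD('n) - 1) * einstein_quantity k T \<gamma> ch t"
    unfolding tensor_quantity_def einstein_quantity_def Let_def by (rule main(1))
  show "\<exists>\<alpha>. \<forall>e. vector_derivative (velocity T ?y) (at t within T) $ e
      + (\<Sum>a\<in>UNIV. \<Sum>b\<in>UNIV. christoffel (ge ch) e a b ?x * velocity T ?y t $ a * velocity T ?y t $ b)
      = \<alpha> * velocity T ?y t $ e"
    by (rule main(2))
qed

lemma einstein_quantity_stationary:
  assumes t: "t \<in> times ch" "t \<in> interior T"
  shows "(einstein_quantity k T \<gamma> ch has_real_derivative 0) (at t)"
proof -
  let ?y = "in_chart ch \<gamma>"
  let ?x = "?y t" and ?v = "velocity T ?y"
  interpret E: local_metric "interior_ran ch" "ge ch" by (rule local_metric_ge[OF ch])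
  have xi: "?x \<in> interior_ran ch" by (rule interior_time[OF t])
  obtain \<Lambda> where \<Lambda>: "Ric (ge ch) i j ?x = \<Lambda> * ge ch ?x $ i $ j" for i j
    using einstein ch xi unfolding einstein_on_def ge_def[symmetric] interior_ran_def by blast
  \<comment> \<open>\<open>cky_form\<close> is a condition at one point, so a trace part may be
    chosen at each point separately.\<close>
  define N where "N x = (SOME N. cky_form (ge ch) (comps (k ch)) x N)" for x
  have N: "cky_form (ge ch) (comps (k ch)) x (N x)" if "x \<in> interior_ran ch" for x
    unfolding N_def by (rule someI_ex[OF cky_ge[OF ch cky g0_in_class that]])
  obtain \<alpha> where \<alpha>: "\<And>e. vector_derivative ?v (at t within T) $ e
      + (\<Sum>a\<in>UNIV. \<Sum>b\<in>UNIV. christoffel (ge ch) e a b ?x * ?v t $ a * ?v t $ b) = \<alpha> * ?v t $ e"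
    using interior_quantity(2)[OF g0_in_class t] by blast
  have atT: "at t within T = at t" using t(2) by (rule at_within_interior)
  have nonnull: "?v t \<bullet> (ge ch ?x *v ?v t) \<noteq> 0"
  proof -
    have "?v t \<bullet> (cmetric (g0 ch) ?x *v ?v t) \<noteq> 0"
      using causal[OF ch g0_in_class t(1)] by (auto simp: causal_sign_def)
    moreover have "cmetric (g0 ch) ?x = ((scale_density (g0 ch) ?x)\<^sup>2 * (r (point ch ?x))\<^sup>2) *\<^sub>R ge ch ?x"
      using inner_r[OF ch xi] by (simp add: cmetric_def ge_eq[OF ch])
    ultimately show ?thesis by (auto simp: scaleR_matrix_vector_assoc[symmetric])
  qed
  have "((\<lambda>s. sgn (?v s \<bullet> (ge ch (?y s) *v ?v s)) * ((\<Sum>a\<in>UNIV. ?v s $ a * (div2 (ge ch) (comps (k ch)) a (?y s) / scale_density (ge ch) (?y s))) /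
     sqrt \<bar>?v s \<bullet> (ge ch (?y s) *v ?v s)\<bar>)) has_real_derivative 0) (at t)"
  proof (rule E.killing_along_pregeodesic[where y="?y" and v="?v" and t=t and K="comps (k ch)", OF card xi twice_diff_tensor[OF ch k_tensor] _ N \<Lambda> _ _ \<alpha> nonnull])
    show "comps (k ch) c b x = - comps (k ch) b c x" if "x \<in> interior_ran ch" for x b c
      by (rule cky_inner(2)[OF ch cky g0_in_class g0 that])
    show "(?y has_vector_derivative ?v t) (at t)"
      using curve_velocity[OF nontrivial openin_times[OF ch] smooth_in_chart[OF ch] t(1)] by (simp only: atT)
    show "(?v has_vector_derivative vector_derivative ?v (at t within T)) (at t)"
      using curve_acceleration[OF nontrivial openin_times[OF ch] smooth_in_chart[OF ch] t(1)] by (simp only: atT)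
  qed
  then show ?thesis by (simp only: einstein_quantity_def[abs_def] Let_def)
qed

end

lemma einstein_quantity_independent:
  assumes "ch \<in> A" "ch' \<in> A" "t \<in> times ch" "t \<in> times ch'" "t \<in> interior T"
  shows "einstein_quantity k T \<gamma> ch t = einstein_quantity k T \<gamma> ch' t"
proof (rule einstein_quantity_chart[OF assms(1,2) k_tensor])
  have tT: "t \<in> T" using assms(3) by (simp add: times_def)
  show "at t within T \<noteq> bot" by (rule nontrivial[OF tT])
  show "openin (top_of_set T) (times ch \<inter> times ch')"
    using openin_times[OF assms(1)] openin_times[OF assms(2)] by (rule openin_Int)
  show "t \<in> times ch \<inter> times ch'" using assms by simp
  show "\<gamma> s \<in> chart_dom ch \<inter> chart_dom ch'" if "s \<in> times ch \<inter> times ch'" for s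
    using that by (simp add: times_def)
  show "(in_chart ch \<gamma> has_vector_derivative velocity T (in_chart ch \<gamma>) t) (at t within T)"
    by (rule curve_velocity[OF nontrivial openin_times[OF assms(1)] smooth_in_chart[OF assms(1)] assms(3)])
  show "in_chart ch \<gamma> t \<in> interior_ran ch" by (rule interior_time[OF assms(1,3,5)])
qed

text \<open>A chart is chosen at each time. By independence of the chart, the resulting function
  agrees near any time with the quantity in one fixed chart, whose derivative vanishes; so it is
  locally constant on the connected interior of \<open>T\<close>.\<close>

lemma einstein_quantity_constant:
  "\<exists>C. \<forall>ch\<in>A. \<forall>t\<in>times ch \<inter> interior T. einstein_quantity k T \<gamma> ch t = C"
proof -
  define chart_at where "chart_at t = (SOME ch. ch \<in> A \<and> \<gamma> t \<in> chart_dom ch)" for t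
  have chart_at: "chart_at t \<in> A \<and> \<gamma> t \<in> chart_dom (chart_at t)" for t
    unfolding chart_at_def by (rule someI_ex) (use chart_cover[of "\<gamma> t"] in blast)
  define F where "F t = einstein_quantity k T \<gamma> (chart_at t) t" for t
  have F: "einstein_quantity k T \<gamma> ch t = F t" if "ch \<in> A" "t \<in> times ch" "t \<in> interior T" for ch t
  proof -
    have "t \<in> times (chart_at t)" using chart_at[of t] that(2) by (simp add: times_def)
    then show ?thesis unfolding F_def using einstein_quantity_independent that chart_at by blast
  qed
  have T: "is_interval T" "interior T \<noteq> {}"
    using geodesic by (auto simp: generalised_geodesic_def regular_curve_def)
  have conn: "connected (interior T)"
    using T(1) by (simp add: convex_connected convex_interior is_interval_convex)
  have loc: "\<forall>a\<in>interior T. eventually (\<lambda>b. F a = F b) (at a within interior T)"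
  proof
    fix a assume a: "a \<in> interior T"
    let ?ch = "chart_at a"
    have ch: "?ch \<in> A" and ta: "a \<in> times ?ch"
      using chart_at[of a] a interior_subset by (auto simp: times_def)
    obtain V where V: "open V" "times ?ch = T \<inter> V" using openin_times[OF ch] openin_open by metis
    have "open (interior T \<inter> V)" "a \<in> interior T \<inter> V" using V a ta by auto
    then obtain e where e: "e > 0" "ball a e \<subseteq> interior T \<inter> V" using open_contains_ball by meson
    have sub: "s \<in> times ?ch \<and> s \<in> interior T" if "s \<in> ball a e" for s
      using that e(2) V(2) interior_subset by blast
    have "(einstein_quantity k T \<gamma> ?ch has_real_derivative 0) (at s within ball a e)" if "s \<in> ball a e" for s
      using einstein_quantity_stationary[OF ch] sub[OF that] has_field_derivative_at_within by blast
    then obtain C where C: "\<And>s. s \<in> ball a e \<Longrightarrow> einstein_quantity k T \<gamma> ?ch s = C"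
      using has_field_derivative_zero_constant[of "ball a e" "einstein_quantity k T \<gamma> ?ch"] by (metis convex_ball)
    have "F s = C" if "s \<in> ball a e" for s
      using F[OF ch, of s] sub[OF that] C[OF that] by simp
    then show "eventually (\<lambda>b. F a = F b) (at a within interior T)"
      using e(1) unfolding eventually_at by (intro exI[of _ e]) (auto simp: dist_commute)
  qed
  obtain t1 where t1: "t1 \<in> interior T" using T(2) by blast
  have "F t = F t1" if "t \<in> interior T" for t
    by (rule connected_local_const[OF conn that t1 loc])
  then show ?thesis using F by (intro exI[of _ "F t1"]) auto
qed

text \<open>At interior times the value is fixed by the Einstein scale. A different value at an end
  point would persist nearby by continuity, and interior times accumulate at every point of
  \<open>T\<close>.\<close>

lemma tensor_quantity_constant:
  "first_integral A (conformal_class A g0) T \<gamma> (tensor_quantity T \<gamma> k)"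
proof -
  obtain C where C: "\<And>ch t. ch \<in> A \<Longrightarrow> t \<in> times ch \<Longrightarrow> t \<in> interior T \<Longrightarrow> einstein_quantity k T \<gamma> ch t = C"
    using einstein_quantity_constant by auto
  define C' where "C' = - 1 / (real CARD('n) - 1) * C"
  have int: "tensor_quantity T \<gamma> k g ch t = C'" if "g \<in> conformal_class A g0" "ch \<in> A" "t \<in> times ch" "t \<in> interior T" for g ch t
    using interior_quantity(1)[OF that(2,1,3,4)] C[OF that(2-4)] by (simp only: C'_def)
  have "tensor_quantity T \<gamma> k g ch t = C'" if g: "g \<in> conformal_class A g0" and ch: "ch \<in> A" and t: "t \<in> times ch" for g ch t
  proof (rule ccontr)
    assume ne: "tensor_quantity T \<gamma> k g ch t \<noteq> C'"
    note gm = class_metric[OF g]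
    have "smooth_on (chart_ran ch) (k ch)" using k_tensor ch by (simp add: tensor2_field_def)
    then have "continuous_on (times ch) (tensor_quantity T \<gamma> k g ch)"
      unfolding tensor_quantity_def[abs_def] Let_def
      by (intro continuous_on_tensor_quantity[OF openin_chart_ran[OF ch] metric_facts(1)[OF ch gm] metric_facts(2)[OF ch gm]
          nontrivial openin_times[OF ch] smooth_in_chart[OF ch] _ causal[OF ch g] _ k_anti[OF ch]])
        (use in_chart_ran[OF ch] in auto)
    then have "openin (top_of_set (times ch)) (times ch \<inter> tensor_quantity T \<gamma> k g ch -` (- {C'}))"
      by (rule continuous_openin_preimage_gen) auto
    then obtain Q where Q: "open Q" "times ch \<inter> tensor_quantity T \<gamma> k g ch -` (- {C'}) = times ch \<inter> Q"
      using openin_open by metis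
    obtain V where V: "open V" "times ch = T \<inter> V" using openin_times[OF ch] openin_open by metis
    have tOV: "t \<in> Q \<inter> V" using Q(2) V(2) t ne by auto
    have T: "convex T" "interior T \<noteq> {}"
      using geodesic by (auto simp: generalised_geodesic_def regular_curve_def is_interval_convex)
    \<comment> \<open>A convex set with nonempty interior lies in the closure of its interior; the
      nonempty interior is part of the notion of a regular curve.\<close>
    have "t \<in> closure (interior T)"
      using convex_closure_interior[OF T] t closure_subset by (auto simp: times_def)
    then obtain s where s: "s \<in> interior T" "s \<in> Q \<inter> V"
      using tOV Q(1) V(1) by (metis closure_iff_nhds_not_empty disjoint_iff open_Int order_refl)
    then have st: "s \<in> times ch" using V(2) interior_subset by blast
    then have "s \<in> times ch \<inter> tensor_quantity T \<gamma> k g ch -` (- {C'})" unfolding Q(2) using s by blast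
    then show False using int[OF g ch st s(1)] by simp
  qed
  then show ?thesis
    unfolding first_integral_def by (intro exI[of _ C']) (auto simp: times_def)
qed

lemma tractor_quantity_eq:
  assumes g: "g \<in> conformal_class A g0" and ch: "ch \<in> A" and t: "t \<in> times ch"
  shows "tractor_quantity T \<gamma> k g ch t = 6 * tensor_quantity T \<gamma> k g ch t"
proof -
  have tT: "t \<in> T" using t by (simp add: times_def)
  note xr = in_chart_ran[OF ch t]
  show ?thesis
    unfolding tractor_quantity_def tensor_quantity_def Let_def
    by (rule tractor_eq_tensor[where G="g ch" and K="k ch" and T=T and y="in_chart ch \<gamma>" and t=t, OF nontrivial tT causal[OF ch g t] metric_facts(2)[OF ch class_metric[OF g] xr]
          metric_facts(3)[OF ch class_metric[OF g] xr] k_anti[OF ch xr]])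
qed

end

theorem theorem4:
  fixes A :: "('p::{t2_space, second_countable_topology}, 'n::finite) chart set"
    and c :: "('p, 'n) tensor2 set"
    and \<sigma> :: "('p, 'n) density"
    and k :: "('p, 'n) tensor2"
    and T :: "real set"
    and \<gamma> :: "real \<Rightarrow> 'p"
  assumes "CARD('n) \<ge> 3"
    and "poincare_einstein A c \<sigma>"
    and "generalised_geodesic A c \<sigma> T \<gamma>"
    and "conformal_killing_yano A c k"
  shows "first_integral A c T \<gamma> (tractor_quantity T \<gamma> k) \<and>
    first_integral A c T \<gamma> (tensor_quantity T \<gamma> k) \<and>
    (\<forall>g\<in>c. \<forall>ch\<in>A. \<forall>t\<in>T. \<gamma> t \<in> chart_dom ch \<longrightarrow>
       tractor_quantity T \<gamma> k g ch t = 6 * tensor_quantity T \<gamma> k g ch t)"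
proof -
  obtain g0 r where g0: "metric A g0" "defining_function A r"
    "einstein_on A (- boundary A) (rescale (\<lambda>p. 1 / (r p)\<^sup>2) g0)"
    and c: "c = conformal_class A g0"
    and \<sigma>: "\<forall>ch\<in>A. \<forall>x\<in>chart_ran ch. \<sigma> ch x = r (point ch x) * scale_density (g0 ch) x"
    and A: "smooth_manifold A"
    using assms(2) unfolding poincare_einstein_def by blast
  interpret poincare_einstein_geodesic A g0 r \<sigma> k T \<gamma>
    by unfold_locales (use A g0 \<sigma> assms c in auto)
  have six: "\<forall>g\<in>c. \<forall>ch\<in>A. \<forall>t\<in>T. \<gamma> t \<in> chart_dom ch \<longrightarrow>
       tractor_quantity T \<gamma> k g ch t = 6 * tensor_quantity T \<gamma> k g ch t"
    using tractor_quantity_eq by (auto simp: c times_def)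
  have tensor: "first_integral A c T \<gamma> (tensor_quantity T \<gamma> k)"
    unfolding c by (rule tensor_quantity_constant)
  then obtain C where "\<forall>g\<in>c. \<forall>ch\<in>A. \<forall>t\<in>T. \<gamma> t \<in> chart_dom ch \<longrightarrow> tensor_quantity T \<gamma> k g ch t = C"
    unfolding first_integral_def by blast
  with six have "first_integral A c T \<gamma> (tractor_quantity T \<gamma> k)"
    unfolding first_integral_def by (intro exI[of _ "6 * C"]) auto
  with tensor six show ?thesis by blast
qed

end
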